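(* Let $\Phi$ be a symmetric norming function, let $1<q\leqslant2\leqslant p<+\infty$ satisfy $\frac1p+\frac1q=1$, and let $\mathscr{A}\in L^q_s(\Omega,\mu,\mathcal{B}(\mathcal{H}))$ and $\mathscr{B}\in L^p_G(\Omega,\mu,\mathcal{B}(\mathcal{H}))$ be such that $\int_\Omega|\mathscr{B}|^p\,d\mu\in\mathcal{C}_\Phi^{(\circ)}(\mathcal{H})$. Then for every $E\in\mathfrak{M}$ we have $$\nu_{\mathscr{A}^*\mathscr{B}}(E)=\int_E\mathscr{A}^*\mathscr{B}\,d\mu\in\mathcal{C}_{\Phi^{(p)}}^{(\circ)}(\mathcal{H})$$ and $$\left\|\int_E\mathscr{A}^*\mathscr{B}\,d\mu\right\|_{\Phi^{(p)}}\leqslant\|\mathscr{A}\|_{L^q_s}\cdot\left\|\sqrt[p]{\int_E|\mathscr{B}|^p\,d\mu}\right\|_{\Phi^{(p)}}.$$ Furthermore, the induced vector measure $\nu_{\mathscr{A}^*\mathscr{B}}\colon\mathfrak{M}\to\mathcal{C}_{\Phi^{(p)}}^{(\circ)}(\mathcal{H})$ is countably additive (with respect to the norm $\|\cdot\|_{\Phi^{(p)}}$).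
   Context: $\mathcal{H}$ is an infinite-dimensional separable complex Hilbert space, $\mathcal{B}(\mathcal{H})$ the bounded linear operators on it, $|A|=\sqrt{A^*A}$. $(\Omega,\mathfrak{M},\mu)$ is a measure space with complete measure $\mu$. Symmetric norming (s.n.) function: a norm $\Phi$ on finitely supported sequences with $\Phi(1,0,0,\dots)=1$, depending only on the absolute values of the entries and invariant under permutations of the entries. It is extended by $\Phi(a)=\lim_n\Phi(a_1,\dots,a_n,0,0,\dots)$, and $\mathfrak{c}_\Phi$ is the set of complex sequences $a$ converging to $0$ with $\Phi(a)<+\infty$. $\mathcal{C}_\Phi(\mathcal{H})$ is the ideal of compact operators $A$ whose singular value sequence $(s_n(A))_{n\ge1}$ lies in $\mathfrak{c}_\Phi$, with norm $\|A\|_\Phi=\Phi((s_n(A))_n)$. $\mathcal{C}_\Phi^{(\circ)}(\mathcal{H})$ is the $\|\cdot\|_\Phi$-closure of the finite-rank operators in $\mathcal{C}_\Phi(\mathcal{H})$. For $1\le p<\infty$ the $p$-modification of $\Phi$ is the s.n. function $\Phi^{(p)}((z_n)_n)=\Phi((|z_n|^p)_n)^{1/p}$. A scalar function on $\Omega$ is $\mu$-measurable if it is a $\mu$-a.e. limit of $\mu$-simple functions $\sum_{k=1}^m x_k\chi_{A_k}$ with $A_k\in\mathfrak{M}$ disjoint of finite measure. $\mathscr{A}\colon\Omega\to\mathcal{B}(\mathcal{H})$, $t\mapsto\mathscr{A}_t$, is weakly$^*$ $\mu$-measurable (weakly$^*$ integrable) if for every $f\in\mathcal{H}$ the function $t\mapsto\langle\mathscr{A}_tf,f\rangle$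 is $\mu$-measurable (resp. also integrable). In the integrable case the weak$^*$ integral $\int_E\mathscr{A}\,d\mu\in\mathcal{B}(\mathcal{H})$, $E\in\mathfrak{M}$, is the unique operator with $\langle(\int_E\mathscr{A}\,d\mu)f,g\rangle=\int_E\langle\mathscr{A}_tf,g\rangle\,d\mu(t)$ for all $f,g\in\mathcal{H}$. All operator-valued integrals here are weak$^*$ integrals. Operations are pointwise: $(\mathscr{A}^*\mathscr{B})_t=\mathscr{A}_t^*\mathscr{B}_t$, $(|\mathscr{B}|^p)_t=|\mathscr{B}_t|^p$. $L^q_s(\Omega,\mu,\mathcal{B}(\mathcal{H}))$ is the space of weakly$^*$ $\mu$-measurable $\mathscr{A}$ with $\int_\Omega\|\mathscr{A}_tf\|^q\,d\mu(t)<+\infty$ for all $f\in\mathcal{H}$, normed by $\|\mathscr{A}\|_{L^q_s}=\sup_{\|f\|=1}\left(\int_\Omega\|\mathscr{A}_tf\|^q\,d\mu(t)\right)^{1/q}$. $L^p_G(\Omega,\mu,\mathcal{B}(\mathcal{H}))$ is the class of weakly$^*$ $\mu$-measurable $\mathscr{B}$ such that $|\mathscr{B}|^p$ is weakly$^*$ integrable. A vector measure $\nu\colon\mathfrak{M}\to X$ into a Banach space is countably additive if $\nu(\bigsqcup_nE_n)=\sum_n\nu(E_n)$ in norm for every sequence of pairwise disjoint $E_n\in\mathfrak{M}$. *)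

theory Defs
  imports "HOL-Analysis.Analysis" "HOL-Computational_Algebra.Polynomial"
begin

section \<open>Complex Hilbert spaces and their bounded operators\<close>

text \<open>
  The library has no complex inner products. A complex Hilbert space is rendered as a complete real
  inner product space carrying a complex scalar multiplication extending the real one and a complex
  inner product, linear in the first argument, whose real part is the real inner product; so
  \<open>norm x = sqrt (Re (cinner x x))\<close> and norm, metric and topology are those of \<^term>\<open>cinner\<close>.
\<close>

class complex_hilbert = real_inner + complete_space +
  fixes scaleC :: "complex \<Rightarrow> 'a \<Rightarrow> 'a" (infixr "*\<^sub>C" 75)
    and cinner :: "'a \<Rightarrow> 'a \<Rightarrow> complex"
  assumes scaleC_add_right: "c *\<^sub>C (x + y) = c *\<^sub>C x + c *\<^sub>C y"
    and scaleC_add_left: "(c + d) *\<^sub>C x = c *\<^sub>C x + d *\<^sub>C x"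
    and scaleC_scaleC: "c *\<^sub>C d *\<^sub>C x = (c * d) *\<^sub>C x"
    and scaleC_of_real: "complex_of_real r *\<^sub>C x = r *\<^sub>R x"
    and cinner_add_left: "cinner (x + y) z = cinner x z + cinner y z"
    and cinner_scaleC_left: "cinner (c *\<^sub>C x) y = c * cinner x y"
    and cinner_commute: "cinner x y = cnj (cinner y x)"
    and Re_cinner: "Re (cinner x y) = inner x y"

global_interpretation complex_vector:
  vector_space "scaleC :: complex \<Rightarrow> 'a \<Rightarrow> 'a::complex_hilbert"
proof unfold_locales
  show "1 *\<^sub>C x = x" for x :: 'a
    using scaleC_of_real[of 1 x] by simp
qed (simp_all add: scaleC_add_right scaleC_add_left scaleC_scaleC)

text \<open>
  Elements of \<^typ>\<open>'h \<Rightarrow>\<^sub>L 'h\<close> are only real-linear, so the bounded (complex linear) operators form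
  a subset of this type. The norm of the type is the operator norm.
\<close>

definition bounded_ops :: "('h::complex_hilbert \<Rightarrow>\<^sub>L 'h) set" where
  "bounded_ops = {A. \<forall>c x. blinfun_apply A (c *\<^sub>C x) = c *\<^sub>C blinfun_apply A x}"

definition adj :: "('h::complex_hilbert \<Rightarrow>\<^sub>L 'h) \<Rightarrow> 'h \<Rightarrow>\<^sub>L 'h" where
  "adj A = (THE B. B \<in> bounded_ops \<and>
     (\<forall>x y. cinner (blinfun_apply A x) y = cinner x (blinfun_apply B y)))"

definition poly_op :: "real poly \<Rightarrow> ('h::complex_hilbert \<Rightarrow>\<^sub>L 'h) \<Rightarrow> 'h \<Rightarrow>\<^sub>L 'h" where
  "poly_op P A = (\<Sum>i\<le>degree P. coeff P i *\<^sub>R (((o\<^sub>L) A ^^ i) id_blinfun))"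

text \<open>
  Continuous functional calculus \<open>f(A)\<close> for a positive operator \<open>A\<close> and \<open>f\<close> continuous on
  \<open>[0, \<parallel>A\<parallel>]\<close>, an interval containing the spectrum of \<open>A\<close>: the operator norm limit of \<open>P\<^sub>n(A)\<close> for
  every sequence of polynomials \<open>P\<^sub>n\<close> converging to \<open>f\<close> uniformly on that interval.
\<close>

definition op_fun :: "(real \<Rightarrow> real) \<Rightarrow> ('h::complex_hilbert \<Rightarrow>\<^sub>L 'h) \<Rightarrow> 'h \<Rightarrow>\<^sub>L 'h" where
  "op_fun f A = (THE T. \<forall>P :: nat \<Rightarrow> real poly.
     uniform_limit {0..norm A} (\<lambda>n. poly (P n)) f sequentially \<longrightarrow>
     (\<lambda>n. poly_op (P n) A) \<longlonglongrightarrow> T)"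

definition op_abs :: "('h::complex_hilbert \<Rightarrow>\<^sub>L 'h) \<Rightarrow> 'h \<Rightarrow>\<^sub>L 'h" where
  "op_abs A = op_fun sqrt (adj A o\<^sub>L A)"

definition op_powr :: "('h::complex_hilbert \<Rightarrow>\<^sub>L 'h) \<Rightarrow> real \<Rightarrow> 'h \<Rightarrow>\<^sub>L 'h" where
  "op_powr A r = op_fun (\<lambda>x. x powr r) A"

definition compact_op :: "('h::complex_hilbert \<Rightarrow>\<^sub>L 'h) \<Rightarrow> bool" where
  "compact_op A \<longleftrightarrow> compact (closure (blinfun_apply A ` cball 0 1))"

definition finite_rank :: "('h::complex_hilbert \<Rightarrow>\<^sub>L 'h) \<Rightarrow> bool" where
  "finite_rank A \<longleftrightarrow> (\<exists>S. finite S \<and> range (blinfun_apply A) \<subseteq> complex_vector.span S)"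

text \<open>
  The singular values of a compact operator \<open>A\<close>: the positive eigenvalues of \<open>|A|\<close> in nonincreasing
  order, repeated according to (complex) multiplicity, followed by zeros if \<open>A\<close> has finite rank.
  The index starts at 0, so \<open>sing_vals A n\<close> is \<open>s\<^bsub>n+1\<^esub>(A)\<close>.
\<close>

definition sing_vals :: "('h::complex_hilbert \<Rightarrow>\<^sub>L 'h) \<Rightarrow> nat \<Rightarrow> real" where
  "sing_vals A = (THE s. decseq s \<and> s \<longlonglongrightarrow> 0 \<and>
     (\<forall>l>0. card {n. s n = l} =
        complex_vector.dim {x. blinfun_apply (op_abs A) x = l *\<^sub>R x}))"

section \<open>Symmetric norming functions and their ideals\<close>

definition fin_supp :: "(nat \<Rightarrow> complex) \<Rightarrow> bool" where
  "fin_supp a \<longleftrightarrow> finite {n. a n \<noteq> 0}"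

text \<open>A symmetric norming function only matters on finitely supported sequences.\<close>

definition sn_function :: "((nat \<Rightarrow> complex) \<Rightarrow> real) \<Rightarrow> bool" where
  "sn_function \<Phi> \<longleftrightarrow>
     (\<forall>a. fin_supp a \<longrightarrow> 0 \<le> \<Phi> a \<and> (\<Phi> a = 0 \<longleftrightarrow> a = (\<lambda>_. 0))) \<and>
     (\<forall>a c. fin_supp a \<longrightarrow> \<Phi> (\<lambda>n. c * a n) = cmod c * \<Phi> a) \<and>
     (\<forall>a b. fin_supp a \<longrightarrow> fin_supp b \<longrightarrow> \<Phi> (\<lambda>n. a n + b n) \<le> \<Phi> a + \<Phi> b) \<and>
     \<Phi> (\<lambda>n. if n = 0 then 1 else 0) = 1 \<and>
     (\<forall>a. fin_supp a \<longrightarrow> \<Phi> a = \<Phi> (\<lambda>n. of_real (cmod (a n)))) \<and>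
     (\<forall>a \<pi>. fin_supp a \<longrightarrow> bij \<pi> \<longrightarrow> \<Phi> (a \<circ> \<pi>) = \<Phi> a)"

text \<open>The extension to all sequences takes the value \<open>\<infinity>\<close>, hence is \<^typ>\<open>ennreal\<close>-valued.\<close>

definition sn_ext :: "((nat \<Rightarrow> complex) \<Rightarrow> real) \<Rightarrow> (nat \<Rightarrow> complex) \<Rightarrow> ennreal" where
  "sn_ext \<Phi> a = lim (\<lambda>n. ennreal (\<Phi> (\<lambda>k. if k < n then a k else 0)))"

definition p_mod :: "((nat \<Rightarrow> complex) \<Rightarrow> real) \<Rightarrow> real \<Rightarrow> (nat \<Rightarrow> complex) \<Rightarrow> real" where
  "p_mod \<Phi> p z = \<Phi> (\<lambda>n. of_real (cmod (z n) powr p)) powr (1 / p)"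

definition c_space :: "((nat \<Rightarrow> complex) \<Rightarrow> real) \<Rightarrow> (nat \<Rightarrow> complex) set" where
  "c_space \<Phi> = {a. a \<longlonglongrightarrow> 0 \<and> sn_ext \<Phi> a < \<infinity>}"

definition sn_norm :: "((nat \<Rightarrow> complex) \<Rightarrow> real) \<Rightarrow> ('h::complex_hilbert \<Rightarrow>\<^sub>L 'h) \<Rightarrow> ennreal" where
  "sn_norm \<Phi> A = sn_ext \<Phi> (\<lambda>n. of_real (sing_vals A n))"

definition sn_ideal :: "((nat \<Rightarrow> complex) \<Rightarrow> real) \<Rightarrow> ('h::complex_hilbert \<Rightarrow>\<^sub>L 'h) set" where
  "sn_ideal \<Phi> = {A \<in> bounded_ops. compact_op A \<and> (\<lambda>n. of_real (sing_vals A n)) \<in> c_space \<Phi>}"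

definition sn_ideal0 :: "((nat \<Rightarrow> complex) \<Rightarrow> real) \<Rightarrow> ('h::complex_hilbert \<Rightarrow>\<^sub>L 'h) set" where
  "sn_ideal0 \<Phi> = {A \<in> sn_ideal \<Phi>. \<forall>\<epsilon>>0. \<exists>F \<in> sn_ideal \<Phi>. finite_rank F \<and> sn_norm \<Phi> (A - F) < \<epsilon>}"

section \<open>Weak* integration\<close>

definition mu_measurable :: "'w measure \<Rightarrow> ('w \<Rightarrow> complex) \<Rightarrow> bool" where
  "mu_measurable M f \<longleftrightarrow> (\<exists>s :: nat \<Rightarrow> 'w \<Rightarrow> complex.
     (\<forall>n. Bochner_Integration.simple_bochner_integrable M (s n)) \<and> (AE t in M. (\<lambda>n. s n t) \<longlonglongrightarrow> f t))"

definition weak_measurable :: "'w measure \<Rightarrow> ('w \<Rightarrow> 'h::complex_hilbert \<Rightarrow>\<^sub>L 'h) \<Rightarrow> bool" where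
  "weak_measurable M A \<longleftrightarrow> (\<forall>t\<in>space M. A t \<in> bounded_ops) \<and>
     (\<forall>f. mu_measurable M (\<lambda>t. cinner (blinfun_apply (A t) f) f))"

definition weak_integrable :: "'w measure \<Rightarrow> ('w \<Rightarrow> 'h::complex_hilbert \<Rightarrow>\<^sub>L 'h) \<Rightarrow> bool" where
  "weak_integrable M A \<longleftrightarrow> weak_measurable M A \<and>
     (\<forall>f. integrable M (\<lambda>t. cinner (blinfun_apply (A t) f) f))"

definition weak_integral ::
    "'w measure \<Rightarrow> 'w set \<Rightarrow> ('w \<Rightarrow> 'h::complex_hilbert \<Rightarrow>\<^sub>L 'h) \<Rightarrow> 'h \<Rightarrow>\<^sub>L 'h" where
  "weak_integral M E A = (THE T. T \<in> bounded_ops \<and>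
     (\<forall>f g. cinner (blinfun_apply T f) g = (LINT t:E|M. cinner (blinfun_apply (A t) f) g)))"

definition Ls_space :: "'w measure \<Rightarrow> real \<Rightarrow> ('w \<Rightarrow> 'h::complex_hilbert \<Rightarrow>\<^sub>L 'h) set" where
  "Ls_space M q = {A. weak_measurable M A \<and>
     (\<forall>f. integrable M (\<lambda>t. norm (blinfun_apply (A t) f) powr q))}"

definition Ls_norm :: "'w measure \<Rightarrow> real \<Rightarrow> ('w \<Rightarrow> 'h::complex_hilbert \<Rightarrow>\<^sub>L 'h) \<Rightarrow> real" where
  "Ls_norm M q A = (SUP f\<in>{f. norm f = 1}.
     (LINT t|M. norm (blinfun_apply (A t) f) powr q) powr (1 / q))"

definition LG_space :: "'w measure \<Rightarrow> real \<Rightarrow> ('w \<Rightarrow> 'h::complex_hilbert \<Rightarrow>\<^sub>L 'h) set" where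
  "LG_space M p = {B. weak_measurable M B \<and> weak_integrable M (\<lambda>t. op_powr (op_abs (B t)) p)}"

definition sn_countably_additive ::
    "'w measure \<Rightarrow> ((nat \<Rightarrow> complex) \<Rightarrow> real) \<Rightarrow> ('w set \<Rightarrow> 'h::complex_hilbert \<Rightarrow>\<^sub>L 'h) \<Rightarrow> bool" where
  "sn_countably_additive M \<Phi> \<nu> \<longleftrightarrow> (\<forall>E :: nat \<Rightarrow> 'w set.
     range E \<subseteq> sets M \<longrightarrow> disjoint_family E \<longrightarrow>
     (\<lambda>n. sn_norm \<Phi> (\<nu> (\<Union>i. E i) - (\<Sum>i<n. \<nu> (E i)))) \<longlonglongrightarrow> 0)"

end

theory Submission
  imports Defs
    "HOL-Computational_Algebra.Fundamental_Theorem_Algebra"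
    "HOL-Combinatorics.Transposition"
begin

text \<open>
  Write \<open>X\<close> for the integral of \<open>A\<^sup>* B\<close> over \<open>E\<close>, \<open>T\<close> for that of \<open>|B|\<^sup>p\<close>, and \<open>L\<close> for the norm of
  \<open>A\<close>. Hoelder's inequality and Jensen's inequality \<open>\<parallel>B\<^sub>t f\<parallel>\<^sup>p \<le> \<langle>|B\<^sub>t|\<^sup>p f, f\<rangle>\<close> for \<open>\<parallel>f\<parallel> \<le> 1\<close>
  give the pointwise estimate \<open>\<parallel>X f\<parallel>\<^sup>p \<le> L\<^sup>p \<langle>T f, f\<rangle>\<close>. Summing it over right singular vectors of
  \<open>X\<close> and using Ky Fan's maximum principle, the sequence \<open>s\<^sub>n(X)\<^sup>p\<close> is weakly majorized by
  \<open>L\<^sup>p s\<^sub>n(T)\<close>, and a symmetric norming function is monotone under weak majorization; this is the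
  norm inequality. Restricting the estimate to the complement of the first \<open>r\<close> eigenvectors of the
  integral of \<open>|B|\<^sup>p\<close> over \<open>\<Omega>\<close> replaces \<open>s\<^sub>n(T)\<close> by a tail, whose norm is small because that
  integral lies in the closure of the finite rank operators. This approximates \<open>X\<close> by operators of
  finite rank and, together with dominated convergence on the span of these eigenvectors, yields
  countable additivity.
\<close>

section \<open>Complex inner products and adjoints\<close>

text \<open>For \<open>p > 2\<close> the pointwise estimate has degree \<open>p\<close> in
  \<open>f\<close> on the left and degree 2 on the right, so it lives on the unit ball. This shapes
  its uses: it is applied to orthonormal vectors, to halved differences and to residuals of
  projections, all of norm at most 1. Norms are compared for \<open>p\<close>-th powers of singular
  values under \<Phi> itself, and the root is taken last. The restriction \<open>p\<close> \<ge> 2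
  makes \<open>u powr (p / 2)\<close> convex, so that the tangent in Jensen's inequality involves
  only \<open>|B|\<close> squared, whose form is the squared norm of \<open>B f\<close>. Adjoints,
  functional calculus, singular values and weak* integrals are definite descriptions, so each has to
  be shown to exist uniquely. The key to the calculus is that a polynomial nonnegative on
  \<open>{0..norm S}\<close> has a nonnegative form at \<open>S\<close>; it is proved by splitting
  polynomials over the complex numbers. The norm of \<open>A\<close> is a supremum of reals, and its
  boundedness, like the existence of the integral of \<open>|B|\<close> to the power
  \<open>p\<close>, rests on a Baire category argument.\<close>

instance complex_hilbert \<subseteq> banach ..

lemma cinner_add_right: "cinner x (y + z) = cinner x y + cinner x (z::'h::complex_hilbert)"
  by (metis cinner_add_left cinner_commute complex_cnj_add)

lemma cinner_scaleC_right: "cinner x (c *\<^sub>C y) = cnj c * cinner x (y::'h::complex_hilbert)"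
  by (metis cinner_scaleC_left cinner_commute complex_cnj_mult)

lemma cinner_scaleR_left: "cinner (r *\<^sub>R x) y = of_real r * cinner x (y::'h::complex_hilbert)"
  by (metis cinner_scaleC_left scaleC_of_real)

lemma cinner_scaleR_right: "cinner x (r *\<^sub>R y) = of_real r * cinner x (y::'h::complex_hilbert)"
  using cinner_scaleC_right[of x "of_real r" y] by (simp add: scaleC_of_real)

lemma cinner_zero_left [simp]: "cinner 0 (y::'h::complex_hilbert) = 0"
  using cinner_scaleR_left[of 0 y y] by simp

lemma cinner_zero_right [simp]: "cinner (y::'h::complex_hilbert) 0 = 0"
  using cinner_scaleR_right[of y 0 y] by simp

lemma cinner_minus_left: "cinner (- x) (y::'h::complex_hilbert) = - cinner x y"
  using cinner_scaleR_left[of "-1" x y] by simp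

lemma cinner_minus_right: "cinner x (- y::'h::complex_hilbert) = - cinner x y"
  using cinner_scaleR_right[of x "-1" y] by simp

lemma cinner_diff_left: "cinner (x - y) (z::'h::complex_hilbert) = cinner x z - cinner y z"
  by (simp only: diff_conv_add_uminus cinner_add_left cinner_minus_left)

lemma cinner_diff_right: "cinner x (y - z::'h::complex_hilbert) = cinner x y - cinner x z"
  by (simp only: diff_conv_add_uminus cinner_add_right cinner_minus_right)

lemma cinner_sum_left: "cinner (\<Sum>i\<in>I. f i) (z::'h::complex_hilbert) = (\<Sum>i\<in>I. cinner (f i) z)"
  by (induction I rule: infinite_finite_induct) (simp_all add: cinner_add_left)

lemma cinner_sum_right: "cinner z (\<Sum>i\<in>I. f i :: 'h::complex_hilbert) = (\<Sum>i\<in>I. cinner z (f i))"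
  by (induction I rule: infinite_finite_induct) (simp_all add: cinner_add_right)

lemmas cinner_simps = cinner_add_left cinner_add_right cinner_diff_left cinner_diff_right
  cinner_minus_left cinner_minus_right cinner_scaleC_left cinner_scaleC_right
  cinner_scaleR_left cinner_scaleR_right

lemma cinner_self: "cinner x x = of_real ((norm (x::'h::complex_hilbert))\<^sup>2)"
proof -
  have "cnj (cinner x x) = cinner x x"
    using cinner_commute[of x x] by simp
  hence "Im (cinner x x) = 0"
    by (simp add: complex_eq_iff)
  thus ?thesis
    by (simp add: complex_eq_iff Re_cinner power2_norm_eq_inner)
qed

lemma norm_scaleC: "norm (c *\<^sub>C (x::'h::complex_hilbert)) = cmod c * norm x"
proof -
  have "(of_real ((norm (c *\<^sub>C x))\<^sup>2) :: complex) = c * cnj c * cinner x x"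
    by (simp only: cinner_self[symmetric] cinner_scaleC_left cinner_scaleC_right)
      (simp add: mult_ac)
  also have "\<dots> = of_real ((cmod c)\<^sup>2 * (norm x)\<^sup>2)"
    by (simp only: cinner_self complex_norm_square of_real_mult)
  finally have "(norm (c *\<^sub>C x))\<^sup>2 = (cmod c)\<^sup>2 * (norm x)\<^sup>2"
    by (simp only: of_real_eq_iff)
  thus ?thesis by (simp add: power2_eq_iff_nonneg flip: power_mult_distrib)
qed

lemma cmod_eq_rotate: "\<exists>c. cmod c = 1 \<and> of_real (cmod z) = c * z"
proof (cases "z = 0")
  case True
  thus ?thesis by (intro exI[of _ 1]) simp
next
  case False
  have "cnj z / of_real (cmod z) * z = of_real (cmod z)"
    using False complex_norm_square[of z] by (simp add: field_simps power2_eq_square)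
  moreover have "cmod (cnj z / of_real (cmod z)) = 1"
    using False by (simp add: norm_divide)
  ultimately show ?thesis by metis
qed

lemma cmod_cinner_le: "cmod (cinner x y) \<le> norm x * norm (y::'h::complex_hilbert)"
proof -
  obtain c where c: "cmod c = 1" "of_real (cmod (cinner x y)) = c * cinner x y"
    using cmod_eq_rotate by blast
  hence "cmod (cinner x y) = Re (cinner (c *\<^sub>C x) y)"
    by (metis Re_complex_of_real cinner_scaleC_left)
  also have "\<dots> \<le> norm (c *\<^sub>C x) * norm y"
    by (simp add: Re_cinner norm_cauchy_schwarz)
  finally show ?thesis by (simp add: norm_scaleC c)
qed

lemma bounded_bilinear_cinner: "bounded_bilinear (cinner :: 'h::complex_hilbert \<Rightarrow> 'h \<Rightarrow> complex)"
  by standard (auto simp: cinner_simps scaleR_conv_of_real intro!: exI[of _ 1] cmod_cinner_le)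

lemmas tendsto_cinner [tendsto_intros] = bounded_bilinear.tendsto[OF bounded_bilinear_cinner]

lemma bounded_linear_scaleC: "bounded_linear (\<lambda>x::'h::complex_hilbert. c *\<^sub>C x)"
proof (rule bounded_linear_intro)
  show "c *\<^sub>C r *\<^sub>R x = r *\<^sub>R c *\<^sub>C x" for r and x :: 'h
    by (simp add: scaleC_of_real[symmetric] mult_ac)
  show "norm (c *\<^sub>C x) \<le> norm x * cmod c" for x :: 'h
    by (simp add: norm_scaleC mult.commute)
qed (rule scaleC_add_right)

lemma scaleC_scaleR_commute: "c *\<^sub>C r *\<^sub>R x = r *\<^sub>R c *\<^sub>C (x::'h::complex_hilbert)"
  using bounded_linear_scaleC linear_simps(5) by blast

lemma cinner_eqI:
  assumes "\<And>z. cinner x z = cinner (y::'h::complex_hilbert) z" shows "x = y"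
proof -
  have "cinner (x - y) (x - y) = 0" using assms by (simp add: cinner_diff_left)
  thus ?thesis by (simp add: cinner_self)
qed

section \<open>Complex linear operators, representation theorems and adjoints\<close>

lemma bounded_opsD: "A \<in> bounded_ops \<Longrightarrow> A (c *\<^sub>C x) = c *\<^sub>C A x"
  by (simp add: bounded_ops_def)

lemma bounded_ops_comp: "A \<in> bounded_ops \<Longrightarrow> B \<in> bounded_ops \<Longrightarrow> A o\<^sub>L B \<in> bounded_ops"
  by (simp add: bounded_ops_def)

lemma bounded_ops_add: "A \<in> bounded_ops \<Longrightarrow> B \<in> bounded_ops \<Longrightarrow> A + B \<in> bounded_ops"
  by (simp add: bounded_ops_def blinfun.add_left scaleC_add_right)

lemma bounded_ops_scaleR: "A \<in> bounded_ops \<Longrightarrow> r *\<^sub>R A \<in> bounded_ops"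
  by (simp add: bounded_ops_def blinfun.scaleR_left scaleC_scaleR_commute)

lemma bounded_ops_id: "id_blinfun \<in> bounded_ops"
  by (simp add: bounded_ops_def)

lemma bounded_ops_diff: "A \<in> bounded_ops \<Longrightarrow> B \<in> bounded_ops \<Longrightarrow> A - B \<in> bounded_ops"
  using bounded_ops_add[of A "(-1) *\<^sub>R B"] bounded_ops_scaleR[of B "-1"] by simp

lemma bounded_ops_0: "0 \<in> bounded_ops"
  by (simp add: bounded_ops_def)

lemma bounded_ops_tendsto:
  assumes "\<And>n::nat. X n \<in> bounded_ops" "X \<longlonglongrightarrow> T" shows "T \<in> bounded_ops"
  unfolding bounded_ops_def
proof (intro CollectI allI)
  fix c x
  have 1: "(\<lambda>n. X n (c *\<^sub>C x)) \<longlonglongrightarrow> T (c *\<^sub>C x)"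
    by (intro tendsto_intros assms)
  have "(\<lambda>n. c *\<^sub>C X n x) \<longlonglongrightarrow> c *\<^sub>C T x"
    by (intro bounded_linear.tendsto[OF bounded_linear_scaleC] tendsto_intros assms)
  moreover have "(\<lambda>n. c *\<^sub>C X n x) = (\<lambda>n. X n (c *\<^sub>C x))"
    using assms(1) by (simp add: bounded_opsD)
  ultimately show "T (c *\<^sub>C x) = c *\<^sub>C T x"
    using 1 LIMSEQ_unique by metis
qed

text \<open>
  The representing vector is the minimizer of \<open>x \<mapsto> \<parallel>x\<parallel>\<^sup>2 / 2 - \<phi> x\<close>; the parallelogram law makes
  minimizing sequences Cauchy.
\<close>

theorem Riesz_representation:
  fixes \<phi> :: "'a::{real_inner,complete_space} \<Rightarrow> real"
  assumes "bounded_linear \<phi>"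
  shows "\<exists>y. \<forall>x. \<phi> x = inner x y"
proof -
  interpret bounded_linear \<phi> by fact
  obtain K where K: "\<And>x. norm (\<phi> x) \<le> norm x * K" using bounded by blast
  define J where "J x = (norm x)\<^sup>2 / 2 - \<phi> x" for x
  have lb: "- (K\<^sup>2) / 2 \<le> J x" for x
  proof -
    have "0 \<le> (norm x - K)\<^sup>2" by simp
    hence "0 \<le> (norm x)\<^sup>2 - 2 * (norm x * K) + K\<^sup>2" by (simp add: power2_diff)
    thus ?thesis using K[of x] unfolding J_def by (simp add: abs_le_iff field_simps)
  qed
  define m where "m = (INF x. J x)"
  have bdd: "bdd_below (range J)" using lb by (auto intro!: bdd_belowI)
  have mle: "m \<le> J x" for x unfolding m_def using bdd by (intro cINF_lower) auto
  define u where "u n = 1 / real (Suc n)" for n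
  have u0: "0 < u n" for n by (simp add: u_def)
  have "\<exists>x. J x < m + u n" for n
    using cINF_less_iff[of UNIV J "m + u n"] bdd u0[of n] unfolding m_def by auto
  then obtain X where X: "\<And>n. J (X n) < m + u n" by metis
  have par: "(norm (x - y))\<^sup>2 / 8 = (J x + J y) / 2 - J ((1/2) *\<^sub>R (x + y))" for x y
    unfolding J_def
    by (simp add: scaleR add power2_norm_eq_inner inner_add_left inner_add_right inner_diff_left
        inner_diff_right inner_commute field_simps)
  have dist2: "(norm (X n - X k))\<^sup>2 \<le> 8 / Suc N" if "N \<le> n" "N \<le> k" for n k N
  proof -
    have "u n \<le> u N" "u k \<le> u N"
      using that by (simp_all add: u_def frac_le)
    moreover have "d / 8 \<le> U" if "u1 \<le> U" "u2 \<le> U" "d / 8 = (a + b) / 2 - c" "m \<le> c" "a < m + u1"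
      "b < m + u2"
      for a b c d u1 u2 U :: real
      using that by argo
    ultimately have "(norm (X n - X k))\<^sup>2 / 8 \<le> u N"
      using par[of "X n" "X k"] mle X by blast
    thus ?thesis by (simp add: u_def)
  qed
  have "Cauchy X"
  proof (rule CauchyI)
    fix e :: real assume e: "0 < e"
    obtain N where N: "8 / e\<^sup>2 < real N" using reals_Archimedean2 by blast
    have "norm (X n - X k) < e" if "N \<le> n" "N \<le> k" for n k
    proof -
      have "8 / e\<^sup>2 < real (Suc N)" using N by simp
      hence "8 / Suc N < e\<^sup>2" using e by (simp add: field_simps)
      hence "(norm (X n - X k))\<^sup>2 < e\<^sup>2" using dist2[OF that] by linarith
      thus ?thesis using e by (simp add: power2_less_imp_less)
    qed
    thus "\<exists>N. \<forall>n\<ge>N. \<forall>k\<ge>N. norm (X n - X k) < e" by blast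
  qed
  then obtain y where y: "X \<longlonglongrightarrow> y" using Cauchy_convergent convergent_def by blast
  have "(\<lambda>n. J (X n)) \<longlonglongrightarrow> J y"
    unfolding J_def by (intro tendsto_intros y tendsto) simp
  moreover have "(\<lambda>n. m + u n) \<longlonglongrightarrow> m + 0"
    unfolding u_def by (intro tendsto_intros LIMSEQ_Suc lim_1_over_n)
  ultimately have "J y \<le> m + 0"
    using X by (intro LIMSEQ_le) (auto intro: less_imp_le)
  hence min: "J y \<le> J x" for x using mle[of x] by simp
  have "\<phi> x = inner x y" for x
  proof (rule ccontr)
    define d where "d = inner x y - \<phi> x"
    assume "\<phi> x \<noteq> inner x y"
    hence d: "d \<noteq> 0" by (simp add: d_def)
    define N where "N = (norm x)\<^sup>2 + 1"
    have N: "N > 0" by (simp add: N_def add_nonneg_pos)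
    \<comment> \<open>Moving the minimizer by \<open>t *\<^sub>R x\<close> changes \<open>J\<close>
      by \<open>t\<^sup>2 * (norm x)\<^sup>2 / 2 + t * d\<close>, which is negative for this
      \<open>t\<close>. The summand 1 in \<open>N\<close> makes the division legitimate.\<close>
    define t where "t = - d / N"
    have "(norm (y + t *\<^sub>R x))\<^sup>2 = (norm y)\<^sup>2 + t\<^sup>2 * (norm x)\<^sup>2 + 2 * t * inner x y"
      unfolding power2_norm_eq_inner
      by (simp add: inner_add_left inner_add_right inner_commute power2_eq_square algebra_simps)
    hence "J (y + t *\<^sub>R x) = J y + t\<^sup>2 * (norm x)\<^sup>2 / 2 + t * d"
      unfolding J_def d_def by (simp add: scaleR add field_simps)
    hence "0 \<le> t\<^sup>2 * (norm x)\<^sup>2 / 2 + t * d" using min[of "y + t *\<^sub>R x"] by simp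
    also have "\<dots> \<le> t\<^sup>2 * N / 2 + t * d" by (simp add: N_def field_simps)
    also have "\<dots> = - d\<^sup>2 / (2 * N)" using N by (simp add: t_def field_simps power2_eq_square)
    also have "\<dots> < 0" using d N by simp
    finally show False by simp
  qed
  thus ?thesis by blast
qed

text \<open>Riesz representation over the reals yields a vector for the real part of
  \<open>b f\<close>. Replacing \<open>g\<close> by \<open>\<i> *\<^sub>C g\<close> recovers the
  imaginary part, because \<open>b\<close> and \<open>cinner\<close> are both conjugate linear in
  the second argument.\<close>

theorem sesquilinear_operator:
  fixes b :: "'h::complex_hilbert \<Rightarrow> 'h \<Rightarrow> complex"
  assumes add_left: "\<And>f f' g. b (f + f') g = b f g + b f' g"
    and add_right: "\<And>f g g'. b f (g + g') = b f g + b f g'"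
    and scale_left: "\<And>c f g. b (c *\<^sub>C f) g = c * b f g"
    and scale_right: "\<And>c f g. b f (c *\<^sub>C g) = cnj c * b f g"
    and bound: "\<And>f g. cmod (b f g) \<le> C * norm f * norm g"
  shows "\<exists>T\<in>bounded_ops. \<forall>f g. cinner (T f) g = b f g"
proof -
  have sR: "b f (r *\<^sub>R g) = of_real r * b f g" for f r g
    using scale_right[of f "of_real r" g] by (simp add: scaleC_of_real)
  have "\<exists>y. \<forall>g. Re (b f g) = inner g y" for f
  proof (rule Riesz_representation, rule bounded_linear_intro)
    show "norm (Re (b f g)) \<le> norm g * (C * norm f)" for g
      using bound[of f g] abs_Re_le_cmod[of "b f g"] by (simp add: mult_ac)
  qed (simp_all add: add_right sR)
  then obtain T where T: "\<And>f g. Re (b f g) = inner g (T f)" by metis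
  have cT: "cinner (T f) g = b f g" for f g
  proof -
    have "Re (cinner (T f) g) = Re (b f g)" for g
      by (simp add: T Re_cinner inner_commute)
    from this[of g] this[of "\<i> *\<^sub>C g"] show ?thesis
      by (simp add: complex_eq_iff cinner_scaleC_right scale_right)
  qed
  have TC: "T (c *\<^sub>C f) = c *\<^sub>C T f" for c f
    by (rule cinner_eqI) (simp add: cT cinner_scaleC_left scale_left)
  have lin: "bounded_linear T"
  proof (rule bounded_linear_intro)
    show "T (f + f') = T f + T f'" for f f'
      by (rule cinner_eqI) (simp add: cT cinner_add_left add_left)
    show "T (r *\<^sub>R f) = r *\<^sub>R T f" for r f
      using TC[of "of_real r" f] by (simp add: scaleC_of_real)
    show "norm (T f) \<le> norm f * \<bar>C\<bar>" for f
    proof (cases "T f = 0")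
      case False
      have "(norm (T f))\<^sup>2 = cmod (b f (T f))" by (simp add: cT[symmetric] cinner_self norm_power)
      also have "\<dots> \<le> \<bar>C\<bar> * norm f * norm (T f)"
        using bound[of f "T f"]
        by (meson abs_ge_self mult_right_mono norm_ge_zero order_trans)
      finally show ?thesis using False by (simp add: power2_eq_square mult_ac)
    qed simp
  qed
  show ?thesis
    by (rule bexI[of _ "Blinfun T"])
      (simp_all add: bounded_ops_def bounded_linear_Blinfun_apply[OF lin] TC cT)
qed

lemma bounded_ops_cinner_eqI:
  fixes S T :: "'h::complex_hilbert \<Rightarrow>\<^sub>L 'h"
  assumes "\<And>f g. cinner (S f) g = cinner (T f) g"
  shows "S = T"
  by (rule blinfun_eqI, rule cinner_eqI) (rule assms)

text \<open>The form \<open>cinner f (A g)\<close> is represented by an operator, and conjugation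
  turns it into the required identity. Uniqueness then identifies this operator with the definite
  description \<open>adj A\<close>.\<close>

lemma
  fixes A :: "'h::complex_hilbert \<Rightarrow>\<^sub>L 'h"
  assumes "A \<in> bounded_ops"
  shows adj_bounded: "adj A \<in> bounded_ops"
    and cinner_adj_right: "cinner (A x) y = cinner x (adj A y)"
proof -
  have "\<exists>T\<in>bounded_ops. \<forall>f g. cinner (T f) g = cinner f (A g)"
  proof (rule sesquilinear_operator[where C = "norm A"])
    show "cmod (cinner f (A g)) \<le> norm A * norm f * norm g" for f g
      using cmod_cinner_le[of f "A g"] mult_left_mono[OF norm_blinfun[of A g], of "norm f"]
      by (simp add: mult_ac)
  qed (simp_all add: cinner_simps blinfun.add_right bounded_opsD[OF assms])
  then obtain T where T: "T \<in> bounded_ops" "\<And>f g. cinner (T f) g = cinner f (A g)"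
    by blast
  have T': "cinner (A x) y = cinner x (T y)" for x y
    by (metis T(2) cinner_commute)
  have "adj A \<in> bounded_ops \<and> (\<forall>x y. cinner (A x) y = cinner x (adj A y))"
    unfolding adj_def
  proof (rule theI2[where a = T])
    fix B assume B: "B \<in> bounded_ops \<and> (\<forall>x y. cinner (A x) y = cinner x (B y))"
    show "B = T"
      by (rule bounded_ops_cinner_eqI) (metis B T' cinner_commute)
  qed (use T T' in auto)
  thus "adj A \<in> bounded_ops" "cinner (A x) y = cinner x (adj A y)"
    by auto
qed

lemma cinner_adj_left:
  "A \<in> bounded_ops \<Longrightarrow> cinner (adj A x) y = cinner x (A (y::'h::complex_hilbert))"
  by (metis cinner_adj_right cinner_commute)

section \<open>Functional calculus of positive operators\<close>

lemma blinfun_power_apply: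
  fixes A :: "'h::complex_hilbert \<Rightarrow>\<^sub>L 'h"
  shows
  "(((o\<^sub>L) A ^^ i) id_blinfun) x = (blinfun_apply A ^^ i) x"
  by (induction i) auto

lemma poly_op_eq_sum:
  assumes "degree P \<le> n"
  shows "poly_op P A = (\<Sum>i\<le>n. coeff P i *\<^sub>R (((o\<^sub>L) A ^^ i) id_blinfun))"
  unfolding poly_op_def
  by (rule sum.mono_neutral_left) (use assms in \<open>auto simp: coeff_eq_0\<close>)

lemma poly_op_add: "poly_op (P + Q) A = poly_op P A + poly_op Q A"
proof -
  define n where "n = max (degree P) (degree Q)"
  have "degree P \<le> n" "degree Q \<le> n" "degree (P + Q) \<le> n"
    by (auto simp: n_def degree_add_le)
  thus ?thesis by (simp add: poly_op_eq_sum scaleR_add_left sum.distrib)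
qed

lemma poly_op_smult: "poly_op (smult c P) A = c *\<^sub>R poly_op P A"
  using degree_smult_le[of c P]
  by (simp add: poly_op_eq_sum[of _ "degree P"] scaleR_sum_right)

lemma poly_op_diff: "poly_op (P - Q) A = poly_op P A - poly_op Q A"
  using poly_op_add[of P "smult (-1) Q" A] poly_op_smult[of "-1" Q A] by simp

lemma poly_op_0 [simp]: "poly_op 0 A = 0"
  by (simp add: poly_op_def)

lemma poly_op_pCons:
  "poly_op (pCons c P) A x = c *\<^sub>R x + A (poly_op P A x)"
proof -
  have "poly_op (pCons c P) A
      = (\<Sum>i\<le>Suc (degree P). coeff (pCons c P) i *\<^sub>R (((o\<^sub>L) A ^^ i) id_blinfun))"
    by (rule poly_op_eq_sum) (simp add: degree_pCons_le)
  thus ?thesis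
    by (simp add: sum.atMost_Suc_shift blinfun.bilinear_simps blinfun.sum_left blinfun.sum_right
        poly_op_def del: sum.atMost_Suc)
qed

lemma poly_op_const: "poly_op [:c:] A x = c *\<^sub>R x"
  by (simp add: poly_op_pCons)

lemma poly_op_mult: "poly_op (P * Q) A = poly_op P A o\<^sub>L poly_op Q A"
  by (induction P)
    (auto intro!: blinfun_eqI simp: poly_op_add poly_op_smult poly_op_pCons blinfun.bilinear_simps)

lemma poly_op_commute:
  fixes A :: "'h::complex_hilbert \<Rightarrow>\<^sub>L 'h"
  shows "A (poly_op P A x) = poly_op P A (A x)"
  by (induction P arbitrary: x) (auto simp: poly_op_pCons blinfun.bilinear_simps)

lemma poly_op_bounded_ops: "A \<in> bounded_ops \<Longrightarrow> poly_op P A \<in> bounded_ops"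
proof (induction P)
  case (pCons c P)
  have "poly_op (pCons c P) A = c *\<^sub>R id_blinfun + (A o\<^sub>L poly_op P A)"
    by (rule blinfun_eqI) (simp add: poly_op_pCons blinfun.bilinear_simps)
  thus ?case
    using pCons by (simp add: bounded_ops_add bounded_ops_scaleR bounded_ops_id bounded_ops_comp)
qed (simp add: bounded_ops_0)

lemma poly_op_self_adjoint:
  fixes S :: "'h::complex_hilbert \<Rightarrow>\<^sub>L 'h"
  assumes "\<And>x y. cinner (S x) y = cinner x (S y)"
  shows "cinner (poly_op P S x) y = cinner x (poly_op P S y)"
proof (induction P arbitrary: x y)
  case (pCons c P)
  thus ?case by (simp add: poly_op_pCons cinner_simps assms flip: poly_op_commute)
qed simp

lemma poly_op_eigenvector:
  fixes A :: "'h::complex_hilbert \<Rightarrow>\<^sub>L 'h"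
  shows "A x = l *\<^sub>R x \<Longrightarrow> poly_op P A x = poly P l *\<^sub>R x"
  by (induction P) (simp_all add: poly_op_pCons blinfun.bilinear_simps algebra_simps)

section \<open>Positive operators and positivity of polynomials\<close>

definition pos_op :: "('h::complex_hilbert \<Rightarrow>\<^sub>L 'h) \<Rightarrow> bool" where
  "pos_op S \<longleftrightarrow> S \<in> bounded_ops \<and>
     (\<forall>x y. cinner (S x) y = cinner x (S y)) \<and>
     (\<forall>x. 0 \<le> inner (S x) x)"

lemma pos_opD:
  assumes "pos_op S"
  shows "S \<in> bounded_ops" "cinner (S x) y = cinner x (S y)"
    "inner (S x) y = inner x (S y)" "0 \<le> inner (S x) x"
  using assms unfolding pos_op_def by (auto simp flip: Re_cinner)

lemma cinner_pos_op: "pos_op S \<Longrightarrow> cinner (S x) x = of_real (inner (S x) x)"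
  using pos_opD(2)[of S x x] cinner_commute[of "S x" x]
  by (simp add: complex_eq_iff Re_cinner)

lemma inner_blinfun_le:
  fixes S :: "'h::real_inner \<Rightarrow>\<^sub>L 'h"
  shows "inner (S x) x \<le> norm S * (norm x)\<^sup>2"
proof -
  have "inner (S x) x \<le> norm (S x) * norm x"
    by (rule norm_cauchy_schwarz)
  also have "\<dots> \<le> norm S * norm x * norm x"
    by (intro mult_right_mono norm_blinfun) simp
  finally show ?thesis by (simp add: power2_eq_square mult_ac)
qed

text \<open>The Cauchy--Schwarz inequality for the form of \<open>R\<close>, tested on \<open>x - R x / c\<close>.\<close>

lemma norm_positive_form_le:
  fixes R :: "'h::real_inner \<Rightarrow>\<^sub>L 'h"
  assumes "\<And>x y. inner (R x) y = inner x (R y)"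
    and "\<And>x. 0 \<le> inner (R x) x"
    and c: "c > 0" "inner (R (R x)) (R x) \<le> c * (norm (R x))\<^sup>2"
  shows "(norm (R x))\<^sup>2 \<le> c * inner (R x) x"
proof -
  define y t where "y = R x" and "t = 1 / c"
  have "0 \<le> inner (R (x - t *\<^sub>R y)) (x - t *\<^sub>R y)" by (rule assms)
  also have "\<dots> = inner y x - 2 * t * (norm y)\<^sup>2 + t\<^sup>2 * inner (R y) y"
    using assms(1)[of x y] assms(1)[of y x] unfolding power2_norm_eq_inner
    by (simp add: blinfun.bilinear_simps inner_diff_left inner_diff_right inner_commute
        power2_eq_square algebra_simps flip: y_def)
  also have "\<dots> \<le> inner y x - 2 * t * (norm y)\<^sup>2 + t\<^sup>2 * (c * (norm y)\<^sup>2)"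
    using c(2) by (intro add_left_mono mult_left_mono) (simp_all add: y_def)
  also have "\<dots> = inner y x - (norm y)\<^sup>2 / c"
    using c(1) by (simp add: t_def field_simps power2_eq_square)
  finally show ?thesis using c(1) by (simp add: y_def field_simps)
qed

lemma norm_positive_form:
  fixes R :: "'h::real_inner \<Rightarrow>\<^sub>L 'h"
  assumes "\<And>x y. inner (R x) y = inner x (R y)"
    and "\<And>x. 0 \<le> inner (R x) x"
  shows "(norm (R x))\<^sup>2 \<le> norm R * inner (R x) x"
proof (cases "norm R = 0")
  case False
  thus ?thesis by (intro norm_positive_form_le assms inner_blinfun_le) simp
qed simp

text \<open>Complex coefficients allow a splitting into linear factors. The value is a vector and
  not an operator because the type of operators carries real scalars only.\<close>

definition cpoly_apply :: "complex poly \<Rightarrow> ('h::complex_hilbert \<Rightarrow>\<^sub>L 'h) \<Rightarrow> 'h \<Rightarrow> 'h" where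
  "cpoly_apply Q S x = (\<Sum>i\<le>degree Q. coeff Q i *\<^sub>C (blinfun_apply S ^^ i) x)"

lemma cpoly_apply_eq_sum:
  assumes "degree Q \<le> n"
  shows "cpoly_apply Q S x = (\<Sum>i\<le>n. coeff Q i *\<^sub>C (blinfun_apply S ^^ i) x)"
  unfolding cpoly_apply_def
  by (rule sum.mono_neutral_left) (use assms in \<open>auto simp: coeff_eq_0\<close>)

lemma scaleC_sum_right: "c *\<^sub>C (\<Sum>i\<in>I. f i) = (\<Sum>i\<in>I. c *\<^sub>C (f i :: 'h::complex_hilbert))"
  by (rule complex_vector.scale_sum_right)

lemma cpoly_apply_linear_factor:
  assumes "S \<in> bounded_ops"
  shows "cpoly_apply ([:- z, 1:] * Q) S x
    = S (cpoly_apply Q S x) - z *\<^sub>C cpoly_apply Q S x"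
proof -
  define n where "n = degree Q"
  have eq: "[:- z, 1:] * Q = smult (- z) Q + pCons 0 Q"
    by (simp add: mult_pCons_left)
  have deg: "degree ([:- z, 1:] * Q) \<le> Suc n" "degree Q \<le> n" "degree Q \<le> Suc n"
    using degree_mult_le[of "[:- z, 1:]" Q] by (auto simp: n_def)
  have "cpoly_apply ([:- z, 1:] * Q) S x
      = (\<Sum>i\<le>Suc n. - (z *\<^sub>C coeff Q i *\<^sub>C (blinfun_apply S ^^ i) x)) +
        (\<Sum>i\<le>Suc n. coeff (pCons 0 Q) i *\<^sub>C (blinfun_apply S ^^ i) x)"
    unfolding cpoly_apply_eq_sum[OF deg(1)] unfolding eq
    by (simp add: complex_vector.scale_left_diff_distrib sum_subtractf sum_negf scaleC_scaleC
        del: sum.atMost_Suc)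
  also have
    "(\<Sum>i\<le>Suc n. - (z *\<^sub>C coeff Q i *\<^sub>C (blinfun_apply S ^^ i) x)) = - (z *\<^sub>C cpoly_apply Q S x)"
    unfolding cpoly_apply_eq_sum[OF deg(3)] by (simp only: scaleC_sum_right sum_negf)
  also have "(\<Sum>i\<le>Suc n. coeff (pCons 0 Q) i *\<^sub>C (blinfun_apply S ^^ i) x)
      = S (cpoly_apply Q S x)"
    unfolding cpoly_apply_eq_sum[OF deg(2)]
    by (simp add: sum.atMost_Suc_shift blinfun.sum_right bounded_opsD[OF assms] del: sum.atMost_Suc)
  finally show ?thesis by simp
qed

lemma cpoly_apply_of_real:
  "cpoly_apply (map_poly of_real P) S x = poly_op P S x"
  unfolding cpoly_apply_def poly_op_def
  by (simp add: degree_map_poly coeff_map_poly scaleC_of_real blinfun.sum_left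
      blinfun.scaleR_left blinfun_power_apply)

lemma poly_map_poly_of_real:
  "poly (map_poly of_real P) (of_real t) = (of_real (poly P t) :: complex)"
  by (induction P) (simp_all add: map_poly_pCons)

text \<open>The numerical range of \<open>S\<close> lies in \<open>{0..norm S}\<close>, hence at a
  positive distance \<open>d\<close> from \<open>z\<close>. Cauchy--Schwarz converts this distance
  for the form of \<open>S - z\<close> into a lower bound for its norm.\<close>

lemma pos_op_bounded_below_linear:
  assumes S: "pos_op S" and z: "z \<notin> of_real ` {0..norm S}"
  shows "\<exists>d>0. \<forall>y. d * norm y \<le> norm (S y - z *\<^sub>C y)"
proof -
  have "closed (complex_of_real ` {0..norm S})"
    by (intro compact_imp_closed compact_continuous_image continuous_intros) auto
  then obtain d where d: "d > 0" "\<And>w. w \<in> of_real ` {0..norm S} \<Longrightarrow> d \<le> dist z w"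
    using separate_point_closed[OF _ z] by blast
  have "d * norm y \<le> norm (S y - z *\<^sub>C y)" for y
  proof (cases "y = 0")
    case False
    define u where "u = inner (S y) y / (norm y)\<^sup>2"
    have "u \<in> {0..norm S}"
      using False pos_opD(4)[OF S, of y] inner_blinfun_le[of S y]
      by (simp add: u_def field_simps)
    hence "d \<le> cmod (of_real u - z)" using d(2)[of "of_real u"]
      by (simp add: dist_norm norm_minus_commute)
    hence "d * (norm y)\<^sup>2 \<le> cmod (of_real u - z) * (norm y)\<^sup>2" by (rule mult_right_mono) simp
    also have "\<dots> = cmod ((of_real u - z) * of_real ((norm y)\<^sup>2))"
      by (simp add: norm_mult norm_power)
    also have "(of_real u - z) * of_real ((norm y)\<^sup>2) = cinner (S y - z *\<^sub>C y) y"
      using False by (simp add: u_def cinner_simps cinner_pos_op[OF S] cinner_self algebra_simps)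
    also have "cmod \<dots> \<le> norm (S y - z *\<^sub>C y) * norm y" by (rule cmod_cinner_le)
    finally show ?thesis using False by (simp add: power2_eq_square)
  qed simp
  thus ?thesis using d(1) by blast
qed

text \<open>Induction on the degree: the fundamental theorem of algebra splits off a linear factor,
  its root avoids the interval, and the lower bounds of the factors multiply.\<close>

lemma pos_op_bounded_below:
  assumes S: "pos_op S" and "Q \<noteq> 0" and "\<And>t. t \<in> {0..norm S} \<Longrightarrow> poly Q (of_real t) \<noteq> 0"
  shows "\<exists>c>0. \<forall>x. c * norm x \<le> norm (cpoly_apply Q S x)"
  using assms(2,3)
proof (induction "degree Q" arbitrary: Q)
  case 0
  then obtain a where a: "Q = [:a:]" by (metis degree_eq_zeroE)
  hence "a \<noteq> 0" using 0 by simp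
  thus ?case using a by (intro exI[of _ "cmod a"]) (simp add: cpoly_apply_def norm_scaleC)
next
  case (Suc n)
  hence "\<not> constant (poly Q)" by (simp add: constant_degree)
  then obtain z where "poly Q z = 0" using fundamental_theorem_of_algebra by blast
  then obtain R where R: "Q = [:- z, 1:] * R" by (metis poly_eq_0_iff_dvd dvdE)
  have "R \<noteq> 0" using R Suc by auto
  moreover from this have "degree Q = Suc (degree R)" by (subst R, subst degree_mult_eq) auto
  ultimately have "\<exists>c>0. \<forall>x. c * norm x \<le> norm (cpoly_apply R S x)"
    using Suc by (intro Suc(1)) (auto simp: R)
  then obtain c where c: "c > 0" "\<And>x. c * norm x \<le> norm (cpoly_apply R S x)" by blast
  have "z \<notin> of_real ` {0..norm S}" using Suc(4) \<open>poly Q z = 0\<close> by auto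
  then obtain d where d: "d > 0" "\<And>y. d * norm y \<le> norm (S y - z *\<^sub>C y)"
    using pos_op_bounded_below_linear[OF S] by blast
  have "d * c * norm x \<le> norm (cpoly_apply Q S x)" for x
  proof -
    have "d * c * norm x \<le> d * norm (cpoly_apply R S x)" using c(2)[of x] d(1) by simp
    also have "\<dots> \<le> norm (cpoly_apply Q S x)"
      unfolding R cpoly_apply_linear_factor[OF pos_opD(1)[OF S]] by (rule d)
    finally show ?thesis .
  qed
  thus ?case using c(1) d(1) by (intro exI[of _ "d * c"]) simp
qed

text \<open>
  If the form of \<open>P(S)\<close> had a negative infimum \<open>m\<close>, then \<open>P(S) - m\<close> would not be bounded below,
  although the polynomial \<open>P - m\<close> has no zero on \<open>[0, \<parallel>S\<parallel>]\<close>.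
\<close>

theorem poly_op_nonneg:
  fixes S :: "'h::complex_hilbert \<Rightarrow>\<^sub>L 'h"
  assumes S: "pos_op S" and P: "\<And>t. t \<in> {0..norm S} \<Longrightarrow> 0 \<le> poly P t"
  shows "0 \<le> inner (poly_op P S x) x"
proof (rule ccontr)
  assume not: "\<not> ?thesis"
  define R where "R = poly_op P S"
  define g where "g y = inner (R y) y" for y
  have gs: "g (r *\<^sub>R y) = r\<^sup>2 * g y" for r y
    by (simp add: g_def blinfun.scaleR_right power2_eq_square)
  have neg: "g x < 0" using not by (simp add: g_def R_def)
  hence "x \<noteq> 0" by (auto simp: g_def)
  define X where "X = {y::'h. norm y = 1}"
  have bdd: "bdd_below (g ` X)"
  proof (rule bdd_belowI2)
    show "- norm R \<le> g y" if "y \<in> X" for y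
      using inner_blinfun_le[of "- R" y] that by (simp add: X_def g_def blinfun.minus_left)
  qed
  define m where "m = (INF y\<in>X. g y)"
  have x1: "(1 / norm x) *\<^sub>R x \<in> X" using \<open>x \<noteq> 0\<close> by (simp add: X_def)
  have "m \<le> g ((1 / norm x) *\<^sub>R x)" unfolding m_def using bdd x1 by (rule cINF_lower)
  also have "\<dots> = g x / (norm x)\<^sup>2" by (simp add: gs power_divide)
  also have "\<dots> < 0" using neg \<open>x \<noteq> 0\<close> by (intro divide_neg_pos) simp_all
  finally have m: "m < 0" .
  define Q where "Q = P - [:m:]"
  define R' where "R' = poly_op Q S"
  have R'y: "inner (R' y) y = g y - m * (norm y)\<^sup>2" for y
    by (simp add: R'_def Q_def g_def R_def poly_op_diff poly_op_const blinfun.diff_left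
        inner_diff_left power2_norm_eq_inner)
  have R'pos: "0 \<le> inner (R' y) y" for y
  proof (cases "y = 0")
    case False
    have "m \<le> g ((1 / norm y) *\<^sub>R y)"
      unfolding m_def using bdd by (rule cINF_lower) (use False in \<open>simp add: X_def\<close>)
    thus ?thesis using False by (simp add: R'y gs field_simps)
  qed simp
  have R'sa: "inner (R' y) z = inner y (R' z)" for y z
    using poly_op_self_adjoint[OF pos_opD(2)[OF S], where P = Q and x = y and y = z]
    by (simp add: R'_def flip: Re_cinner)
  have pQ: "0 < poly Q t" if "t \<in> {0..norm S}" for t
    using P[OF that] m by (simp add: Q_def)
  hence "Q \<noteq> 0" by (metis atLeastAtMost_iff norm_ge_zero order_refl poly_0 less_irrefl)
  have "\<exists>c>0. \<forall>x. c * norm x \<le> norm (cpoly_apply (map_poly of_real Q) S x)"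
  proof (rule pos_op_bounded_below[OF S])
    show "map_poly complex_of_real Q \<noteq> 0"
      using \<open>Q \<noteq> 0\<close> by (simp add: map_poly_eq_0_iff)
    show "poly (map_poly complex_of_real Q) (of_real t) \<noteq> 0" if "t \<in> {0..norm S}" for t
      using pQ[OF that] by (simp add: poly_map_poly_of_real)
  qed
  then obtain c where c: "c > 0" "\<And>y. c * norm y \<le> norm (R' y)"
    unfolding cpoly_apply_of_real R'_def by blast
  \<comment> \<open>Some unit vector brings the form of \<open>R'\<close> below \<open>e\<close>,
    hence its squared norm under \<open>R'\<close> to at most \<open>norm R' * e\<close>. This is
    less than \<open>c\<^sup>2\<close>, against the lower bound; the summand 1 keeps the denominator
    positive.\<close>
  define e where "e = c\<^sup>2 / (norm R' + 1)"
  have e: "e > 0" using c(1) by (simp add: e_def add_nonneg_pos)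
  obtain y where y: "y \<in> X" "g y < m + e"
    using cINF_less_iff[of X g "m + e"] bdd x1 e unfolding m_def by auto
  have "c\<^sup>2 \<le> (norm (R' y))\<^sup>2"
    using c(1) c(2)[of y] y(1) by (intro power_mono) (auto simp: X_def)
  also have "\<dots> \<le> norm R' * inner (R' y) y"
    using R'sa R'pos by (rule norm_positive_form)
  also have "\<dots> \<le> norm R' * e"
    using y by (intro mult_left_mono) (auto simp: R'y X_def)
  also have "\<dots> < (norm R' + 1) * e" using e by (simp add: distrib_right)
  also have "\<dots> = c\<^sup>2"
    using add_nonneg_pos[OF norm_ge_zero[of R'] zero_less_one] by (simp add: e_def)
  finally show False by simp
qed

text \<open>The polynomial \<open>M\<^sup>2 - P\<^sup>2\<close> is nonnegative on the interval, and
  nonnegativity of its form at \<open>S\<close> says exactly that \<open>P(S)\<close> is bounded by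
  \<open>M\<close>.\<close>

lemma norm_poly_op_le:
  assumes S: "pos_op S" and P: "\<And>t. t \<in> {0..norm S} \<Longrightarrow> \<bar>poly P t\<bar> \<le> M"
  shows "norm (poly_op P S) \<le> M"
proof (rule norm_blinfun_bound)
  show M: "0 \<le> M" using P[of 0] by simp
  fix x
  have "0 \<le> inner ((poly_op ([:M\<^sup>2:] - P * P) S) x) x"
  proof (rule poly_op_nonneg[OF S])
    fix t assume "t \<in> {0..norm S}"
    hence "\<bar>poly P t\<bar>\<^sup>2 \<le> M\<^sup>2" using P by (intro power_mono) auto
    thus "0 \<le> poly ([:M\<^sup>2:] - P * P) t" by (simp add: power2_eq_square)
  qed
  moreover have "inner (poly_op P S (poly_op P S x)) x
      = (norm (poly_op P S x))\<^sup>2"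
    using poly_op_self_adjoint[OF pos_opD(2)[OF S], where P = P and x = "poly_op P S x" and y = x]
    unfolding power2_norm_eq_inner Re_cinner[symmetric] by simp
  hence "inner ((poly_op ([:M\<^sup>2:] - P * P) S) x) x
      = (M * norm x)\<^sup>2 - (norm (poly_op P S x))\<^sup>2"
    by (simp only: poly_op_diff poly_op_mult poly_op_const blinfun.diff_left inner_diff_left
        power_mult_distrib blinfun_compose.rep_eq o_apply inner_scaleR_left power2_norm_eq_inner)
  ultimately have "(norm (poly_op P S x))\<^sup>2 \<le> (M * norm x)\<^sup>2"
    by linarith
  thus "norm (poly_op P S x) \<le> M * norm x"
    by (rule power2_le_imp_le) (simp add: M)
qed

section \<open>From polynomials to continuous functions\<close>

lemma Weierstrass_poly:
  fixes f :: "real \<Rightarrow> real"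
  assumes "continuous_on {a..b} f"
  shows "\<exists>P :: nat \<Rightarrow> real poly. uniform_limit {a..b} (\<lambda>n. poly (P n)) f sequentially"
proof -
  have "\<exists>P. \<forall>x\<in>{a..b}. \<bar>f x - poly P x\<bar> < 1 / real (Suc n)" for n
  proof -
    obtain g where g: "real_polynomial_function g" "\<And>x. x \<in> {a..b} \<Longrightarrow> \<bar>f x - g x\<bar> < 1 / real (Suc n)"
      using Stone_Weierstrass_real_polynomial_function[OF _ assms, of "1 / real (Suc n)"] by auto
    then obtain c N where "g = (\<lambda>x. \<Sum>i\<le>N. c i * x ^ i)"
      by (auto simp: real_polynomial_function_iff_sum)
    hence "g = poly (\<Sum>i\<le>N. monom (c i) i)" by (simp add: poly_sum poly_monom fun_eq_iff)
    thus ?thesis using g(2) by blast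
  qed
  then obtain P where P: "\<And>n x. x \<in> {a..b} \<Longrightarrow> \<bar>f x - poly (P n) x\<bar> < 1 / real (Suc n)" by metis
  have "uniform_limit {a..b} (\<lambda>n. poly (P n)) f sequentially"
    unfolding uniform_limit_iff
  proof (intro allI impI)
    fix e :: real assume "0 < e"
    then obtain N where N: "1 / real (Suc N) < e" using nat_approx_posE by blast
    have "dist (poly (P n) x) (f x) < e" if "N \<le> n" "x \<in> {a..b}" for n x
    proof -
      have "1 / real (Suc n) \<le> 1 / real (Suc N)" using that(1) by (simp add: frac_le)
      thus ?thesis using P[OF that(2), of n] N by (simp add: dist_real_def abs_minus_commute)
    qed
    thus "\<forall>\<^sub>F n in sequentially. \<forall>x\<in>{a..b}. dist (poly (P n) x) (f x) < e"
      unfolding eventually_sequentially by blast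
  qed
  thus ?thesis by blast
qed

lemma poly_op_tendsto_zero:
  assumes S: "pos_op S" and "uniform_limit {0..norm S} (\<lambda>n. poly (P n)) (\<lambda>_. 0) sequentially"
  shows "(\<lambda>n. poly_op (P n) S) \<longlonglongrightarrow> 0"
proof (rule LIMSEQ_I)
  fix e :: real assume "0 < e"
  hence "\<forall>\<^sub>F n in sequentially. \<forall>t\<in>{0..norm S}. dist (poly (P n) t) 0 < e / 2"
    using assms(2) unfolding uniform_limit_iff by (meson half_gt_zero)
  then obtain N where N: "\<And>n t. N \<le> n \<Longrightarrow> t \<in> {0..norm S} \<Longrightarrow> \<bar>poly (P n) t\<bar> < e / 2"
    unfolding eventually_sequentially dist_real_def diff_zero by blast
  have "norm (poly_op (P n) S) \<le> e / 2" if "N \<le> n" for n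
    using N[OF that] by (intro norm_poly_op_le[OF S]) (simp add: less_imp_le)
  thus "\<exists>N. \<forall>n\<ge>N. norm (poly_op (P n) S - 0) < e"
    using \<open>0 < e\<close> by (intro exI[of _ N]) (auto intro: le_less_trans[of _ "e / 2"])
qed

text \<open>Justifies the definite description in \<open>op_fun\<close>. One approximating sequence
  gives a limit by the norm bound, and any other differs from it by a uniformly null sequence.
  Weierstrass approximation matters for uniqueness too: it keeps the universal condition in the
  definition from being vacuous.\<close>

theorem op_fun_tendsto:
  assumes S: "pos_op S" and f: "continuous_on {0..norm S} f"
    and P: "uniform_limit {0..norm S} (\<lambda>n. poly (P n)) f sequentially"
  shows "(\<lambda>n. poly_op (P n) S) \<longlonglongrightarrow> op_fun f S"
proof -
  obtain P0 where P0: "uniform_limit {0..norm S} (\<lambda>n. poly (P0 n)) f sequentially"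
    using Weierstrass_poly[OF f] by blast
  have "Cauchy (\<lambda>n. poly_op (P0 n) S)"
  proof (rule CauchyI)
    fix e :: real assume e: "0 < e"
    hence "\<forall>\<^sub>F n in sequentially. \<forall>t\<in>{0..norm S}. dist (poly (P0 n) t) (f t) < e / 4"
      using P0 unfolding uniform_limit_iff by (meson divide_pos_pos zero_less_numeral)
    then obtain N where N: "\<And>n t. N \<le> n \<Longrightarrow> t \<in> {0..norm S} \<Longrightarrow> \<bar>poly (P0 n) t - f t\<bar> < e / 4"
      unfolding eventually_sequentially dist_real_def by blast
    have "norm (poly_op (P0 m) S - poly_op (P0 n) S) < e" if "N \<le> m" "N \<le> n" for m n
    proof -
      have "norm (poly_op (P0 m - P0 n) S) \<le> e / 2"
      proof (rule norm_poly_op_le[OF S])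
        fix t assume t: "t \<in> {0..norm S}"
        show "\<bar>poly (P0 m - P0 n) t\<bar> \<le> e / 2"
          using N[OF that(1) t] N[OF that(2) t] unfolding poly_diff abs_le_iff abs_less_iff
          by linarith
      qed
      thus ?thesis using e by (simp add: poly_op_diff)
    qed
    thus "\<exists>N. \<forall>m\<ge>N. \<forall>n\<ge>N. norm (poly_op (P0 m) S - poly_op (P0 n) S) < e" by blast
  qed
  then obtain T where T: "(\<lambda>n. poly_op (P0 n) S) \<longlonglongrightarrow> T"
    using Cauchy_convergent convergent_def by blast
  have lim: "(\<lambda>n. poly_op (P n) S) \<longlonglongrightarrow> T"
    if "uniform_limit {0..norm S} (\<lambda>n. poly (P n)) f sequentially" for P
  proof -
    have "uniform_limit {0..norm S} (\<lambda>n t. poly (P n) t - poly (P0 n) t) (\<lambda>t. f t - f t) sequentially"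
      by (rule uniform_limit_minus[OF that P0])
    hence "uniform_limit {0..norm S} (\<lambda>n. poly (P n - P0 n)) (\<lambda>_. 0) sequentially"
      by (simp add: uniform_limit_iff)
    hence "(\<lambda>n. poly_op (P n - P0 n) S) \<longlonglongrightarrow> 0"
      by (rule poly_op_tendsto_zero[OF S])
    from tendsto_add[OF this T] show ?thesis by (simp add: poly_op_diff)
  qed
  have "op_fun f S = T"
    unfolding op_fun_def
  proof (rule the_equality)
    fix T' assume "\<forall>P. uniform_limit {0..norm S} (\<lambda>n. poly (P n)) f sequentially \<longrightarrow>
       (\<lambda>n. poly_op (P n) S) \<longlonglongrightarrow> T'"
    thus "T' = T" using P0 T LIMSEQ_unique by blast
  qed (use lim in blast)
  thus ?thesis using lim[OF P] by simp
qed

lemma op_fun_obtain: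
  assumes "pos_op S" and "continuous_on {0..norm S} f"
  obtains P where "uniform_limit {0..norm S} (\<lambda>n. poly (P n)) f sequentially"
    "(\<lambda>n. poly_op (P n) S) \<longlonglongrightarrow> op_fun f S"
  using Weierstrass_poly[OF assms(2)] op_fun_tendsto[OF assms] by blast

text \<open>If \<open>F n\<close> is within \<open>d\<close> of \<open>f\<close>, then
  \<open>F n - P + d\<close> is nonnegative on the interval; its form is nonnegative and the limit
  removes \<open>d\<close>. This lets a tangent polynomial bound a nonpolynomial function of an
  operator.\<close>

lemma inner_poly_op_le_op_fun:
  assumes S: "pos_op S" and f: "continuous_on {0..norm S} f"
    and le: "\<And>t. t \<in> {0..norm S} \<Longrightarrow> poly P t \<le> f t"
  shows "inner (poly_op P S x) x \<le> inner (op_fun f S x) x"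
proof -
  obtain F where F: "uniform_limit {0..norm S} (\<lambda>n. poly (F n)) f sequentially"
    "(\<lambda>n. poly_op (F n) S) \<longlonglongrightarrow> op_fun f S" using op_fun_obtain[OF S f] .
  have lim: "(\<lambda>n. inner (poly_op (F n) S x) x) \<longlonglongrightarrow> inner (op_fun f S x) x"
    by (intro tendsto_intros F)
  show ?thesis
  proof (rule field_le_epsilon)
    fix e :: real assume "0 < e"
    define d where "d = e / ((norm x)\<^sup>2 + 1)"
    have N: "0 < (norm x)\<^sup>2 + 1" by (simp add: add_nonneg_pos)
    have d: "d > 0" "d * (norm x)\<^sup>2 \<le> e"
      using \<open>0 < e\<close> N by (simp_all add: d_def pos_divide_le_eq)
    hence "\<forall>\<^sub>F n in sequentially. \<forall>t\<in>{0..norm S}. dist (poly (F n) t) (f t) < d"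
      using F(1) unfolding uniform_limit_iff by blast
    hence "\<forall>\<^sub>F n in sequentially. inner (poly_op P S x) x - d * (norm x)\<^sup>2
        \<le> inner (poly_op (F n) S x) x"
    proof eventually_elim
      case (elim n)
      have "0 \<le> inner ((poly_op (F n - P + [:d:]) S) x) x"
      proof (rule poly_op_nonneg[OF S])
        fix t assume t: "t \<in> {0..norm S}"
        thus "0 \<le> poly (F n - P + [:d:]) t"
          using le[OF t] elim by (fastforce simp: dist_real_def abs_less_iff)
      qed
      thus ?case
        by (simp add: poly_op_add poly_op_diff poly_op_const blinfun.bilinear_simps inner_diff_left
            inner_add_left power2_norm_eq_inner)
    qed
    from tendsto_lowerbound[OF lim this]
    show "inner (poly_op P S x) x \<le> inner (op_fun f S x) x + e"
      using d(2) by simp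
  qed
qed

lemma pos_op_op_fun:
  assumes S: "pos_op S" and f: "continuous_on {0..norm S} f" "\<And>t. t \<in> {0..norm S} \<Longrightarrow> 0 \<le> f t"
  shows "pos_op (op_fun f S)"
proof -
  obtain F where F: "(\<lambda>n. poly_op (F n) S) \<longlonglongrightarrow> op_fun f S"
    using op_fun_obtain[OF S f(1)] by blast
  have "op_fun f S \<in> bounded_ops"
    by (rule bounded_ops_tendsto[OF poly_op_bounded_ops F]) (rule pos_opD(1)[OF S])
  moreover have "cinner (op_fun f S x) y = cinner x (op_fun f S y)" for x y
  proof (rule LIMSEQ_unique)
    show "(\<lambda>n. cinner (poly_op (F n) S x) y) \<longlonglongrightarrow> cinner (op_fun f S x) y"
      by (intro tendsto_intros F)
    show "(\<lambda>n. cinner (poly_op (F n) S x) y) \<longlonglongrightarrow> cinner x (op_fun f S y)"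
      unfolding poly_op_self_adjoint[OF pos_opD(2)[OF S]] by (intro tendsto_intros F)
  qed
  moreover have "0 \<le> inner (op_fun f S x) x" for x
    using inner_poly_op_le_op_fun[OF S f(1), of 0 x] f(2) by simp
  ultimately show ?thesis unfolding pos_op_def by blast
qed

text \<open>An eigenvalue with a nonzero eigenvector lies in \<open>{0..norm S}\<close>, where the
  approximating polynomials converge, and polynomials of \<open>S\<close> act on the eigenvector as
  scalars.\<close>

lemma op_fun_eigenvector:
  assumes S: "pos_op S" and f: "continuous_on {0..norm S} f"
    and x: "S x = l *\<^sub>R x"
  shows "op_fun f S x = f l *\<^sub>R x"
proof (cases "x = 0")
  case False
  obtain F where F: "uniform_limit {0..norm S} (\<lambda>n. poly (F n)) f sequentially"
    "(\<lambda>n. poly_op (F n) S) \<longlonglongrightarrow> op_fun f S" using op_fun_obtain[OF S f] .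
  have "0 \<le> l"
    using pos_opD(4)[OF S, of x] False
    by (simp add: x zero_le_mult_iff) (metis inner_gt_zero_iff not_le)
  moreover have "l \<le> norm S"
    using inner_blinfun_le[of S x] False by (simp add: x power2_norm_eq_inner)
  ultimately have "(\<lambda>n. poly (F n) l) \<longlonglongrightarrow> f l"
    using tendsto_uniform_limitI[OF F(1)] by simp
  hence "(\<lambda>n. poly_op (F n) S x) \<longlonglongrightarrow> f l *\<^sub>R x"
    unfolding poly_op_eigenvector[OF x] by (intro tendsto_intros)
  moreover have "(\<lambda>n. poly_op (F n) S x) \<longlonglongrightarrow> op_fun f S x"
    by (intro tendsto_intros F)
  ultimately show ?thesis by (rule LIMSEQ_unique[rotated])
qed simp

text \<open>Since \<open>sqrt\<close> is bounded on the interval, the squares of its polynomial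
  approximations converge uniformly to the identity, whose value at \<open>S\<close> is
  \<open>S\<close>.\<close>

lemma op_fun_sqrt_square:
  assumes S: "pos_op S"
  shows "op_fun sqrt S o\<^sub>L op_fun sqrt S = S"
proof -
  have cont: "continuous_on {0..norm S} sqrt" by (intro continuous_intros)
  obtain F where F: "uniform_limit {0..norm S} (\<lambda>n. poly (F n)) sqrt sequentially"
    "(\<lambda>n. poly_op (F n) S) \<longlonglongrightarrow> op_fun sqrt S" using op_fun_obtain[OF S cont] .
  have "bounded (sqrt ` {0..norm S})"
    by (intro compact_imp_bounded compact_continuous_image cont) simp
  hence "uniform_limit {0..norm S} (\<lambda>n t. poly (F n) t * poly (F n) t) (\<lambda>t. sqrt t * sqrt t) sequentially"
    by (intro uniform_lim_mult F)
  hence "uniform_limit {0..norm S} (\<lambda>n. poly (F n * F n - [:0, 1:])) (\<lambda>_. 0) sequentially"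
    unfolding uniform_limit_iff by (simp add: dist_real_def)
  hence "(\<lambda>n. poly_op (F n * F n - [:0, 1:]) S) \<longlonglongrightarrow> 0"
    by (rule poly_op_tendsto_zero[OF S])
  moreover have "poly_op [:0, 1:] S = S"
    by (rule blinfun_eqI) (simp add: poly_op_pCons)
  ultimately have "(\<lambda>n. poly_op (F n) S o\<^sub>L poly_op (F n) S) \<longlonglongrightarrow> S"
    by (simp add: poly_op_diff poly_op_mult LIM_zero_iff)
  moreover have "(\<lambda>n. poly_op (F n) S o\<^sub>L poly_op (F n) S) \<longlonglongrightarrow> (op_fun sqrt S o\<^sub>L op_fun sqrt S)"
    by (intro bounded_bilinear.tendsto[OF bounded_bilinear_blinfun_compose] F)
  ultimately show ?thesis by (rule LIMSEQ_unique[rotated])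
qed

section \<open>Absolute values and powers\<close>

lemma pos_op_adj_comp: "A \<in> bounded_ops \<Longrightarrow> pos_op (adj A o\<^sub>L A)"
  by (simp add: pos_op_def bounded_ops_comp adj_bounded cinner_adj_left cinner_adj_right[symmetric]
      flip: Re_cinner) (simp add: Re_cinner)

lemma
  assumes A: "A \<in> bounded_ops"
  shows pos_op_op_abs: "pos_op (op_abs A)"
    and op_abs_square: "op_abs A o\<^sub>L op_abs A = adj A o\<^sub>L A"
  unfolding op_abs_def
  by (intro pos_op_op_fun op_fun_sqrt_square pos_op_adj_comp A; auto intro!: continuous_intros)+

lemma norm_op_abs:
  assumes A: "A \<in> bounded_ops"
  shows "norm (op_abs A x) = norm (A x)"
proof -
  have "cinner (op_abs A x) (op_abs A x)
      = cinner ((op_abs A o\<^sub>L op_abs A) x) x"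
    by (simp add: pos_opD(2)[OF pos_op_op_abs[OF A]])
  also have "\<dots> = cinner (A x) (A x)"
    unfolding op_abs_square[OF A] by (simp add: cinner_adj_left[OF A])
  finally show ?thesis
    by (simp add: cinner_self del: of_real_power)
qed

lemma continuous_on_powr_nonneg: "r > 0 \<Longrightarrow> continuous_on {0..a} (\<lambda>x::real. x powr r)"
  by (intro continuous_on_powr' continuous_intros) auto

lemma pos_op_op_powr: "pos_op S \<Longrightarrow> r > 0 \<Longrightarrow> pos_op (op_powr S r)"
  unfolding op_powr_def by (intro pos_op_op_fun continuous_on_powr_nonneg) auto

text \<open>Young's inequality for the product \<open>y * c powr (r - 1)\<close>, with exponents
  \<open>r\<close> and \<open>r / (r - 1)\<close>; the second power is \<open>c powr r\<close>, and
  rearranging gives the tangent line.\<close>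

lemma powr_tangent_le:
  fixes y c r :: real
  assumes "0 \<le> y" "0 < c" "1 \<le> r"
  shows "c powr r + r * c powr (r - 1) * (y - c) \<le> y powr r"
proof (cases "r = 1")
  case False
  hence r: "r > 1" using assms by simp
  define s where "s = r / (r - 1)"
  have s: "s > 1" "1 / r + 1 / s = 1" using r by (simp_all add: s_def field_simps)
  have "y * c powr (r - 1) \<le> y powr r / r + (c powr (r - 1)) powr s / s"
    using assms r s by (intro Youngs_inequality) auto
  also have "(c powr (r - 1)) powr s = c powr r"
    using r by (simp add: powr_powr s_def)
  finally have "r * (y * c powr (r - 1)) \<le> r * (y powr r / r + c powr r / s)"
    using r by (intro mult_left_mono) simp_all
  also have "\<dots> = y powr r + (r - 1) * c powr r"
    using r by (simp add: s_def field_simps)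
  finally show ?thesis
    using powr_mult_base[of c "r - 1"] assms by (simp add: algebra_simps)
qed (use assms in simp)

lemma power2_powr_half: "0 \<le> t \<Longrightarrow> (t\<^sup>2) powr (p / 2) = t powr (p::real)"
  using powr_powr[of t 2 "p / 2"] by (cases "t = 0") (simp_all add: powr_numeral)

text \<open>
  Jensen's inequality: \<open>t\<^sup>p\<close> lies above its tangent in \<open>t\<^sup>2\<close> at \<open>t\<^sup>2 = \<parallel>B f\<parallel>\<^sup>2\<close>.
\<close>

theorem norm_powr_le_op_powr_abs:
  assumes B: "B \<in> bounded_ops" and p: "2 \<le> p" and f: "norm f \<le> 1"
  shows "norm (B f) powr p \<le> inner (op_powr (op_abs B) p f) f"
proof (cases "B f = 0")
  case True
  thus ?thesis
    using pos_opD(4)[OF pos_op_op_powr[OF pos_op_op_abs[OF B]], of p f] p by simp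
next
  case False
  define c r where "c = (norm (B f))\<^sup>2" and "r = p / 2"
  \<comment> \<open>\<open>P\<close> is
    \<open>c powr r + r * c powr (r - 1) * (t\<^sup>2 - c)\<close> in the variable \<open>t\<close>.
    With no linear term, its form at \<open>op_abs B\<close> depends only on the norms of
    \<open>f\<close> and \<open>B f\<close>.\<close>
  define P where "P = [:c powr r - r * c powr r, 0, r * c powr (r - 1):]"
  have c: "c > 0" using False by (simp add: c_def)
  have r: "1 \<le> r" using p by (simp add: r_def)
  have n: "(norm f)\<^sup>2 \<le> 1" using f by (simp add: power_le_one)
  have cc: "c * c powr (r - 1) = c powr r" using powr_mult_base[of c "r - 1"] c by simp
  have "norm (B f) powr p = c powr r"
    by (simp add: c_def r_def power2_powr_half)
  \<comment> \<open>The constant coefficient \<open>(1 - r) * c powr r\<close> of \<open>P\<close>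
    is nonpositive because \<open>p\<close> \<ge> 2, so a norm of \<open>f\<close> below 1 can only
    raise the form.\<close>
  also have "\<dots> \<le> c powr r * (r + (1 - r) * (norm f)\<^sup>2)"
  proof -
    have "0 \<le> (r - 1) * (1 - (norm f)\<^sup>2)" using r n by simp
    hence "1 \<le> r + (1 - r) * (norm f)\<^sup>2" by (simp add: algebra_simps)
    thus ?thesis using mult_left_mono[of 1 _ "c powr r"] by simp
  qed
  also have "\<dots> = inner (poly_op P (op_abs B) f) f"
  proof -
    have "inner (op_abs B (op_abs B f)) f = c"
      using pos_opD(3)[OF pos_op_op_abs[OF B]]
      by (simp add: c_def power2_norm_eq_inner[symmetric] norm_op_abs[OF B])
    hence "inner (poly_op P (op_abs B) f) f
        = (c powr r - r * c powr r) * (norm f)\<^sup>2 + r * c powr (r - 1) * c"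
      by (simp add: P_def poly_op_pCons blinfun.bilinear_simps inner_add_left power2_norm_eq_inner)
    also have "r * c powr (r - 1) * c = r * c powr r" using cc by (simp add: mult_ac)
    finally show ?thesis by (simp add: algebra_simps)
  qed
  also have "\<dots> \<le> inner (op_powr (op_abs B) p f) f"
    unfolding op_powr_def
  proof (rule inner_poly_op_le_op_fun[OF pos_op_op_abs[OF B]])
    show "continuous_on {0..norm (op_abs B)} (\<lambda>x. x powr p)"
      using p by (intro continuous_on_powr_nonneg) simp
    fix t assume t: "t \<in> {0..norm (op_abs B)}"
    have "poly P t = c powr r + r * c powr (r - 1) * (t\<^sup>2 - c)"
      using cc by (simp add: P_def algebra_simps power2_eq_square)
    also have "\<dots> \<le> (t\<^sup>2) powr r" using c r by (intro powr_tangent_le) auto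
    also have "(t\<^sup>2) powr r = t powr p"
      using t by (simp add: r_def power2_powr_half)
    finally show "poly P t \<le> t powr p" .
  qed
  finally show ?thesis .
qed

section \<open>Orthonormal families and compact operators\<close>

definition orthonormal :: "('i \<Rightarrow> 'h::complex_hilbert) \<Rightarrow> 'i set \<Rightarrow> bool" where
  "orthonormal e I \<longleftrightarrow> (\<forall>i\<in>I. \<forall>j\<in>I. cinner (e i) (e j) = (if i = j then 1 else 0))"

definition proj :: "('i \<Rightarrow> 'h::complex_hilbert) \<Rightarrow> 'i set \<Rightarrow> 'h \<Rightarrow> 'h" where
  "proj e I x = (\<Sum>i\<in>I. cinner x (e i) *\<^sub>C e i)"

lemma orthonormalD:
  "orthonormal e I \<Longrightarrow> i \<in> I \<Longrightarrow> j \<in> I \<Longrightarrow> cinner (e i) (e j) = (if i = j then 1 else 0)"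
  by (simp add: orthonormal_def)

lemma orthonormal_subset: "orthonormal e I \<Longrightarrow> J \<subseteq> I \<Longrightarrow> orthonormal e J"
  unfolding orthonormal_def by blast

lemma orthonormal_norm:
  assumes "orthonormal e I" "i \<in> I" shows "norm (e i) = 1"
proof -
  have "complex_of_real ((norm (e i))\<^sup>2) = of_real (1\<^sup>2)"
    using orthonormalD[OF assms(1) assms(2) assms(2)] by (simp only: cinner_self[symmetric]) simp
  hence "(norm (e i))\<^sup>2 = 1\<^sup>2" by (simp only: of_real_eq_iff)
  thus ?thesis by (simp only: power2_eq_iff_nonneg norm_ge_zero zero_le_one)
qed

lemma orthonormal_sum_cinner:
  assumes "finite I" "orthonormal e I" "j \<in> I"
  shows "cinner (\<Sum>i\<in>I. c i *\<^sub>C e i) (e j) = c j"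
proof -
  have "cinner (\<Sum>i\<in>I. c i *\<^sub>C e i) (e j) = (\<Sum>i\<in>I. if i = j then c i else 0)"
    unfolding cinner_sum_left
    by (rule sum.cong) (use assms in \<open>auto simp: cinner_scaleC_left orthonormalD\<close>)
  thus ?thesis using assms by simp
qed

lemma cinner_proj: "finite I \<Longrightarrow> orthonormal e I \<Longrightarrow> j \<in> I \<Longrightarrow> cinner (proj e I x) (e j) = cinner x (e j)"
  unfolding proj_def by (rule orthonormal_sum_cinner)

lemma cinner_residual:
  "finite I \<Longrightarrow> orthonormal e I \<Longrightarrow> j \<in> I \<Longrightarrow> cinner (x - proj e I x) (e j) = 0"
  by (simp add: cinner_diff_left cinner_proj)

lemma proj_self_adjoint: "cinner (proj e I x) y = cinner x (proj e I y)"
  unfolding proj_def cinner_sum_left cinner_sum_right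
  by (rule sum.cong) (simp_all add: cinner_scaleC_left cinner_scaleC_right flip: cinner_commute)

lemma cinner_sum_orthogonal:
  assumes "\<And>i. i \<in> I \<Longrightarrow> cinner z (e i) = 0"
  shows "cinner z (\<Sum>i\<in>I. c i *\<^sub>C e i) = 0"
  unfolding cinner_sum_right by (rule sum.neutral) (simp add: cinner_scaleC_right assms)

lemma norm_sum_orthonormal:
  assumes "finite I" "orthonormal e I"
  shows "(norm (\<Sum>i\<in>I. c i *\<^sub>C e i))\<^sup>2 = (\<Sum>i\<in>I. (cmod (c i))\<^sup>2)"
proof -
  have "complex_of_real ((norm (\<Sum>i\<in>I. c i *\<^sub>C e i))\<^sup>2)
      = (\<Sum>j\<in>I. cnj (c j) * cinner (\<Sum>i\<in>I. c i *\<^sub>C e i) (e j))"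
    unfolding cinner_self[symmetric] by (subst cinner_sum_right) (simp add: cinner_scaleC_right)
  also have "\<dots> = (\<Sum>j\<in>I. c j * cnj (c j))"
    by (rule sum.cong) (simp_all add: orthonormal_sum_cinner[OF assms])
  also have "\<dots> = of_real (\<Sum>j\<in>I. (cmod (c j))\<^sup>2)"
    by (simp only: of_real_sum complex_norm_square)
  finally show ?thesis by (simp only: of_real_eq_iff)
qed

lemma norm_proj:
  "finite I \<Longrightarrow> orthonormal e I \<Longrightarrow> (norm (proj e I x))\<^sup>2 = (\<Sum>i\<in>I. (cmod (cinner x (e i)))\<^sup>2)"
  unfolding proj_def by (rule norm_sum_orthonormal)

lemma norm_add_orthogonal:
  assumes "cinner x y = (0::complex)"
  shows "(norm (x + y :: 'h::complex_hilbert))\<^sup>2 = (norm x)\<^sup>2 + (norm y)\<^sup>2"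
proof -
  have "inner x y = 0" using assms by (simp flip: Re_cinner)
  thus ?thesis by (simp add: power2_norm_eq_inner inner_add_left inner_add_right inner_commute)
qed

lemma norm_residual:
  assumes "finite I" "orthonormal e I"
  shows "(norm x)\<^sup>2 = (norm (x - proj e I x))\<^sup>2 + (norm (proj e I x))\<^sup>2"
proof -
  have "cinner (x - proj e I x) (proj e I x) = 0"
    unfolding proj_def[of e I x]
    by (rule cinner_sum_orthogonal) (simp add: cinner_residual[OF assms] flip: proj_def)
  from norm_add_orthogonal[OF this] show ?thesis by simp
qed

lemma Bessel:
  "finite I \<Longrightarrow> orthonormal e I \<Longrightarrow> (\<Sum>i\<in>I. (cmod (cinner x (e i)))\<^sup>2) \<le> (norm x)\<^sup>2"
  using norm_residual[of I e x] by (simp add: norm_proj)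

lemma cmod_cinner_commute: "cmod (cinner x y) = cmod (cinner y (x::'h::complex_hilbert))"
  by (metis cinner_commute complex_mod_cnj)

lemma Bessel':
  "finite I \<Longrightarrow> orthonormal e I \<Longrightarrow> (\<Sum>i\<in>I. (cmod (cinner (e i) x))\<^sup>2) \<le> (norm x)\<^sup>2"
  using Bessel[of I e x] by (simp add: cmod_cinner_commute[of x])

lemma norm_proj_le:
  assumes "finite I" "orthonormal e I" shows "norm (proj e I x) \<le> norm x"
  by (rule power2_le_imp_le) (use norm_residual[OF assms, of x] in simp_all)

lemma norm_residual_le:
  assumes "finite I" "orthonormal e I" shows "norm (x - proj e I x) \<le> norm x"
  by (rule power2_le_imp_le) (use norm_residual[OF assms, of x] in simp_all)

lemma proj_op:
  assumes "finite I" "orthonormal e I"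
  shows "\<exists>Q\<in>bounded_ops. \<forall>x. Q x = proj e I x"
proof -
  have C: "proj e I (c *\<^sub>C x) = c *\<^sub>C proj e I x" for c x
    by (simp add: proj_def cinner_scaleC_left scaleC_sum_right scaleC_scaleC)
  have "bounded_linear (proj e I)"
  proof (rule bounded_linear_intro)
    show "proj e I (x + y) = proj e I x + proj e I y" for x y
      by (simp add: proj_def cinner_add_left scaleC_add_left sum.distrib)
    show "proj e I (r *\<^sub>R x) = r *\<^sub>R proj e I x" for r x
      using C[of "of_real r" x] by (simp add: scaleC_of_real)
    show "norm (proj e I x) \<le> norm x * 1" for x
      using norm_proj_le[OF assms] by simp
  qed
  thus ?thesis
    by (intro bexI[of _ "Blinfun (proj e I)"])
      (simp_all add: bounded_linear_Blinfun_apply bounded_ops_def C)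
qed

lemma proj_in_span: "proj e I x \<in> complex_vector.span (e ` I)"
  unfolding proj_def
  by (intro complex_vector.span_sum complex_vector.span_scale complex_vector.span_base) simp

lemma span_orthogonal:
  assumes "x \<in> complex_vector.span S" "\<And>s. s \<in> S \<Longrightarrow> cinner y s = 0"
  shows "cinner y x = (0::complex)"
proof -
  have "complex_vector.subspace {x. cinner y x = 0}"
    by (simp add: complex_vector.subspace_def cinner_add_right cinner_scaleC_right)
  moreover have "S \<subseteq> {x. cinner y x = 0}" using assms(2) by auto
  ultimately show ?thesis using complex_vector.span_minimal assms(1) by blast
qed

lemma proj_span_eq:
  assumes "finite I" "orthonormal e I" "x \<in> complex_vector.span (e ` I)"
  shows "proj e I x = x"
proof -
  have "x - proj e I x \<in> complex_vector.span (e ` I)"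
    by (intro complex_vector.span_diff assms proj_in_span)
  hence "cinner (x - proj e I x) (x - proj e I x) = 0"
    by (rule span_orthogonal) (use cinner_residual[OF assms(1,2)] in auto)
  thus ?thesis by (simp add: cinner_self)
qed

lemma orthonormal_inj: "orthonormal e I \<Longrightarrow> inj_on e I"
  by (rule inj_onI) (metis orthonormalD zero_neq_one)

lemma orthonormal_independent:
  assumes "finite I" "orthonormal e I" shows "complex_vector.independent (e ` I)"
proof
  assume "complex_vector.dependent (e ` I)"
  then obtain u v where uv: "v \<in> e ` I" "u v \<noteq> 0" "(\<Sum>w\<in>e ` I. u w *\<^sub>C w) = 0"
    using assms(1) by (auto simp: complex_vector.dependent_finite)
  then obtain j where j: "j \<in> I" "v = e j" by auto
  have "(\<Sum>i\<in>I. u (e i) *\<^sub>C e i) = 0"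
    using uv(3) by (simp add: sum.reindex[OF orthonormal_inj[OF assms(2)]])
  hence "u (e j) = 0" using orthonormal_sum_cinner[OF assms j(1), of "\<lambda>i. u (e i)"] by simp
  thus False using uv j by simp
qed

text \<open>The orthonormal set is indexed by itself, whence the identity as family. One inclusion
  lets orthogonality to \<open>S\<close> be tested on \<open>E\<close>, the other keeps vectors
  built from \<open>E\<close> inside the span of \<open>S\<close>.\<close>

lemma Gram_Schmidt:
  assumes "finite S"
  shows "\<exists>E::'h::complex_hilbert set. finite E \<and> orthonormal (\<lambda>x. x) E \<and> card E \<le> card S \<and>
    S \<subseteq> complex_vector.span E \<and> E \<subseteq> complex_vector.span S"
  using assms
proof (induction S rule: finite_induct)
  case empty
  show ?case by (intro exI[of _ "{}"]) (simp add: orthonormal_def)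
next
  case (insert s S)
  then obtain E :: "'h set" where E: "finite E" "orthonormal (\<lambda>x. x) E" "card E \<le> card S"
    "S \<subseteq> complex_vector.span E" "E \<subseteq> complex_vector.span S" by blast
  have ES: "complex_vector.span E \<subseteq> complex_vector.span (insert s S)"
    using E(5) by (meson complex_vector.span_minimal complex_vector.span_mono
        complex_vector.subspace_span order_trans subset_insertI)
  define x where "x = s - proj (\<lambda>x. x) E s"
  have psp: "proj (\<lambda>x. x) E s \<in> complex_vector.span E" using proj_in_span[of "\<lambda>x. x" E s] by simp
  show ?case
  proof (cases "x = 0")
    case True
    hence "s \<in> complex_vector.span E" using psp by (simp add: x_def)
    moreover have "card E \<le> card (insert s S)" using E(3) insert(1,2) by simp
    moreover have "E \<subseteq> complex_vector.span (insert s S)"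
      using ES complex_vector.span_superset[of E] by blast
    ultimately show ?thesis using E(1,2,4) by blast
  next
    case False
    define y where "y = (1 / norm x) *\<^sub>R x"
    have y1: "cinner y y = 1" using False by (simp add: y_def cinner_self)
    have orth: "cinner y e = 0" "cinner e y = 0" if "e \<in> E" for e
    proof -
      show "cinner y e = 0"
        using cinner_residual[OF E(1,2), of e s] that by (simp add: y_def x_def cinner_scaleR_left)
      thus "cinner e y = 0" using cinner_commute[of e y] by simp
    qed
    have "y \<notin> E" using orth(1)[of y] y1 by auto
    have yx: "x = norm x *\<^sub>C y" using False by (simp add: y_def scaleC_of_real)
    have on: "orthonormal (\<lambda>x. x) (insert y E)"
      using E(2) orth y1 \<open>y \<notin> E\<close> by (auto simp: orthonormal_def)
    have "s = proj (\<lambda>x. x) E s + norm x *\<^sub>C y" using yx by (simp add: x_def)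
    also have "\<dots> \<in> complex_vector.span (insert y E)"
      using psp complex_vector.span_mono[of E "insert y E"]
      by (intro complex_vector.span_add complex_vector.span_scale)
        (auto intro: complex_vector.span_base)
    finally have s: "s \<in> complex_vector.span (insert y E)" .
    have "x \<in> complex_vector.span (insert s S)"
      unfolding x_def using psp ES
      by (intro complex_vector.span_diff) (auto intro: complex_vector.span_base)
    hence "(of_real (1 / norm x)) *\<^sub>C x \<in> complex_vector.span (insert s S)"
      by (rule complex_vector.span_scale)
    hence "y \<in> complex_vector.span (insert s S)" by (simp only: y_def scaleC_of_real)
    moreover have "E \<subseteq> complex_vector.span (insert s S)"
      using ES complex_vector.span_superset[of E] by blast
    moreover have "insert s S \<subseteq> complex_vector.span (insert y E)"
      using s E(4) complex_vector.span_mono[of E "insert y E"] by blast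
    moreover have "card (insert y E) \<le> card (insert s S)"
      using E(1,3) insert(1,2) \<open>y \<notin> E\<close> by simp
    ultimately show ?thesis using on E(1) by blast
  qed
qed

lemma exists_orthogonal_unit:
  fixes S E :: "'h::complex_hilbert set"
  assumes "finite S" "x \<notin> complex_vector.span S"
  shows "\<exists>y. norm y = 1 \<and> (\<forall>s\<in>S. cinner y s = 0) \<and>
    y \<in> complex_vector.span (insert x S)"
proof -
  obtain E :: "'h set" where E: "finite E" "orthonormal (\<lambda>x. x) E"
    "S \<subseteq> complex_vector.span E" "E \<subseteq> complex_vector.span S"
    using Gram_Schmidt[OF assms(1)] by blast
  have ES: "complex_vector.span E \<subseteq> complex_vector.span S"
    using E(4) by (simp add: complex_vector.span_minimal)
  have p: "proj (\<lambda>x. x) E x \<in> complex_vector.span S"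
    using proj_in_span[of "\<lambda>x. x" E x] ES by auto
  define z where "z = x - proj (\<lambda>x. x) E x"
  have "z \<noteq> 0" using assms(2) p by (auto simp: z_def)
  have "cinner z s = 0" if "s \<in> S" for s
    by (rule span_orthogonal[where S = E])
      (use E that cinner_residual[OF E(1,2)] in \<open>auto simp: z_def\<close>)
  moreover have "proj (\<lambda>x. x) E x \<in> complex_vector.span (insert x S)"
    using p complex_vector.span_mono[of S "insert x S"] by blast
  hence "z \<in> complex_vector.span (insert x S)"
    unfolding z_def by (intro complex_vector.span_diff) (auto intro: complex_vector.span_base)
  hence "of_real (1 / norm z) *\<^sub>C z \<in> complex_vector.span (insert x S)"
    by (rule complex_vector.span_scale)
  hence "(1 / norm z) *\<^sub>R z \<in> complex_vector.span (insert x S)" by (simp only: scaleC_of_real)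
  ultimately show ?thesis using \<open>z \<noteq> 0\<close>
    by (intro exI[of _ "(1 / norm z) *\<^sub>R z"]) (simp add: cinner_scaleR_left)
qed

text \<open>A dimension count: \<open>m + 1\<close> orthonormal vectors against at most
  \<open>m\<close> conditions. On the span each \<open>c\<close> may be replaced by its projection,
  since projections are self-adjoint; the projected vectors cannot span all
  \<open>e k\<close>.\<close>

lemma exists_orthogonal_in_span:
  fixes C :: "'h::complex_hilbert set"
  assumes e: "orthonormal e {..m::nat}" and C: "finite C" "card C \<le> m"
  shows "\<exists>x\<in>complex_vector.span (e ` {..m}). norm x = 1 \<and> (\<forall>c\<in>C. cinner x c = 0)"
proof -
  define D where "D = proj e {..m} ` C"
  have D: "finite D" "card D \<le> m" "D \<subseteq> complex_vector.span (e ` {..m})"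
    using C card_image_le[OF C(1), of "proj e {..m}"] proj_in_span[of e "{..m}"]
    by (auto simp: D_def)
  have "\<not> e ` {..m} \<subseteq> complex_vector.span D"
  proof
    assume "e ` {..m} \<subseteq> complex_vector.span D"
    hence "card (e ` {..m}) \<le> card D"
      using complex_vector.independent_span_bound[OF D(1) orthonormal_independent[OF _ e]] by simp
    thus False using D(2) card_image[OF orthonormal_inj[OF e]] by simp
  qed
  then obtain k where k: "k \<le> m" "e k \<notin> complex_vector.span D" by auto
  obtain x where x: "norm x = 1" "\<And>d. d \<in> D \<Longrightarrow> cinner x d = 0"
    "x \<in> complex_vector.span (insert (e k) D)"
    using exists_orthogonal_unit[OF D(1) k(2)] by blast
  have "insert (e k) D \<subseteq> complex_vector.span (e ` {..m})"
    using D(3) k(1) complex_vector.span_base[of "e k" "e ` {..m}"] by auto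
  hence xs: "x \<in> complex_vector.span (e ` {..m})"
    using x(3) by (meson complex_vector.span_minimal complex_vector.subspace_span subsetD)
  have "cinner x c = 0" if "c \<in> C" for c
  proof -
    have "cinner x c = cinner (proj e {..m} x) c" by (simp add: proj_span_eq[OF _ e xs])
    also have "\<dots> = cinner x (proj e {..m} c)" by (rule proj_self_adjoint)
    also have "\<dots> = 0" using x(2) that by (simp add: D_def)
    finally show ?thesis .
  qed
  thus ?thesis using x(1) xs by blast
qed

section \<open>Compact operators\<close>

lemma compact_op_iff_seq:
  "compact_op A \<longleftrightarrow> (\<forall>x::nat \<Rightarrow> 'h::complex_hilbert. (\<forall>n. norm (x n) \<le> 1) \<longrightarrow>
     (\<exists>\<phi>. strict_mono \<phi> \<and> convergent (\<lambda>n. A (x (\<phi> n)))))"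
proof
  assume "compact_op A"
  hence seq: "seq_compact (closure (blinfun_apply A ` cball 0 1))"
    by (simp add: compact_op_def compact_eq_seq_compact_metric)
  show "\<forall>x::nat \<Rightarrow> 'h. (\<forall>n. norm (x n) \<le> 1) \<longrightarrow>
     (\<exists>\<phi>. strict_mono \<phi> \<and> convergent (\<lambda>n. A (x (\<phi> n))))"
  proof (intro allI impI)
    fix x :: "nat \<Rightarrow> 'h" assume "\<forall>n. norm (x n) \<le> 1"
    hence "\<forall>n. A (x n) \<in> closure (blinfun_apply A ` cball 0 1)"
      by (intro allI subsetD[OF closure_subset]) simp
    from seq_compactE[OF seq this] obtain l \<phi>
      where "strict_mono (\<phi> :: nat \<Rightarrow> nat)" "((\<lambda>n. A (x n)) \<circ> \<phi>) \<longlonglongrightarrow> l" .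
    thus "\<exists>\<phi>. strict_mono \<phi> \<and> convergent (\<lambda>n. A (x (\<phi> n)))"
      by (auto simp: o_def convergent_def)
  qed
next
  assume *: "\<forall>x::nat \<Rightarrow> 'h. (\<forall>n. norm (x n) \<le> 1) \<longrightarrow>
     (\<exists>\<phi>. strict_mono \<phi> \<and> convergent (\<lambda>n. A (x (\<phi> n))))"
  show "compact_op A"
    unfolding compact_op_def compact_eq_seq_compact_metric seq_compact_def
  proof (intro allI impI)
    fix f :: "nat \<Rightarrow> 'h" assume f: "\<forall>n. f n \<in> closure (blinfun_apply A ` cball 0 1)"
    have "\<exists>x. norm x \<le> 1 \<and> dist (A x) (f n) < 1 / real (Suc n)" for n
      using f[rule_format, of n] unfolding closure_approachable
      by (drule_tac x = "1 / real (Suc n)" in spec) auto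
    then obtain x where x: "\<And>n. norm (x n) \<le> 1" "\<And>n. dist (A (x n)) (f n) < 1 / real (Suc n)"
      by metis
    from *[rule_format, of x] x(1) obtain \<phi> l
      where \<phi>: "strict_mono \<phi>" and l: "(\<lambda>n. A (x (\<phi> n))) \<longlonglongrightarrow> l"
      by (auto simp: convergent_def)
    have "(\<lambda>n. f n - A (x n)) \<longlonglongrightarrow> 0"
    proof (rule Lim_null_comparison)
      show "\<forall>\<^sub>F n in sequentially. norm (f n - A (x n)) \<le> 1 / real (Suc n)"
        using x(2)
        by (intro always_eventually allI) (simp add: dist_norm norm_minus_commute less_imp_le)
    qed (rule LIMSEQ_Suc[OF lim_1_over_n])
    hence "(\<lambda>n. f (\<phi> n) - A (x (\<phi> n))) \<longlonglongrightarrow> 0"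
      using LIMSEQ_subseq_LIMSEQ[OF _ \<phi>] by (auto simp: o_def)
    from tendsto_add[OF this l] have lim: "(f \<circ> \<phi>) \<longlonglongrightarrow> l" by (simp add: o_def)
    moreover have "l \<in> closure (blinfun_apply A ` cball 0 1)"
      using closed_sequentially[OF closed_closure _ lim] f by auto
    ultimately show "\<exists>l\<in>closure (blinfun_apply A ` cball 0 1). \<exists>\<phi>. strict_mono \<phi> \<and> (f \<circ> \<phi>) \<longlonglongrightarrow> l"
      using \<phi> by blast
  qed
qed

lemma compact_op_subseq:
  assumes "compact_op A" "\<And>n. norm (x n) \<le> 1"
  obtains \<phi> l where "strict_mono (\<phi> :: nat \<Rightarrow> nat)" "(\<lambda>n. A (x (\<phi> n))) \<longlonglongrightarrow> l"
  using assms unfolding compact_op_iff_seq convergent_def by blast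

lemma compact_op_diff:
  assumes "compact_op A" "compact_op B" shows "compact_op (A - B)"
  unfolding compact_op_iff_seq
proof (intro allI impI)
  fix x :: "nat \<Rightarrow> 'a" assume x: "\<forall>n. norm (x n) \<le> 1"
  obtain \<phi> l where \<phi>: "strict_mono \<phi>" "(\<lambda>n. A (x (\<phi> n))) \<longlonglongrightarrow> l"
    using compact_op_subseq[OF assms(1)] x by metis
  obtain \<psi> k where \<psi>: "strict_mono \<psi>" "(\<lambda>n. B (x (\<phi> (\<psi> n)))) \<longlonglongrightarrow> k"
    using compact_op_subseq[OF assms(2), of "\<lambda>n. x (\<phi> n)"] x by metis
  have "(\<lambda>n. A (x (\<phi> (\<psi> n)))) \<longlonglongrightarrow> l"
    using LIMSEQ_subseq_LIMSEQ[OF \<phi>(2) \<psi>(1)] by (simp add: o_def)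
  from tendsto_diff[OF this \<psi>(2)] strict_mono_o[OF \<phi>(1) \<psi>(1)]
  show "\<exists>\<phi>. strict_mono \<phi> \<and> convergent (\<lambda>n. (A - B) (x (\<phi> n)))"
    by (intro exI[of _ "\<phi> \<circ> \<psi>"]) (auto simp: blinfun.diff_left convergent_def)
qed

lemma compact_op_comp_left:
  assumes "compact_op A" shows "compact_op (B o\<^sub>L A)"
  unfolding compact_op_iff_seq
proof (intro allI impI)
  fix x :: "nat \<Rightarrow> 'a" assume x: "\<forall>n. norm (x n) \<le> 1"
  obtain \<phi> l where \<phi>: "strict_mono \<phi>" "(\<lambda>n. A (x (\<phi> n))) \<longlonglongrightarrow> l"
    using compact_op_subseq[OF assms(1)] x by metis
  have "(\<lambda>n. B (A (x (\<phi> n)))) \<longlonglongrightarrow> B l"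
    by (intro tendsto_intros \<phi>)
  thus "\<exists>\<phi>. strict_mono \<phi> \<and> convergent (\<lambda>n. (B o\<^sub>L A) (x (\<phi> n)))"
    using \<phi>(1) by (auto simp: convergent_def)
qed

lemma compact_op_comp_right:
  fixes A U :: "'h::complex_hilbert \<Rightarrow>\<^sub>L 'h"
  assumes "compact_op A" "\<And>x. norm (U x) \<le> norm x" shows "compact_op (A o\<^sub>L U)"
  unfolding compact_op_iff_seq
proof (intro allI impI)
  fix x :: "nat \<Rightarrow> 'h" assume "\<forall>n. norm (x n) \<le> 1"
  hence "norm (U (x n)) \<le> 1" for n using assms(2) order_trans by blast
  with compact_op_subseq[OF assms(1), of "\<lambda>n. U (x n)"]
  show "\<exists>\<phi>. strict_mono \<phi> \<and> convergent (\<lambda>n. (A o\<^sub>L U) (x (\<phi> n)))"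
    by (auto simp: convergent_def) metis
qed

text \<open>Along a subsequence on which \<open>T\<close> converges, the inequality for a difference
  bounds \<open>X\<close> by \<open>T\<close>, so \<open>X\<close> is Cauchy there. The difference
  is halved because the inequality is available on the unit ball and is not homogeneous.\<close>

lemma compact_op_of_form:
  fixes X T :: "'h::complex_hilbert \<Rightarrow>\<^sub>L 'h"
  assumes T: "compact_op T" and p: "p > 0" and C: "C \<ge> 0"
    and le: "\<And>x. norm x \<le> 1 \<Longrightarrow> norm (X x) powr p \<le> C * inner (T x) x"
  shows "compact_op X"
  unfolding compact_op_iff_seq
proof (intro allI impI)
  fix x :: "nat \<Rightarrow> 'h" assume x: "\<forall>n. norm (x n) \<le> 1"
  obtain \<phi> l where \<phi>: "strict_mono \<phi>" "(\<lambda>n. T (x (\<phi> n))) \<longlonglongrightarrow> l"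
    using compact_op_subseq[OF T] x by metis
  have "Cauchy (\<lambda>n. X (x (\<phi> n)))"
  proof (rule CauchyI)
    fix e :: real assume e: "0 < e"
    define d where "d = (e / 2) powr p / (C + 1)"
    have d: "d > 0" "C * d < (e / 2) powr p"
    proof -
      have "d * (C + 1) = (e / 2) powr p" using C by (simp add: d_def)
      moreover show "d > 0" using e C by (simp add: d_def)
      ultimately show "C * d < (e / 2) powr p" by (simp add: algebra_simps)
    qed
    have "Cauchy (\<lambda>n. T (x (\<phi> n)))"
      using \<phi>(2) by (rule LIMSEQ_imp_Cauchy)
    then obtain N where N: "\<And>m n. N \<le> m \<Longrightarrow> N \<le> n \<Longrightarrow>
        norm (T (x (\<phi> m)) - T (x (\<phi> n))) < d"
      using CauchyD[OF _ d(1)] by metis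
    have "norm (X (x (\<phi> m)) - X (x (\<phi> n))) < e"
      if mn: "N \<le> m" "N \<le> n" for m n
    proof -
      define z where "z = (1/2) *\<^sub>R (x (\<phi> m) - x (\<phi> n))"
      have "norm (x (\<phi> m) - x (\<phi> n)) \<le> 2"
        using norm_triangle_ineq4[of "x (\<phi> m)" "x (\<phi> n)"] x[rule_format, of "\<phi> m"]
          x[rule_format, of "\<phi> n"]
        by linarith
      hence z1: "norm z \<le> 1" by (simp add: z_def)
      have "norm (T z) = norm (T (x (\<phi> m)) - T (x (\<phi> n))) / 2"
        by (simp add: z_def blinfun.bilinear_simps)
      hence Tz: "norm (T z) \<le> d" using N[OF mn] d(1) by simp
      have "norm (X z) powr p \<le> C * inner (T z) z" by (rule le[OF z1])
      also have "inner (T z) z \<le> norm (T z) * norm z"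
        by (rule norm_cauchy_schwarz)
      also have "\<dots> \<le> d * 1" using Tz z1 d(1) by (intro mult_mono) auto
      finally have "norm (X z) powr p \<le> C * d" using C by (simp add: mult_left_mono)
      hence "norm (X z) powr p < (e / 2) powr p" using d(2) by linarith
      hence "norm (X z) < e / 2"
        using powr_mono2[of p "e / 2" "norm (X z)"] e p by linarith
      moreover have "norm (X z) = norm (X (x (\<phi> m)) - X (x (\<phi> n))) / 2"
        by (simp add: z_def blinfun.bilinear_simps)
      ultimately show ?thesis by simp
    qed
    thus "\<exists>N. \<forall>m\<ge>N. \<forall>n\<ge>N. norm (X (x (\<phi> m)) - X (x (\<phi> n))) < e"
      by blast
  qed
  thus "\<exists>\<phi>. strict_mono \<phi> \<and> convergent (\<lambda>n. X (x (\<phi> n)))"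
    using \<phi>(1) Cauchy_convergent by blast
qed

section \<open>Singular values\<close>

definition infinite_dim :: "'h::complex_hilbert itself \<Rightarrow> bool" where
  "infinite_dim _ \<longleftrightarrow> \<not> (\<exists>S :: 'h set. finite S \<and> complex_vector.span S = UNIV)"

lemma infinite_dim_orthogonal_unit:
  assumes "infinite_dim TYPE('h::complex_hilbert)" "finite (S :: 'h set)"
  shows "\<exists>y. norm y = 1 \<and> (\<forall>s\<in>S. cinner y s = 0)"
proof -
  obtain x where "x \<notin> complex_vector.span S" using assms unfolding infinite_dim_def by blast
  thus ?thesis using exists_orthogonal_unit[OF assms(2)] by blast
qed

text \<open>The supremum \<open>l\<close> of the form over unit vectors orthogonal to
  \<open>F\<close> is attained. A maximizing sequence satisfies \<open>R x - l x\<close>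
  \<longlonglongrightarrow> 0; compactness makes \<open>R x\<close> converge along a subsequence,
  hence \<open>x\<close> as well when \<open>l\<close> is nonzero. The complement is invariant
  because \<open>F\<close> consists of eigenvectors.\<close>

lemma compact_op_top_eigenvector:
  fixes R :: "'h::complex_hilbert \<Rightarrow>\<^sub>L 'h"
  assumes R: "pos_op R" "compact_op R" and inf: "infinite_dim TYPE('h)"
    and F: "finite F" "\<And>s. s \<in> F \<Longrightarrow> \<exists>l. R s = l *\<^sub>R s"
  shows "\<exists>e. norm e = 1 \<and> (\<forall>s\<in>F. cinner e s = 0) \<and>
    R e = inner (R e) e *\<^sub>R e \<and>
    (\<forall>x. (\<forall>s\<in>F. cinner x s = 0) \<longrightarrow>
      inner (R x) x \<le> inner (R e) e * (norm x)\<^sup>2)"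
proof -
  define V where "V = {x. \<forall>s\<in>F. cinner x s = 0}"
  define g where "g x = inner (R x) x" for x
  have gs: "g (r *\<^sub>R x) = r\<^sup>2 * g x" for r x
    by (simp add: g_def blinfun.scaleR_right power2_eq_square)
  have V_R: "R x \<in> V" if "x \<in> V" for x
    unfolding V_def
  proof (intro CollectI ballI)
    fix s assume s: "s \<in> F"
    then obtain l where "R s = l *\<^sub>R s" using F by blast
    thus "cinner (R x) s = 0"
      using that s by (simp add: V_def pos_opD(2)[OF R(1)] cinner_scaleR_right)
  qed
  have V_s: "r *\<^sub>R x \<in> V" if "x \<in> V" for r x
    using that by (simp add: V_def cinner_scaleR_left)
  define U where "U = {x \<in> V. norm x = 1}"
  obtain u where u: "u \<in> U"
    using infinite_dim_orthogonal_unit[OF inf F(1)] by (auto simp: U_def V_def)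
  have bdd: "bdd_above (g ` U)"
  proof (rule bdd_aboveI2)
    show "g x \<le> norm R" if "x \<in> U" for x
      using inner_blinfun_le[of R x] that by (simp add: U_def g_def)
  qed
  define l where "l = (SUP x\<in>U. g x)"
  have g0: "0 \<le> g x" for x using pos_opD(4)[OF R(1)] by (simp add: g_def)
  have gl: "g x \<le> l * (norm x)\<^sup>2" if "x \<in> V" for x
  proof (cases "x = 0")
    case False
    have "(1 / norm x) *\<^sub>R x \<in> U" using False V_s[OF that] by (simp add: U_def)
    hence "g ((1 / norm x) *\<^sub>R x) \<le> l" unfolding l_def using bdd by (rule cSUP_upper)
    thus ?thesis using False by (simp add: gs field_simps)
  qed (simp add: g_def)
  have l0: "0 \<le> l" using gl[of u] g0[of u] u by (simp add: U_def)
  have norm_R: "(norm (R x))\<^sup>2 \<le> c * g x" if "x \<in> V" "0 < c" "l \<le> c" for x c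
    unfolding g_def
  proof (rule norm_positive_form_le)
    show "inner (R (R x)) (R x) \<le> c * (norm (R x))\<^sup>2"
      using gl[OF V_R[OF that(1)]] mult_right_mono[OF that(3), of "(norm (R x))\<^sup>2"]
      by (simp add: g_def)
  qed (use pos_opD[OF R(1)] that in auto)
  have "\<exists>e\<in>U. R e = l *\<^sub>R e"
  proof (cases "l = 0")
    case True
    hence "g u = 0" using gl[of u] g0[of u] u by (simp add: U_def)
    hence "R u = 0" using norm_R[of u 1] u True by (simp add: U_def)
    thus ?thesis using u True by auto
  next
    case False
    hence l: "l > 0" using l0 by simp
    have "\<exists>x\<in>U. l - 1 / real (Suc n) < g x" for n
      using less_cSUP_iff[of U g "l - 1 / real (Suc n)"] u bdd unfolding l_def by auto
    then obtain X where X: "\<And>n. X n \<in> U" "\<And>n. l - 1 / real (Suc n) < g (X n)" by metis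
    have Xn: "norm (X n) = 1" "X n \<in> V" for n using X(1)[of n] by (auto simp: U_def)
    obtain \<phi> y where \<phi>: "strict_mono \<phi>" "(\<lambda>n. R (X (\<phi> n))) \<longlonglongrightarrow> y"
      using compact_op_subseq[OF R(2), of X] Xn(1) by auto
    have sq: "(norm (R (X n) - l *\<^sub>R X n))\<^sup>2 \<le> l * (1 / real (Suc n))" for n
    proof -
      have "(norm (R (X n) - l *\<^sub>R X n))\<^sup>2
          = (norm (R (X n)))\<^sup>2 - 2 * l * g (X n) + l\<^sup>2 * (norm (X n))\<^sup>2"
        unfolding power2_norm_eq_inner g_def
        by (simp add: inner_diff_left inner_diff_right inner_commute power2_eq_square algebra_simps)
      also have "\<dots> \<le> l * g (X n) - 2 * l * g (X n) + l\<^sup>2"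
        using norm_R[OF Xn(2) l order_refl] Xn(1) by simp
      also have "\<dots> = l * (l - g (X n))" by (simp add: power2_eq_square algebra_simps)
      also have "\<dots> \<le> l * (1 / real (Suc n))" using X(2)[of n] l by (intro mult_left_mono) auto
      finally show ?thesis .
    qed
    have "(\<lambda>n. (norm (R (X n) - l *\<^sub>R X n))\<^sup>2) \<longlonglongrightarrow> 0"
    proof (rule Lim_null_comparison)
      show "\<forall>\<^sub>F n in sequentially. norm ((norm (R (X n) - l *\<^sub>R X n))\<^sup>2) \<le> l * (1 / real (Suc n))"
        using sq by (intro always_eventually allI) simp
      show "(\<lambda>n. l * (1 / real (Suc n))) \<longlonglongrightarrow> 0"
        using tendsto_mult_right_zero[OF LIMSEQ_Suc[OF lim_1_over_n]] by simp
    qed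
    from tendsto_real_sqrt[OF this] have "(\<lambda>n. R (X n) - l *\<^sub>R X n) \<longlonglongrightarrow> 0"
      by (simp add: tendsto_norm_zero_cancel)
    hence "(\<lambda>n. R (X (\<phi> n)) - l *\<^sub>R X (\<phi> n)) \<longlonglongrightarrow> 0"
      using LIMSEQ_subseq_LIMSEQ[OF _ \<phi>(1)] by (auto simp: o_def)
    from tendsto_diff[OF \<phi>(2) this] have "(\<lambda>n. l *\<^sub>R X (\<phi> n)) \<longlonglongrightarrow> y" by simp
    from tendsto_scaleR[OF tendsto_const this, of "1 / l"]
    have lim: "(\<lambda>n. X (\<phi> n)) \<longlonglongrightarrow> (1 / l) *\<^sub>R y" using l by simp
    define e where "e = (1 / l) *\<^sub>R y"
    have lim: "(\<lambda>n. X (\<phi> n)) \<longlonglongrightarrow> e" using lim by (simp add: e_def)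
    have "norm e = 1" using LIMSEQ_unique[OF tendsto_norm[OF lim]] Xn(1) by simp
    moreover have "cinner e s = 0" if "s \<in> F" for s
    proof -
      have "(\<lambda>n. cinner (X (\<phi> n)) s) \<longlonglongrightarrow> cinner e s" by (intro tendsto_intros lim)
      moreover have "(\<lambda>n. cinner (X (\<phi> n)) s) = (\<lambda>_. 0)"
        using Xn(2) that by (auto simp: V_def)
      ultimately show ?thesis using LIMSEQ_unique tendsto_const by metis
    qed
    moreover have "(\<lambda>n. R (X (\<phi> n))) \<longlonglongrightarrow> R e"
      by (intro tendsto_intros lim)
    hence "R e = y" using \<phi>(2) LIMSEQ_unique by blast
    hence "R e = l *\<^sub>R e" using l by (simp add: e_def)
    ultimately show ?thesis by (auto simp: U_def V_def)
  qed
  then obtain e where e: "e \<in> U" "R e = l *\<^sub>R e" by blast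
  have "inner (R e) e = l"
    using e by (simp add: U_def flip: power2_norm_eq_inner)
  thus ?thesis using e gl by (intro exI[of _ e]) (auto simp: U_def V_def g_def)
qed

text \<open>Top eigenvectors are chosen greedily, each orthogonal to the earlier ones. Infinite
  dimension keeps the choice from stopping, so the sequence is infinite even for finite rank, with
  eigenvalues that are then eventually 0. Kernel vectors may be missed by the sequence.\<close>

theorem compact_pos_op_spectral:
  fixes R :: "'h::complex_hilbert \<Rightarrow>\<^sub>L 'h"
  assumes R: "pos_op R" "compact_op R" and inf: "infinite_dim TYPE('h)"
  obtains e :: "nat \<Rightarrow> 'h" and l where "orthonormal e UNIV" "decseq l" "l \<longlonglongrightarrow> 0"
    "\<And>n. 0 \<le> l n" "\<And>n. R (e n) = l n *\<^sub>R e n"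
    "\<And>n x. (\<And>i. i < n \<Longrightarrow> cinner x (e i) = 0) \<Longrightarrow> inner (R x) x \<le> l n * (norm x)\<^sup>2"
proof -
  define P where "P f n r \<longleftrightarrow> norm r = 1 \<and> (\<forall>i<n. cinner r (f i) = 0) \<and>
      R r = inner (R r) r *\<^sub>R r \<and>
      (\<forall>x. (\<forall>i<n. cinner x (f i) = 0) \<longrightarrow>
        inner (R x) x \<le> inner (R r) r * (norm x)\<^sup>2)"
    for f and n :: nat and r
  have "\<exists>f. \<forall>n. P f n (f n)"
  proof (rule dependent_wellorder_choice)
    show "P f n r = P g n r" if "\<And>m. m < n \<Longrightarrow> f m = g m" for f g n r
      using that by (simp add: P_def)
    show "\<exists>r. P f n r" if "\<And>m. m < n \<Longrightarrow> P f m (f m)" for f n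
    proof -
      have "\<exists>l. R s = l *\<^sub>R s" if "s \<in> f ` {..<n}" for s
        using that \<open>\<And>m. m < n \<Longrightarrow> P f m (f m)\<close> unfolding P_def by blast
      moreover have "(\<forall>s\<in>f ` {..<n}. cinner x s = 0) \<longleftrightarrow> (\<forall>i<n. cinner x (f i) = 0)" for x
        by auto
      ultimately show ?thesis
        using compact_op_top_eigenvector[OF R inf, of "f ` {..<n}"] unfolding P_def by simp
    qed
  qed
  then obtain e where e: "\<And>n. P e n (e n)" by blast
  define l where "l n = inner (R (e n)) (e n)" for n
  have e1: "norm (e n) = 1" and e2: "i < n \<Longrightarrow> cinner (e n) (e i) = 0"
    and e3: "R (e n) = l n *\<^sub>R e n"
    and e4: "(\<And>i. i < n \<Longrightarrow> cinner x (e i) = 0) \<Longrightarrow> inner (R x) x \<le> l n * (norm x)\<^sup>2" for n i x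
    using e[of n] by (simp_all add: P_def l_def)
  have orthonormal: "orthonormal e UNIV"
    unfolding orthonormal_def
  proof (intro ballI)
    fix i j :: nat
    consider "i < j" | "i = j" | "j < i" by linarith
    thus "cinner (e i) (e j) = (if i = j then 1 else 0)"
    proof cases
      case 1
      thus ?thesis using e2[OF 1] cinner_commute[of "e i" "e j"] by simp
    qed (auto simp: e2 cinner_self e1)
  qed
  have l0: "0 \<le> l n" for n using pos_opD(4)[OF R(1)] by (simp add: l_def)
  have dec: "decseq l"
  proof (rule decseq_SucI)
    show "l (Suc n) \<le> l n" for n
      using e4[of n "e (Suc n)"] e2[of _ "Suc n"] by (simp add: e1 l_def)
  qed
  obtain L where L: "l \<longlonglongrightarrow> L" "\<And>n. L \<le> l n"
    using decseq_convergent[OF dec, of 0] l0 by blast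
  have "0 \<le> L" using L(1) l0 by (intro LIMSEQ_le_const) auto
  \<comment> \<open>Otherwise the vectors \<open>R (e n)\<close> are pairwise orthogonal with norms
    at least \<open>L\<close>, so no subsequence of them is Cauchy.\<close>
  have "L = 0"
  proof (rule ccontr)
    assume "L \<noteq> 0"
    hence Lp: "L > 0" using \<open>0 \<le> L\<close> by simp
    obtain \<phi> y where \<phi>: "strict_mono \<phi>" "(\<lambda>n. R (e (\<phi> n))) \<longlonglongrightarrow> y"
      using compact_op_subseq[OF R(2), of e] e1 by auto
    obtain N where N: "\<And>m n. N \<le> m \<Longrightarrow> N \<le> n \<Longrightarrow>
        norm (R (e (\<phi> m)) - R (e (\<phi> n))) < L"
      using CauchyD[OF LIMSEQ_imp_Cauchy[OF \<phi>(2)] Lp] by metis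
    define a b where "a = \<phi> N" and "b = \<phi> (Suc N)"
    have ab: "a < b" using \<phi>(1) by (simp add: a_def b_def strict_mono_less)
    have "cinner (l a *\<^sub>R e a) (- (l b *\<^sub>R e b)) = 0"
      using orthonormalD[OF orthonormal, of a b] ab by (simp add: cinner_simps)
    hence "(norm (l a *\<^sub>R e a - l b *\<^sub>R e b))\<^sup>2 = (l a)\<^sup>2 + (l b)\<^sup>2"
      using norm_add_orthogonal by (fastforce simp: e1 l0)
    hence "L\<^sup>2 \<le> (norm (l a *\<^sub>R e a - l b *\<^sub>R e b))\<^sup>2"
      using power_mono[OF L(2)[of a], of 2] Lp by (simp add: add_increasing2)
    hence "L \<le> norm (l a *\<^sub>R e a - l b *\<^sub>R e b)" by (rule power2_le_imp_le) simp
    thus False using N[of N "Suc N"] by (simp add: e3 a_def b_def)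
  qed
  thus thesis using that[OF orthonormal dec _ l0 e3] L(1) e4 by blast
qed

text \<open>Plays the role of completeness of the eigenvectors up to the kernel: the form at a
  vector orthogonal to all of them is at most every \<open>l n\<close> times its squared norm, hence
  0.\<close>

lemma pos_op_eq_0_on_orthogonal:
  assumes "pos_op R" "l \<longlonglongrightarrow> 0"
    and "\<And>n::nat. inner (R x) x \<le> l n * (norm x)\<^sup>2"
  shows "R x = 0"
proof -
  have "(\<lambda>n. l n * (norm x)\<^sup>2) \<longlonglongrightarrow> 0"
    using assms(2) by (rule tendsto_mult_left_zero)
  hence "inner (R x) x \<le> 0"
    by (rule LIMSEQ_le_const) (use assms(3) in blast)
  hence "inner (R x) x = 0" using pos_opD(4)[OF assms(1), of x] by linarith
  hence "(norm (R x))\<^sup>2 \<le> 0"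
    using norm_positive_form[OF pos_opD(3)[OF assms(1)] pos_opD(4)[OF assms(1)], of x] by simp
  thus ?thesis by simp
qed

text \<open>At a first disagreement the larger value \<open>s n\<close> occurs in \<open>s'\<close>
  only at indices below \<open>n\<close>, where the sequences agree, whereas \<open>s\<close> takes
  it at \<open>n\<close> too. The counts are finite since \<open>s n > 0\<close> and
  \<open>s\<close> tends to 0, so they differ.\<close>

lemma decseq_counts_unique_aux:
  fixes s s' :: "nat \<Rightarrow> real"
  assumes "decseq s" "s \<longlonglongrightarrow> 0" "decseq s'" "s' \<longlonglongrightarrow> 0"
    and card: "\<And>l. l > 0 \<Longrightarrow> card {n. s n = l} = card {n. s' n = l}"
    and eq: "\<And>m. m < n \<Longrightarrow> s m = s' m" and less: "s' n < s n"
  shows False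
proof -
  have "0 \<le> s' n" using decseq_ge[OF assms(3,4)] .
  hence l: "s n > 0" using less by simp
  have "\<forall>\<^sub>F m in sequentially. s m < s n" using order_tendstoD(2)[OF assms(2) l] .
  then obtain N where N: "\<And>m. N \<le> m \<Longrightarrow> s m < s n" by (auto simp: eventually_sequentially)
  have "{m. s m = s n} \<subseteq> {..<N}" using N
    by (metis (mono_tags) lessThan_iff less_irrefl mem_Collect_eq not_le subsetI)
  hence fin: "finite {m. s m = s n}" by (rule finite_subset) simp
  have "s' m = s n \<Longrightarrow> m < n" for m
    using decseqD[OF assms(3), of n m] less by (metis linorder_not_le)
  hence "{m. s' m = s n} \<subset> {m. s m = s n}" using eq less by fastforce
  hence "card {m. s' m = s n} < card {m. s m = s n}" using fin by (rule psubset_card_mono[rotated])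
  thus False using card[OF l] by simp
qed

lemma decseq_counts_unique:
  fixes s s' :: "nat \<Rightarrow> real"
  assumes "decseq s" "s \<longlonglongrightarrow> 0" "decseq s'" "s' \<longlonglongrightarrow> 0"
    and card: "\<And>l. l > 0 \<Longrightarrow> card {n. s n = l} = card {n. s' n = l}"
  shows "s = s'"
proof
  fix n show "s n = s' n"
  proof (induction n rule: less_induct)
    case (less n)
    show ?case
      using decseq_counts_unique_aux[OF assms(1-4) card, of n] less
        decseq_counts_unique_aux[OF assms(3,4,1,2) card[symmetric], of n]
      by (metis linorder_neq_iff)
  qed
qed

text \<open>For \<open>l > 0\<close> the eigenspace of \<open>op_abs K\<close> is the span of the
  \<open>e n\<close> with \<open>s n = l\<close>, so multiplicities can be counted in the sequence
  \<open>s\<close>; the counts determine a null decreasing sequence.\<close>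

theorem sing_vals_eqI:
  fixes K :: "'h::complex_hilbert \<Rightarrow>\<^sub>L 'h"
  assumes K: "K \<in> bounded_ops" and e: "orthonormal e (UNIV :: nat set)" and s: "decseq s" "s \<longlonglongrightarrow> 0"
    and eig: "\<And>n. (adj K o\<^sub>L K) (e n) = (s n)\<^sup>2 *\<^sub>R e n"
    and zero: "\<And>x. (\<And>n. cinner x (e n) = 0) \<Longrightarrow> K x = 0"
  shows "sing_vals K = s"
proof -
  define S where "S = op_abs K"
  have S: "pos_op S" unfolding S_def by (rule pos_op_op_abs[OF K])
  have s0: "0 \<le> s n" for n using decseq_ge[OF s] .
  have Se: "S (e n) = s n *\<^sub>R e n" for n
    using op_fun_eigenvector[OF pos_op_adj_comp[OF K] _ eig, of sqrt n] s0[of n]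
    by (simp add: S_def op_abs_def continuous_on_real_sqrt)
  have cards: "card {n. s n = l} = complex_vector.dim {x. S x = l *\<^sub>R x}"
    if l: "l > 0" for l
  proof -
    define J where "J = {n. s n = l}"
    have "\<forall>\<^sub>F m in sequentially. s m < l" using order_tendstoD(2)[OF s(2) l] .
    then obtain N where N: "\<And>m. N \<le> m \<Longrightarrow> s m < l" by (auto simp: eventually_sequentially)
    have "J \<subseteq> {..<N}" unfolding J_def using N
      by (metis (mono_tags) lessThan_iff less_irrefl mem_Collect_eq not_le subsetI)
    hence fin: "finite J" by (rule finite_subset) simp
    have onJ: "orthonormal e J" using e by (rule orthonormal_subset) simp
    have "{x. S x = l *\<^sub>R x} = complex_vector.span (e ` J)"
    proof (intro set_eqI iffI)
      fix x assume "x \<in> {x. S x = l *\<^sub>R x}"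
      hence x: "S x = l *\<^sub>R x" by simp
      have orth: "cinner x (e n) = 0" if "n \<notin> J" for n
      proof -
        have "of_real l * cinner x (e n) = of_real (s n) * cinner x (e n)"
          using pos_opD(2)[OF S, of x "e n"]
          by (simp add: x Se cinner_scaleR_left cinner_scaleR_right)
        thus ?thesis using that by (simp add: J_def)
      qed
      \<comment> \<open>The residual is orthogonal to every \<open>e n\<close>, so \<open>S\<close>
        annihilates it; it is also an eigenvector for \<open>l > 0\<close>, and therefore 0.\<close>
      define y where "y = x - proj e J x"
      have "cinner y (e n) = 0" for n
      proof (cases "n \<in> J")
        case True
        thus ?thesis by (simp add: y_def cinner_residual[OF fin onJ])
      next
        case False
        have "cinner (e n) (proj e J x) = 0"
          unfolding proj_def
          by (rule cinner_sum_orthogonal) (use False orthonormalD[OF e, of n] in auto)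
        hence "cinner (proj e J x) (e n) = 0" using cinner_commute[of "proj e J x" "e n"] by simp
        thus ?thesis using orth[OF False] by (simp add: y_def cinner_diff_left)
      qed
      hence "K y = 0" by (rule zero)
      hence "S y = 0" using norm_op_abs[OF K, of y] by (simp add: S_def)
      moreover have "S (proj e J x) = l *\<^sub>R proj e J x"
        unfolding proj_def
        by (simp add: blinfun.sum_right bounded_opsD[OF pos_opD(1)[OF S]] Se scaleR_sum_right
            J_def scaleC_scaleR_commute)
      hence "S y = l *\<^sub>R y"
        by (simp add: y_def blinfun.diff_right x scaleR_diff_right)
      ultimately have "y = 0" using l by simp
      thus "x \<in> complex_vector.span (e ` J)" using proj_in_span[of e J x] by (simp add: y_def)
    next
      fix x assume "x \<in> complex_vector.span (e ` J)"
      moreover have "complex_vector.subspace {x. S x = l *\<^sub>R x}"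
        by (simp add: complex_vector.subspace_def blinfun.bilinear_simps scaleR_add_right
            bounded_opsD[OF pos_opD(1)[OF S]] scaleC_scaleR_commute)
      moreover have "e ` J \<subseteq> {x. S x = l *\<^sub>R x}" by (auto simp: Se J_def)
      ultimately show "x \<in> {x. S x = l *\<^sub>R x}"
        using complex_vector.span_minimal by blast
    qed
    thus ?thesis
      using complex_vector.dim_span_eq_card_independent[OF orthonormal_independent[OF fin onJ]]
        card_image[OF orthonormal_inj[OF onJ]] by (simp add: J_def)
  qed
  show ?thesis
    unfolding sing_vals_def S_def[symmetric]
  proof (rule the_equality)
    show "decseq s \<and> s \<longlonglongrightarrow> 0 \<and>
      (\<forall>l>0. card {n. s n = l} = complex_vector.dim {x. S x = l *\<^sub>R x})"
      using s cards by blast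
    fix t assume "decseq t \<and> t \<longlonglongrightarrow> 0 \<and>
      (\<forall>l>0. card {n. t n = l} = complex_vector.dim {x. S x = l *\<^sub>R x})"
    thus "t = s" using cards s by (intro decseq_counts_unique) auto
  qed
qed

lemma inner_adj_comp:
  "K \<in> bounded_ops \<Longrightarrow> inner ((adj K o\<^sub>L K) x) x = (norm (K x))\<^sup>2"
  by (simp add: Re_cinner[symmetric] cinner_adj_left cinner_self del: of_real_power)

text \<open>The \<open>e n\<close> are eigenvectors of \<open>adj K o\<^sub>L K\<close>, that is
  right singular vectors of \<open>K\<close>. The last conclusion is the upper half of the min-max
  characterization, as needed for Weyl's inequality.\<close>

theorem sing_vals_compact:
  fixes K :: "'h::complex_hilbert \<Rightarrow>\<^sub>L 'h"
  assumes K: "K \<in> bounded_ops" "compact_op K" and inf: "infinite_dim TYPE('h)"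
  obtains e :: "nat \<Rightarrow> 'h" where "orthonormal e UNIV" "decseq (sing_vals K)" "sing_vals K \<longlonglongrightarrow> 0"
    "\<And>n. 0 \<le> sing_vals K n" "\<And>n. norm (K (e n)) = sing_vals K n"
    "\<forall>n x. (\<forall>i<n. cinner x (e i) = 0) \<longrightarrow> norm (K x) \<le> sing_vals K n * norm x"
proof -
  define R where "R = adj K o\<^sub>L K"
  have R: "pos_op R" "compact_op R"
    unfolding R_def using K by (auto intro: pos_op_adj_comp compact_op_comp_left)
  obtain e :: "nat \<Rightarrow> 'h" and l where e: "orthonormal e UNIV" "decseq l" "l \<longlonglongrightarrow> 0"
    "\<And>n. 0 \<le> l n" "\<And>n. R (e n) = l n *\<^sub>R e n"
    "\<And>n x. (\<And>i. i < n \<Longrightarrow> cinner x (e i) = 0) \<Longrightarrow> inner (R x) x \<le> l n * (norm x)\<^sup>2"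
    using compact_pos_op_spectral[OF R inf] by metis
  define s where "s n = sqrt (l n)" for n
  have s: "decseq s" "s \<longlonglongrightarrow> 0" "\<And>n. 0 \<le> s n" "\<And>n. (s n)\<^sup>2 = l n"
    using e(2,4) tendsto_real_sqrt[OF e(3)] by (auto simp: s_def[abs_def] decseq_def)
  have nK: "norm (K x) \<le> s n * norm x" if "\<And>i. i < n \<Longrightarrow> cinner x (e i) = 0" for n x
  proof (rule power2_le_imp_le)
    show "(norm (K x))\<^sup>2 \<le> (s n * norm x)\<^sup>2"
      using e(6)[OF that] inner_adj_comp[OF K(1), of x] by (simp add: R_def power_mult_distrib s(4))
  qed (simp add: s(3))
  have "sing_vals K = s"
  proof (rule sing_vals_eqI[OF K(1) e(1) s(1,2)])
    show "(adj K o\<^sub>L K) (e n) = (s n)\<^sup>2 *\<^sub>R e n" for n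
      using e(5) by (simp add: R_def s(4))
    show "K x = 0" if "\<And>n. cinner x (e n) = 0" for x
    proof -
      have "R x = 0"
        by (rule pos_op_eq_0_on_orthogonal[OF R(1) e(3) e(6)]) (rule that)
      thus ?thesis using inner_adj_comp[OF K(1), of x] by (simp add: R_def)
    qed
  qed
  moreover have "norm (K (e n)) = s n" for n
  proof -
    have "(norm (K (e n)))\<^sup>2 = (s n)\<^sup>2"
      using inner_adj_comp[OF K(1), of "e n", folded R_def] orthonormal_norm[OF e(1), of n]
      by (simp add: e(5) s(4) flip: power2_norm_eq_inner)
    thus ?thesis using s(3) by (simp only: power2_eq_iff_nonneg norm_ge_zero)
  qed
  ultimately show thesis using that[OF e(1)] s(1-3) nK by simp
qed

lemma adj_pos_op: "pos_op T \<Longrightarrow> adj T = T"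
  by (rule bounded_ops_cinner_eqI) (simp add: pos_opD(2) cinner_adj_left pos_opD(1))

text \<open>The same eigenvectors serve \<open>T\<close> and all its positive powers, so the
  singular values of a power are powers of singular values. The exponent \<open>1 / p\<close> will
  give those of the root in the norm inequality.\<close>

theorem sing_vals_pos_op:
  fixes T :: "'h::complex_hilbert \<Rightarrow>\<^sub>L 'h"
  assumes T: "pos_op T" "compact_op T" and inf: "infinite_dim TYPE('h)"
  obtains e :: "nat \<Rightarrow> 'h" where "orthonormal e UNIV" "decseq (sing_vals T)" "sing_vals T \<longlonglongrightarrow> 0"
    "\<And>n. 0 \<le> sing_vals T n" "\<And>n. T (e n) = sing_vals T n *\<^sub>R e n"
    "\<forall>n x. (\<forall>i<n. cinner x (e i) = 0) \<longrightarrow> inner (T x) x \<le> sing_vals T n * (norm x)\<^sup>2"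
    "\<forall>r>0. sing_vals (op_powr T r) = (\<lambda>n. sing_vals T n powr r)"
proof -
  obtain e :: "nat \<Rightarrow> 'h" and l where e: "orthonormal e UNIV" "decseq l" "l \<longlonglongrightarrow> 0"
    "\<And>n. 0 \<le> l n" "\<And>n. T (e n) = l n *\<^sub>R e n"
    "\<And>n x. (\<And>i. i < n \<Longrightarrow> cinner x (e i) = 0) \<Longrightarrow> inner (T x) x \<le> l n * (norm x)\<^sup>2"
    using compact_pos_op_spectral[OF T inf] by metis
  have zero: "T x = 0" if "\<And>n. cinner x (e n) = 0" for x
    by (rule pos_op_eq_0_on_orthogonal[OF T(1) e(3) e(6)]) (rule that)
  have "sing_vals T = l"
    by (rule sing_vals_eqI[OF pos_opD(1)[OF T(1)] e(1-3) _ zero])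
      (simp_all add: adj_pos_op[OF T(1)] e(5) blinfun.scaleR_right power2_eq_square)
  moreover have "sing_vals (op_powr T r) = (\<lambda>n. l n powr r)" if r: "r > 0" for r
  proof -
    have eig: "op_powr T r x = (m powr r) *\<^sub>R x" if "T x = m *\<^sub>R x" for x m
      unfolding op_powr_def
      using op_fun_eigenvector[OF T(1) continuous_on_powr_nonneg[OF r] that] .
    show ?thesis
    proof (rule sing_vals_eqI[OF pos_opD(1)[OF pos_op_op_powr[OF T(1) r]] e(1)])
      show "decseq (\<lambda>n. l n powr r)"
        using e(2,4) r by (auto simp: decseq_def intro!: powr_mono2)
      show "(\<lambda>n. l n powr r) \<longlonglongrightarrow> 0"
        using tendsto_powr2[OF e(3) tendsto_const, of r] e(4) r by simp
      show "(adj (op_powr T r) o\<^sub>L op_powr T r) (e n) = (l n powr r)\<^sup>2 *\<^sub>R e n" for n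
        by (simp add: adj_pos_op[OF pos_op_op_powr[OF T(1) r]]
          eig[OF e(5)] blinfun.scaleR_right power2_eq_square)
      show "op_powr T r x = 0" if "\<And>n. cinner x (e n) = 0" for x
        using eig[of x 0] zero[OF that] by simp
    qed
  qed
  ultimately show thesis using that[OF e(1)] e(2-6) by simp
qed

text \<open>
  Weyl's inequality: intersect the span of the first \<open>r + i + 1\<close> eigenvectors of \<open>T\<close> with the kernel
  of \<open>F\<close> and the complement of the first \<open>i\<close> singular vectors of \<open>T - F\<close>.
\<close>

theorem sing_vals_finite_rank_perturbation:
  fixes T F :: "'h::complex_hilbert \<Rightarrow>\<^sub>L 'h"
  assumes T: "pos_op T" "compact_op T" and F: "F \<in> bounded_ops" "compact_op F" "finite_rank F"
    and inf: "infinite_dim TYPE('h)"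
  shows "\<exists>r. \<forall>i. sing_vals T (r + i) \<le> sing_vals (T - F) i"
proof -
  obtain S where S: "finite S" "range (blinfun_apply F) \<subseteq> complex_vector.span S"
    using F(3) unfolding finite_rank_def by blast
  \<comment> \<open>If \<open>x\<close> is orthogonal to \<open>D\<close>, then \<open>F x\<close>
    is orthogonal to \<open>S\<close> and lies in its span, so it vanishes. Thus
    \<open>card D\<close> conditions force \<open>x\<close> into the kernel of \<open>F\<close>, and
    \<open>card D\<close> is the shift \<open>r\<close>.\<close>
  define D where "D = blinfun_apply (adj F) ` S"
  have D: "finite D" using S by (simp add: D_def)
  have FD: "F x = 0" if "\<And>d. d \<in> D \<Longrightarrow> cinner x d = 0" for x
  proof -
    have "cinner (F x) s = 0" if "s \<in> S" for s
      using \<open>\<And>d. d \<in> D \<Longrightarrow> cinner x d = 0\<close> that by (simp add: D_def cinner_adj_right[OF F(1)])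
    moreover have "F x \<in> complex_vector.span S" using S(2) by auto
    ultimately have "cinner (F x) (F x) = 0"
      by (rule span_orthogonal[rotated])
    thus ?thesis by (simp add: cinner_self)
  qed
  define K where "K = T - F"
  have K: "K \<in> bounded_ops" "compact_op K"
    unfolding K_def using T F by (auto intro: bounded_ops_diff compact_op_diff pos_opD)
  obtain e :: "nat \<Rightarrow> 'h" where e: "orthonormal e UNIV" "decseq (sing_vals T)"
      "\<And>n. T (e n) = sing_vals T n *\<^sub>R e n"
    by (rule sing_vals_pos_op[OF T inf], rule that)
  obtain g :: "nat \<Rightarrow> 'h" where
    g: "\<forall>n x. (\<forall>i<n. cinner x (g i) = 0) \<longrightarrow> norm (K x) \<le> sing_vals K n * norm x"
    by (rule sing_vals_compact[OF K inf], rule that)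
  have "sing_vals T (card D + i) \<le> sing_vals K i" for i
  proof -
    define m where "m = card D + i"
    define C where "C = D \<union> g ` {..<i}"
    have "card C \<le> card D + card (g ` {..<i})" unfolding C_def by (rule card_Un_le)
    also have "\<dots> \<le> m" using card_image_le[of "{..<i}" g] by (simp add: m_def)
    finally have C: "finite C" "card C \<le> m" using D by (auto simp: C_def)
    have em: "orthonormal e {..m}" using e(1) by (rule orthonormal_subset) simp
    obtain x where x: "x \<in> complex_vector.span (e ` {..m})" "norm x = 1"
      "\<And>c. c \<in> C \<Longrightarrow> cinner x c = 0"
      using exists_orthogonal_in_span[OF em C] by blast
    define a where "a k = cinner x (e k)" for k
    have xa: "x = (\<Sum>k\<le>m. a k *\<^sub>C e k)"
      using proj_span_eq[OF _ em x(1)] by (simp add: proj_def a_def)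
    have Tx: "T x = (\<Sum>k\<le>m. (of_real (sing_vals T k) * a k) *\<^sub>C e k)"
      by (subst xa) (simp add: blinfun.sum_right bounded_opsD[OF pos_opD(1)[OF T(1)]] e(3)
          scaleC_of_real[symmetric] scaleC_scaleC mult.commute)
    have n1: "(\<Sum>k\<le>m. (cmod (a k))\<^sup>2) = 1"
      using norm_proj[OF _ em, of x] proj_span_eq[OF _ em x(1)] x(2) by (simp add: a_def)
    have s0: "0 \<le> sing_vals T k" for k
      by (rule sing_vals_pos_op[OF T inf])
    have "(sing_vals T m)\<^sup>2 = (\<Sum>k\<le>m. (sing_vals T m)\<^sup>2 * (cmod (a k))\<^sup>2)"
      by (simp add: n1 flip: sum_distrib_left)
    also have "\<dots> \<le> (\<Sum>k\<le>m. (sing_vals T k)\<^sup>2 * (cmod (a k))\<^sup>2)"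
      using e(2) s0 by (intro sum_mono mult_right_mono power_mono) (auto simp: decseq_def)
    also have "\<dots> = (norm (T x))\<^sup>2"
      unfolding Tx norm_sum_orthonormal[OF finite_atMost em]
      by (simp add: norm_mult power_mult_distrib)
    finally have "sing_vals T m \<le> norm (T x)" by (rule power2_le_imp_le) simp
    also have "T x = K x"
      using FD[of x] x(3) by (simp add: K_def blinfun.diff_left C_def)
    also have "norm \<dots> \<le> sing_vals K i * norm x"
      using x(3) g by (simp add: C_def)
    finally show ?thesis by (simp add: m_def x(2))
  qed
  thus ?thesis unfolding K_def by blast
qed

text \<open>The case \<open>r = 0\<close> is the maximum principle; general \<open>r\<close> treats
  the compression of \<open>T\<close> to the complement of the first \<open>r\<close> eigenvectors.
  Each form is \<open>l m\<close> times a squared norm plus excesses \<open>l k - l m\<close>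
  weighted by squared coefficients along \<open>e k\<close>, and by Bessel's inequality the weights
  at each \<open>k\<close> sum to at most 1 over \<open>i\<close>.\<close>

theorem Ky_Fan:
  fixes T :: "'h::complex_hilbert \<Rightarrow>\<^sub>L 'h"
  assumes T: "pos_op T" and e: "orthonormal e UNIV" "\<And>k. T (e k) = l k *\<^sub>R e k"
    and l: "decseq l"
    and le: "\<And>n x. (\<And>i. i < n \<Longrightarrow> cinner x (e i) = 0) \<Longrightarrow> inner (T x) x \<le> l n * (norm x)\<^sup>2"
    and f: "orthonormal f {..<n}"
  shows "(\<Sum>i<n. inner (T (f i - proj e {..<r} (f i))) (f i - proj e {..<r} (f i)))
    \<le> (\<Sum>i<n. l (r + i))"
proof -
  define m where "m = r + n"
  define N where "N = {r..<m}"
  have em: "orthonormal e {..<m}" and eN: "orthonormal e N" using e(1)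
    by (auto intro: orthonormal_subset)
  have fN: "finite N" by (simp add: N_def)
  have one: "inner (T (x - proj e {..<r} x)) (x - proj e {..<r} x)
      \<le> l m * (norm x)\<^sup>2 + (\<Sum>k\<in>N. (l k - l m) * (cmod (cinner x (e k)))\<^sup>2)" for x
  proof -
    define z w where "z = x - proj e {..<m} x" and "w = proj e N x"
    have split: "proj e {..<m} x = proj e {..<r} x + w"
      unfolding proj_def w_def N_def lessThan_atLeast0
      by (rule sum.atLeastLessThan_concat[symmetric]) (simp_all add: m_def)
    hence xz: "x - proj e {..<r} x = z + w" by (simp add: z_def)
    have ze: "cinner z (e i) = 0" if "i < m" for i
      unfolding z_def using cinner_residual[OF _ em] that by simp
    have Tw: "T w = (\<Sum>k\<in>N. (of_real (l k) * cinner x (e k)) *\<^sub>C e k)"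
      by (simp add: w_def proj_def blinfun.sum_right bounded_opsD[OF pos_opD(1)[OF T]] e(2)
          scaleC_of_real[symmetric] scaleC_scaleC mult.commute)
    have "cinner z (T w) = 0"
      unfolding Tw by (rule cinner_sum_orthogonal) (simp add: ze N_def)
    hence zTw: "inner z (T w) = 0" by (simp flip: Re_cinner)
    have wTw: "inner (T w) w = (\<Sum>k\<in>N. l k * (cmod (cinner x (e k)))\<^sup>2)"
    proof -
      have "cinner (T w) w = (\<Sum>k\<in>N. cnj (cinner x (e k)) * cinner (T w) (e k))"
        unfolding w_def proj_def by (subst cinner_sum_right) (simp add: cinner_scaleC_right)
      also have "\<dots> = (\<Sum>k\<in>N. of_real (l k) * (cinner x (e k) * cnj (cinner x (e k))))"
        unfolding Tw by (rule sum.cong) (simp_all add: orthonormal_sum_cinner[OF fN eN])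
      also have "\<dots> = of_real (\<Sum>k\<in>N. l k * (cmod (cinner x (e k)))\<^sup>2)"
        by (simp only: of_real_sum of_real_mult complex_norm_square)
      finally show ?thesis by (simp only: Re_cinner[symmetric] Re_complex_of_real)
    qed
    have nx: "(norm z)\<^sup>2 + (\<Sum>k\<in>N. (cmod (cinner x (e k)))\<^sup>2) \<le> (norm x)\<^sup>2"
    proof -
      have "(\<Sum>k\<in>N. (cmod (cinner x (e k)))\<^sup>2) \<le> (\<Sum>k<m. (cmod (cinner x (e k)))\<^sup>2)"
        by (rule sum_mono2) (auto simp: N_def)
      thus ?thesis using norm_residual[OF _ em, of x] norm_proj[OF _ em, of x] by (simp add: z_def)
    qed
    have lm: "0 \<le> l m"
      using pos_opD(4)[OF T, of "e m"] orthonormal_norm[OF e(1), of m]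
      by (simp add: e(2) flip: power2_norm_eq_inner)
    have "inner (T (z + w)) (z + w)
        = inner (T z) z + inner (T w) w"
      using zTw pos_opD(3)[OF T, of z w]
      by (simp add: blinfun.add_right inner_add_left inner_add_right inner_commute)
    also have "inner (T z) z \<le> l m * (norm z)\<^sup>2" by (rule le) (rule ze)
    also have "\<dots> \<le> l m * ((norm x)\<^sup>2 - (\<Sum>k\<in>N. (cmod (cinner x (e k)))\<^sup>2))"
      using nx lm by (intro mult_left_mono) auto
    finally show ?thesis
      unfolding xz wTw
      by (simp add: left_diff_distrib right_diff_distrib sum_subtractf sum_distrib_left)
  qed
  have "(\<Sum>i<n. inner (T (f i - proj e {..<r} (f i))) (f i - proj e {..<r} (f i)))
    \<le> (\<Sum>i<n. l m + (\<Sum>k\<in>N. (l k - l m) * (cmod (cinner (f i) (e k)))\<^sup>2))"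
  proof (rule sum_mono)
    fix i assume "i \<in> {..<n}"
    thus "inner (T (f i - proj e {..<r} (f i))) (f i - proj e {..<r} (f i))
      \<le> l m + (\<Sum>k\<in>N. (l k - l m) * (cmod (cinner (f i) (e k)))\<^sup>2)"
      using one[of "f i"] orthonormal_norm[OF f, of i] by simp
  qed
  also have "\<dots> = n * l m + (\<Sum>k\<in>N. (l k - l m) * (\<Sum>i<n. (cmod (cinner (f i) (e k)))\<^sup>2))"
    unfolding sum.distrib by (subst sum.swap) (simp add: sum_distrib_left)
  also have "\<dots> \<le> n * l m + (\<Sum>k\<in>N. (l k - l m) * 1)"
  proof (intro add_left_mono sum_mono mult_left_mono)
    fix k assume k: "k \<in> N"
    show "(\<Sum>i<n. (cmod (cinner (f i) (e k)))\<^sup>2) \<le> 1"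
      using Bessel'[OF _ f, of "e k"] orthonormal_norm[OF e(1), of k] by simp
    show "0 \<le> l k - l m" using k decseqD[OF l, of k m] by (simp add: N_def)
  qed
  \<comment> \<open>\<open>N\<close> has exactly \<open>n\<close> elements, so the baseline
    \<open>n * l m\<close> cancels against the subtracted terms.\<close>
  also have "\<dots> = (\<Sum>k\<in>N. l k)" by (simp add: sum_subtractf N_def m_def)
  also have "\<dots> = (\<Sum>i<n. l (r + i))"
    unfolding N_def m_def using sum.shift_bounds_nat_ivl[of l 0 r n]
    by (simp add: lessThan_atLeast0 add.commute)
  finally show ?thesis .
qed

section \<open>Symmetric norming functions\<close>

lemma
  assumes "sn_function \<Phi>"
  shows sn_nonneg: "fin_supp a \<Longrightarrow> 0 \<le> \<Phi> a"
    and sn_scale: "fin_supp a \<Longrightarrow> \<Phi> (\<lambda>n. c * a n) = cmod c * \<Phi> a"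
    and sn_add: "fin_supp a \<Longrightarrow> fin_supp b \<Longrightarrow> \<Phi> (\<lambda>n. a n + b n) \<le> \<Phi> a + \<Phi> b"
    and sn_unit: "\<Phi> (\<lambda>n. if n = 0 then 1 else 0) = 1"
    and sn_abs: "fin_supp a \<Longrightarrow> \<Phi> a = \<Phi> (\<lambda>n. of_real (cmod (a n)))"
    and sn_perm: "fin_supp a \<Longrightarrow> bij \<pi> \<Longrightarrow> \<Phi> (a \<circ> \<pi>) = \<Phi> a"
  using assms unfolding sn_function_def by blast+

lemma fin_supp_subset: "fin_supp a \<Longrightarrow> (\<And>n. a n = 0 \<Longrightarrow> b n = 0) \<Longrightarrow> fin_supp b"
  unfolding fin_supp_def by (erule rev_finite_subset) auto

lemma fin_supp_bounded: "(\<And>n. N \<le> n \<Longrightarrow> a n = 0) \<Longrightarrow> fin_supp a"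
  unfolding fin_supp_def by (rule finite_subset[of _ "{..<N}"]) (auto simp: not_less[symmetric])

lemma fin_supp_scale: "fin_supp a \<Longrightarrow> fin_supp (\<lambda>n. c * a n)"
  by (erule fin_supp_subset) simp

lemma fin_supp_perm: "fin_supp a \<Longrightarrow> bij \<pi> \<Longrightarrow> fin_supp (a \<circ> \<pi>)"
proof -
  assume a: "fin_supp a" and \<pi>: "bij \<pi>"
  have "{n. (a \<circ> \<pi>) n \<noteq> 0} = \<pi> -` {n. a n \<noteq> 0}" by auto
  thus ?thesis using finite_vimageI[OF _ bij_is_inj[OF \<pi>]] a unfolding fin_supp_def by metis
qed

text \<open>The vector \<open>b\<close> will be an image of \<open>a\<close> under a symmetry of
  \<Phi>: a change of sign when one entry is lowered, a transposition when mass is moved between two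
  entries.\<close>

lemma sn_convex:
  assumes sn: "sn_function \<Phi>" and a: "fin_supp a" and b: "fin_supp b" "\<Phi> b = \<Phi> a"
    and t: "0 \<le> t" "t \<le> 1"
    and c: "\<And>n. c n = of_real (1 - t) * a n + of_real t * b n"
  shows "\<Phi> c \<le> \<Phi> a"
proof -
  have "c = (\<lambda>n. of_real (1 - t) * a n + of_real t * b n)" using c by auto
  hence "\<Phi> c \<le> \<Phi> (\<lambda>n. of_real (1 - t) * a n) + \<Phi> (\<lambda>n. of_real t * b n)"
    using sn_add[OF sn fin_supp_scale[OF a] fin_supp_scale[OF b(1)]] by simp
  also have "\<dots> = cmod (of_real (1 - t)) * \<Phi> a + cmod (of_real t) * \<Phi> a"
    by (simp only: sn_scale[OF sn a] sn_scale[OF sn b(1)] b(2))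
  also have "\<dots> = \<Phi> a"
    using t by (simp only: norm_of_real) (simp add: algebra_simps)
  finally show ?thesis .
qed

definition phi :: "((nat \<Rightarrow> complex) \<Rightarrow> real) \<Rightarrow> (nat \<Rightarrow> real) \<Rightarrow> real" where
  "phi \<Phi> x = \<Phi> (\<lambda>k. complex_of_real (x k))"

definition rfin :: "(nat \<Rightarrow> real) \<Rightarrow> bool" where
  "rfin x \<longleftrightarrow> (\<exists>N. \<forall>n\<ge>N. x n = 0)"

lemma rfin_fin_supp: "rfin x \<Longrightarrow> fin_supp (\<lambda>k. complex_of_real (x k))"
  unfolding rfin_def by (metis fin_supp_bounded of_real_0)

lemma phi_nonneg: "sn_function \<Phi> \<Longrightarrow> rfin x \<Longrightarrow> 0 \<le> phi \<Phi> x"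
  unfolding phi_def by (intro sn_nonneg rfin_fin_supp)

lemma phi_scale: "sn_function \<Phi> \<Longrightarrow> rfin x \<Longrightarrow> 0 \<le> c \<Longrightarrow> phi \<Phi> (\<lambda>k. c * x k) = c * phi \<Phi> x"
  unfolding phi_def using sn_scale[OF _ rfin_fin_supp, of \<Phi> x "of_real c"] by simp

lemma phi_add:
  "sn_function \<Phi> \<Longrightarrow> rfin x \<Longrightarrow> rfin y \<Longrightarrow> phi \<Phi> (\<lambda>k. x k + y k) \<le> phi \<Phi> x + phi \<Phi> y"
  unfolding phi_def using sn_add[OF _ rfin_fin_supp rfin_fin_supp, of \<Phi> x y] by simp

text \<open>The lowered sequence is a convex combination of \<open>y\<close> and of \<open>y\<close>
  with its \<open>k\<close>-th sign flipped; the weight \<open>t\<close> solves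
  \<open>(1 - t) * y k - t * y k = c\<close>.\<close>

lemma phi_reduce_entry:
  assumes sn: "sn_function \<Phi>" and y: "rfin y" and c: "0 \<le> c" "c \<le> y k"
  shows "phi \<Phi> (y(k := c)) \<le> phi \<Phi> y"
proof (cases "y k = 0")
  case True
  hence "y(k := c) = y" using c by auto
  thus ?thesis by simp
next
  case False
  hence yk: "y k > 0" using c by simp
  define t where "t = (1 - c / y k) / 2"
  define a b where "a = (\<lambda>n. complex_of_real (y n))" and
    "b = (\<lambda>n. complex_of_real ((y(k := - y k)) n))"
  have a: "fin_supp a" unfolding a_def by (rule rfin_fin_supp[OF y])
  have b: "fin_supp b" by (rule fin_supp_subset[OF a]) (auto simp: a_def b_def)
  have "(\<lambda>n. of_real (cmod (b n))) = (\<lambda>n. complex_of_real (cmod (a n)))"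
    by (auto simp: a_def b_def)
  hence ba: "\<Phi> b = \<Phi> a" using sn_abs[OF sn a] sn_abs[OF sn b] by simp
  have t: "0 \<le> t" "t \<le> 1" using c yk by (simp_all add: t_def field_simps)
  have tk: "(1 - t) * y k - t * y k = c" using yk by (simp add: t_def field_simps)
  have "\<Phi> (\<lambda>n. complex_of_real ((y(k := c)) n)) \<le> \<Phi> a"
  proof (rule sn_convex[OF sn a b ba t])
    fix n
    show "complex_of_real ((y(k := c)) n) = of_real (1 - t) * a n + of_real t * b n"
      unfolding a_def b_def of_real_mult[symmetric] of_real_add[symmetric] of_real_eq_iff
      using tk by (auto simp: algebra_simps)
  qed
  thus ?thesis by (simp add: phi_def a_def)
qed

lemma phi_mono:
  assumes sn: "sn_function \<Phi>" and y: "rfin y" and xy: "\<And>k. 0 \<le> x k" "\<And>k. x k \<le> y k"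
  shows "phi \<Phi> x \<le> phi \<Phi> y"
proof -
  obtain N where N: "\<And>n. N \<le> n \<Longrightarrow> y n = 0" using y unfolding rfin_def by blast
  have x0: "x n = 0" if "N \<le> n" for n
    using N[OF that] xy(1)[of n] xy(2)[of n] by simp
  have "phi \<Phi> (\<lambda>k. if k < m then x k else y k) \<le> phi \<Phi> y" for m
  proof (induction m)
    case (Suc m)
    define z where "z = (\<lambda>k. if k < m then x k else y k)"
    have "rfin z" unfolding rfin_def z_def using N x0 by (intro exI[of _ N]) auto
    hence "phi \<Phi> (z(m := x m)) \<le> phi \<Phi> z" using xy
      by (intro phi_reduce_entry[OF sn]) (auto simp: z_def)
    moreover have "z(m := x m) = (\<lambda>k. if k < Suc m then x k else y k)" by (auto simp: z_def)
    ultimately show ?case using Suc by (simp add: z_def)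
  qed simp
  moreover have "x = (\<lambda>k. if k < N then x k else y k)"
    using N x0 by auto
  ultimately show ?thesis by metis
qed

text \<open>
  Hardy--Littlewood--Polya: as long as some \<open>x k > y k\<close>, moving mass \<open>\<delta>\<close> from an earlier
  index \<open>j\<close> with \<open>y j > x j\<close> to \<open>k\<close> replaces \<open>y\<close> by a convex combination of \<open>y\<close> and a transposed
  \<open>y\<close>, keeps the partial sums above those of \<open>x\<close>, and makes one more entry agree with \<open>x\<close>.
\<close>

theorem phi_weak_majorization:
  assumes sn: "sn_function \<Phi>" and x: "rfin x" "\<And>k. 0 \<le> x k" "decseq x"
    and y: "rfin y" "\<And>k. 0 \<le> y k"
    and sums: "\<And>m. (\<Sum>i<m. x i) \<le> (\<Sum>i<m. y i)"
  shows "phi \<Phi> x \<le> phi \<Phi> y"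
  using y sums
proof (induction "card {i. x i \<noteq> y i}" arbitrary: y rule: less_induct)
  case less
  note y = less.prems(1,2) and sums = less.prems(3)
  show ?case
  proof (cases "\<forall>k. x k \<le> y k")
    case True
    thus ?thesis by (intro phi_mono[OF sn y(1) x(2)]) blast
  next
    case False
    define k where "k = (LEAST k. y k < x k)"
    have k: "y k < x k" unfolding k_def using False by (auto intro: LeastI_ex simp: not_le)
    have before: "x i \<le> y i" if "i < k" for i
      using not_less_Least[of i "\<lambda>k. y k < x k"] that by (simp add: k_def not_less)
    have "\<exists>j<k. x j < y j"
    proof (rule ccontr)
      assume "\<not> ?thesis"
      hence "y i \<le> x i" if "i < k" for i using that by (meson not_less)
      hence "(\<Sum>i<k. y i) \<le> (\<Sum>i<k. x i)" by (intro sum_mono) simp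
      thus False using sums[of "Suc k"] k by simp
    qed
    then obtain j where j: "j < k" "x j < y j" by blast
    define \<delta> where "\<delta> = min (y j - x j) (x k - y k)"
    have \<delta>: "0 < \<delta>" "\<delta> \<le> y j - x j" "\<delta> \<le> x k - y k" using j k by (auto simp: \<delta>_def)
    have xjk: "x k \<le> x j" using x(3) j(1) by (simp add: decseq_def)
    define z where "z i = y i - (if i = j then \<delta> else 0) + (if i = k then \<delta> else 0)" for i
    have z_sum: "(\<Sum>i<m. z i) = (\<Sum>i<m. y i) - (if j < m then \<delta> else 0) + (if k < m then \<delta> else 0)"
      for m
      unfolding z_def by (simp add: sum.distrib sum_subtractf)
    have "phi \<Phi> x \<le> phi \<Phi> z"
    proof (rule less.hyps)
      obtain N M where NM: "\<And>n. N \<le> n \<Longrightarrow> y n = 0" "\<And>n. M \<le> n \<Longrightarrow> x n = 0"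
        using x(1) y(1) unfolding rfin_def by metis
      have "z n = 0" if "max N (Suc k) \<le> n" for n
        using NM that j(1) by (simp add: z_def)
      thus "rfin z" unfolding rfin_def by blast
      show "0 \<le> z i" for i
        using y(2)[of i] \<delta> x(2)[of j] by (auto simp: z_def)
      have "{i. x i \<noteq> y i} \<subseteq> {..<max N M}" using NM by (auto simp: not_le[symmetric])
      hence "finite {i. x i \<noteq> y i}" by (rule finite_subset) simp
      moreover have "{i. x i \<noteq> z i} \<subset> {i. x i \<noteq> y i}"
      proof
        show "{i. x i \<noteq> z i} \<subseteq> {i. x i \<noteq> y i}"
          using j k by (auto simp: z_def)
        have "z j = x j \<or> z k = x k" using j(1) by (auto simp: z_def \<delta>_def min_def)
        moreover have "j \<in> {i. x i \<noteq> y i}" "k \<in> {i. x i \<noteq> y i}" using j k by auto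
        ultimately show "{i. x i \<noteq> z i} \<noteq> {i. x i \<noteq> y i}"
          by (metis (mono_tags, lifting) mem_Collect_eq)
      qed
      ultimately show "card {i. x i \<noteq> z i} < card {i. x i \<noteq> y i}" by (rule psubset_card_mono)
      show "(\<Sum>i<m. x i) \<le> (\<Sum>i<m. z i)" for m
      \<comment> \<open>Only these partial sums lose \<delta>. Below \<open>k\<close> every entry of
        \<open>y\<close> dominates that of \<open>x\<close>, so they have slack at least
        \<open>y j - x j\<close>, hence at least \<delta>.\<close>
      proof (cases "j < m \<and> m \<le> k")
        case True
        have "y j - x j \<le> (\<Sum>i<m. y i - x i)"
          using True before by (intro member_le_sum) auto
        thus ?thesis using True \<delta>(2) by (simp add: z_sum sum_subtractf)
      next
        case False
        thus ?thesis using sums[of m] j(1) by (auto simp: z_sum)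
      qed
    qed
    also have "phi \<Phi> z \<le> phi \<Phi> y"
    proof -
      define t where "t = \<delta> / (y j - y k)"
      \<comment> \<open>Here the monotonicity of \<open>x\<close> enters: \<open>y k < x k\<close>,
        \<open>x k\<close> \<le> \<open>x j\<close> and \<open>x j\<close> \<le>
        \<open>y j - \<delta>\<close>. It puts the weight \<open>t\<close> into the unit
        interval.\<close>
      have d: "0 < y j - y k" "\<delta> \<le> y j - y k" using \<delta> xjk k by linarith+
      have t: "0 \<le> t" "t \<le> 1" using d \<delta>(1) by (simp_all add: t_def)
      have td: "t * y j = t * y k + \<delta>" using d by (simp add: t_def field_simps)
      define a where "a = (\<lambda>n. complex_of_real (y n))"
      have a: "fin_supp a" unfolding a_def by (rule rfin_fin_supp[OF y(1)])
      have bij: "bij (Transposition.transpose j k)" by simp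
      have "\<Phi> (\<lambda>n. complex_of_real (z n)) \<le> \<Phi> a"
      proof (rule sn_convex[OF sn a fin_supp_perm[OF a bij] sn_perm[OF sn a bij] t])
        fix n
        show "complex_of_real (z n) = of_real (1 - t) * a n
          + of_real t * (a \<circ> Transposition.transpose j k) n"
          unfolding a_def o_def of_real_mult[symmetric] of_real_add[symmetric] of_real_eq_iff
          using td j(1) by (auto simp: z_def Transposition.transpose_def algebra_simps)
      qed
      thus ?thesis by (simp add: phi_def a_def)
    qed
    finally show ?thesis .
  qed
qed

section \<open>Truncations and the extension to infinite sequences\<close>

definition trunc :: "nat \<Rightarrow> (nat \<Rightarrow> real) \<Rightarrow> nat \<Rightarrow> real" where
  "trunc n x k = (if k < n then x k else 0)"

lemma rfin_trunc [simp]: "rfin (trunc n x)"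
  unfolding rfin_def trunc_def by (intro exI[of _ n]) simp

lemma phi_trunc_mono:
  assumes "sn_function \<Phi>" "m \<le> n" "\<And>k. 0 \<le> x k"
  shows "phi \<Phi> (trunc m x) \<le> phi \<Phi> (trunc n x)"
  using assms by (intro phi_mono) (auto simp: trunc_def)

lemma phi_trunc_scale:
  assumes "sn_function \<Phi>" "0 \<le> c"
  shows "phi \<Phi> (trunc n (\<lambda>k. c * x k)) = c * phi \<Phi> (trunc n x)"
proof -
  have "trunc n (\<lambda>k. c * x k) = (\<lambda>k. c * trunc n x k)" by (auto simp: trunc_def)
  thus ?thesis using phi_scale[OF assms(1) rfin_trunc assms(2)] by simp
qed

lemma phi_trunc_le:
  assumes "sn_function \<Phi>" "\<And>k. 0 \<le> x k" "\<And>k. x k \<le> y k"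
  shows "phi \<Phi> (trunc n x) \<le> phi \<Phi> (trunc n y)"
  using assms by (intro phi_mono) (auto simp: trunc_def)

text \<open>Monotonicity turns the limit in \<open>ennreal\<close> into a supremum. It is a
  hypothesis on \<Psi> so that the result serves both \<Phi> and its
  \<open>p\<close>-modification.\<close>

lemma sn_ext_eq_SUP:
  assumes "incseq (\<lambda>n. phi \<Psi> (trunc n x))"
  shows "sn_ext \<Psi> (\<lambda>n. of_real (x n)) = (SUP n. ennreal (phi \<Psi> (trunc n x)))"
proof -
  have eq: "(\<lambda>k. if k < n then complex_of_real (x k) else 0) = (\<lambda>k. of_real (trunc n x k))" for n
    by (auto simp: trunc_def)
  have "incseq (\<lambda>n. ennreal (phi \<Psi> (trunc n x)))"
    using assms by (auto simp: incseq_def intro: ennreal_leI)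
  thus ?thesis unfolding sn_ext_def eq phi_def[symmetric] by (intro limI LIMSEQ_SUP)
qed

lemma phi_p_mod:
  assumes "0 < p" "\<And>k. 0 \<le> x k"
  shows "phi (p_mod \<Phi> p) (trunc n x) = phi \<Phi> (trunc n (\<lambda>k. x k powr p)) powr (1 / p)"
proof -
  have "(\<lambda>k. complex_of_real (cmod (complex_of_real (trunc n x k)) powr p))
    = (\<lambda>k. of_real (trunc n (\<lambda>k. x k powr p) k))"
    using assms by (auto simp: trunc_def)
  thus ?thesis by (simp add: phi_def p_mod_def)
qed

lemma incseq_phi: "sn_function \<Phi> \<Longrightarrow> (\<And>k. 0 \<le> x k) \<Longrightarrow> incseq (\<lambda>n. phi \<Phi> (trunc n x))"
  by (intro incseq_SucI phi_trunc_mono) auto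

lemma incseq_phi_p_mod:
  assumes "sn_function \<Phi>" "0 < p" "\<And>k. 0 \<le> x k"
  shows "incseq (\<lambda>n. phi (p_mod \<Phi> p) (trunc n x))"
  unfolding phi_p_mod[OF assms(2,3)] using assms
  by (intro incseq_SucI powr_mono2 phi_trunc_mono phi_nonneg) auto

lemma p_mod_sn_ext_le:
  assumes "sn_function \<Phi>" "0 < p" "\<And>k. 0 \<le> x k"
    and "\<And>n. phi \<Phi> (trunc n (\<lambda>k. x k powr p)) \<le> V"
  shows "sn_ext (p_mod \<Phi> p) (\<lambda>n. of_real (x n)) \<le> ennreal (V powr (1 / p))"
  unfolding sn_ext_eq_SUP[OF incseq_phi_p_mod[OF assms(1-3)]] phi_p_mod[OF assms(2,3)]
  using assms by (intro SUP_least ennreal_leI powr_mono2 phi_nonneg) auto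

lemma phi_le_sn_ext:
  assumes "sn_function \<Phi>" "\<And>k. 0 \<le> x k"
  shows "ennreal (phi \<Phi> (trunc n x)) \<le> sn_ext \<Phi> (\<lambda>n. of_real (x n))"
  unfolding sn_ext_eq_SUP[OF incseq_phi[OF assms]] by (rule SUP_upper) simp

lemma phi_le_of_sn_ext_less:
  assumes "sn_function \<Phi>" "\<And>k. 0 \<le> x k" "sn_ext \<Phi> (\<lambda>n. of_real (x n)) < ennreal V"
  shows "phi \<Phi> (trunc n x) < V"
proof -
  have "ennreal (phi \<Phi> (trunc n x)) < ennreal V"
    using phi_le_sn_ext[OF assms(1,2)] assms(3) by (rule le_less_trans)
  thus ?thesis using phi_nonneg[OF assms(1) rfin_trunc, of n x] by (simp add: ennreal_less_iff)
qed

text \<open>Test the hypothesis on right singular vectors of \<open>K\<close>, then apply weak majorization.\<close>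

theorem phi_sing_vals_le:
  fixes K :: "'h::complex_hilbert \<Rightarrow>\<^sub>L 'h"
  assumes sn: "sn_function \<Phi>" and p: "0 < p"
    and K: "K \<in> bounded_ops" "compact_op K" and inf: "infinite_dim TYPE('h)"
    and y: "\<And>k. 0 \<le> y k"
    and le: "\<And>n f. orthonormal f {..<n} \<Longrightarrow> (\<Sum>i<n. norm (K (f i)) powr p) \<le> (\<Sum>i<n. y i)"
  shows "phi \<Phi> (trunc n (\<lambda>k. sing_vals K k powr p)) \<le> phi \<Phi> (trunc n y)"
proof -
  obtain e :: "nat \<Rightarrow> 'h" where e: "orthonormal e UNIV" "decseq (sing_vals K)" "sing_vals K \<longlonglongrightarrow> 0"
    "\<And>n. 0 \<le> sing_vals K n" "\<And>n. norm (K (e n)) = sing_vals K n"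
    by (rule sing_vals_compact[OF K inf], rule that)
  have trunc_sum: "(\<Sum>i<m. trunc n z i) = (\<Sum>i<min m n. z i)" for m z
  proof -
    have "(\<Sum>i<m. trunc n z i) = (\<Sum>i\<in>{..<m} \<inter> {..<n}. z i)"
      unfolding sum.inter_restrict[OF finite_lessThan] by (rule sum.cong) (auto simp: trunc_def)
    moreover have "{..<m} \<inter> {..<n} = {..<min m n}" by auto
    ultimately show ?thesis by simp
  qed
  show ?thesis
  proof (rule phi_weak_majorization[OF sn])
    show "decseq (trunc n (\<lambda>k. sing_vals K k powr p))"
      using e(2,4) p by (auto simp: decseq_def trunc_def intro: powr_mono2)
    show "(\<Sum>i<m. trunc n (\<lambda>k. sing_vals K k powr p) i) \<le> (\<Sum>i<m. trunc n y i)" for m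
      unfolding trunc_sum using le[OF orthonormal_subset[OF e(1)], of "min m n"] by (simp add: e(5))
  qed (use y in \<open>auto simp: trunc_def\<close>)
qed

section \<open>Weak* integrals\<close>

text \<open>Changing \<open>f\<close> on a null set gives an everywhere limit, which is measurable,
  and completeness carries measurability back to \<open>f\<close>. The constant \<open>c\<close> is
  an arbitrary value on that null set, as the target is only a metric space.\<close>

lemma (in complete_measure) borel_measurable_AE_limit:
  fixes f :: "'a \<Rightarrow> 'b::metric_space"
  assumes s: "\<And>n::nat. s n \<in> borel_measurable M" and lim: "AE t in M. (\<lambda>n. s n t) \<longlonglongrightarrow> f t"
  shows "f \<in> borel_measurable M"
proof -
  obtain N where N: "N \<in> null_sets M" "\<And>t. t \<in> space M - N \<Longrightarrow> (\<lambda>n. s n t) \<longlonglongrightarrow> f t"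
    using lim by (rule AE_E3) blast
  define c where "c = f undefined"
  define g where "g t = (if t \<in> N then c else f t)" for t
  have [measurable]: "N \<in> sets M" using N(1) by auto
  have "g \<in> borel_measurable M"
  proof (rule borel_measurable_LIMSEQ_metric)
    show "(\<lambda>t. if t \<in> N then c else s n t) \<in> borel_measurable M" for n
      using s by measurable
    show "(\<lambda>n. if t \<in> N then c else s n t) \<longlonglongrightarrow> g t" if "t \<in> space M" for t
      using N(2)[of t] that by (cases "t \<in> N") (auto simp: g_def)
  qed
  show ?thesis
  proof (rule measurableI)
    fix B :: "'b set" assume "B \<in> sets borel"
    hence A: "g -` B \<inter> space M \<in> sets M" using \<open>g \<in> borel_measurable M\<close>
      by (rule measurable_sets[rotated])
    have ae: "AE t in M. t \<in> g -` B \<inter> space M \<longleftrightarrow> t \<in> f -` B \<inter> space M"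
      by (rule AE_I'[OF N(1)]) (auto simp: g_def)
    show "f -` B \<inter> space M \<in> sets M" by (rule in_sets_AE[OF ae A]) simp
  qed simp
qed

lemma mu_measurable_borel:
  assumes "complete_measure M" "mu_measurable M f" shows "f \<in> borel_measurable M"
proof -
  obtain s where s: "\<And>n. Bochner_Integration.simple_bochner_integrable M (s n)"
    "AE t in M. (\<lambda>n. s n t) \<longlonglongrightarrow> f t"
    using assms(2) unfolding mu_measurable_def by blast
  have "s n \<in> borel_measurable M" for n
    using s(1)[of n]
    by (auto elim: Bochner_Integration.simple_bochner_integrable.cases
      intro: borel_measurable_simple_function)
  thus ?thesis using complete_measure.borel_measurable_AE_limit[OF assms(1) _ s(2)] by blast
qed

text \<open>Approximating simple functions dominated by twice the modulus of \<open>f\<close> are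
  integrable, hence supported on sets of finite measure. This is how the product integrand is seen
  to be weakly* measurable.\<close>

lemma integrable_mu_measurable:
  fixes f :: "'w \<Rightarrow> complex"
  assumes "integrable M f" shows "mu_measurable M f"
proof -
  obtain F where F: "\<And>i. simple_function M (F i)" "\<And>x. x \<in> space M \<Longrightarrow> (\<lambda>i. F i x) \<longlonglongrightarrow> f x"
    "\<And>i x. x \<in> space M \<Longrightarrow> dist (F i x) 0 \<le> 2 * dist (f x) 0"
    using borel_measurable_implies_sequence_metric[OF borel_measurable_integrable[OF assms], of 0]
    by blast
  have "Bochner_Integration.simple_bochner_integrable M (F i)" for i
  proof (rule simple_bochner_integrableI_bounded[OF F(1)])
    have "integrable M (F i)"
      by (rule Bochner_Integration.integrable_bound[of M "\<lambda>x. 2 *\<^sub>R f x"])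
        (use assms F(1,3) in \<open>auto intro: borel_measurable_simple_function\<close>)
    thus "(\<integral>\<^sup>+ x. ennreal (cmod (F i x)) \<partial>M) < \<infinity>" by (simp add: integrable_iff_bounded)
  qed
  thus ?thesis unfolding mu_measurable_def using F(2) by (intro exI[of _ F]) auto
qed

text \<open>Carries measurability and integrability from the diagonal forms, which the definitions
  control, to arbitrary pairs of vectors.\<close>

lemma cinner_polarization:
  assumes "A \<in> bounded_ops"
  defines "q \<equiv> \<lambda>x. cinner (A x) x"
  shows "cinner (A f) g
    = (q (f + g) - q (f - g) + \<i> * q (f + \<i> *\<^sub>C g) - \<i> * q (f - \<i> *\<^sub>C g)) / 4"
  unfolding q_def
  by (simp add: cinner_simps blinfun.bilinear_simps bounded_opsD[OF assms(1)] field_simps)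

lemma weak_measurable_cinner:
  assumes M: "complete_measure M" and A: "weak_measurable M A"
  shows "(\<lambda>t. cinner (A t f) g) \<in> borel_measurable M"
proof -
  define q where "q x t = cinner (A t x) x" for x t
  have [measurable]: "q x \<in> borel_measurable M" for x
    using A mu_measurable_borel[OF M] unfolding weak_measurable_def q_def by blast
  have "(\<lambda>t. (q (f + g) t - q (f - g) t + \<i> * q (f + \<i> *\<^sub>C g) t - \<i> * q (f - \<i> *\<^sub>C g) t) / 4)
    \<in> borel_measurable M"
    by measurable
  thus ?thesis
    by (rule measurable_cong[THEN iffD1, rotated])
      (use A in \<open>auto simp: weak_measurable_def q_def cinner_polarization[of "A _" f g]\<close>)
qed

lemma weak_integrable_cinner:
  assumes A: "weak_integrable M A"
  shows "integrable M (\<lambda>t. cinner (A t f) g)"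
proof -
  define q where "q x t = cinner (A t x) x" for x t
  have "integrable M (q x)" for x
    using A unfolding weak_integrable_def q_def by blast
  hence "integrable M (\<lambda>t. (q (f + g) t - q (f - g) t
    + \<i> * q (f + \<i> *\<^sub>C g) t - \<i> * q (f - \<i> *\<^sub>C g) t) / 4)"
    by simp
  thus ?thesis
    by (rule Bochner_Integration.integrable_cong[OF refl, THEN iffD1, rotated])
      (use A in \<open>auto simp: weak_integrable_def weak_measurable_def q_def
        cinner_polarization[of "A _" f g]\<close>)
qed

text \<open>Separability reduces the condition that the norm is at most \<open>a\<close> to
  countably many conditions on inner products with a dense set; density recovers the norm by letting
  \<open>d\<close> tend to the vector itself.\<close>

lemma borel_measurable_norm_weak:
  fixes u :: "'w \<Rightarrow> 'h::complex_hilbert"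
  assumes sep: "separable_space (euclidean :: 'h topology)"
    and u: "\<And>d. (\<lambda>t. cinner (u t) d) \<in> borel_measurable M"
  shows "(\<lambda>t. norm (u t)) \<in> borel_measurable M"
proof -
  obtain C :: "'h set" where C: "countable C" "closure C = UNIV"
    using sep unfolding separable_space_def by auto
  have *: "norm x \<le> a \<longleftrightarrow> (\<forall>d\<in>C. cmod (cinner x d) \<le> a * norm d)" if "0 \<le> a" for x :: 'h and a
  proof
    assume "norm x \<le> a"
    thus "\<forall>d\<in>C. cmod (cinner x d) \<le> a * norm d"
      using cmod_cinner_le[of x] by (meson mult_right_mono norm_ge_zero order_trans)
  next
    assume le: "\<forall>d\<in>C. cmod (cinner x d) \<le> a * norm d"
    obtain d where d: "\<And>n. d n \<in> C" "d \<longlonglongrightarrow> x"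
      using C(2) closure_sequential[of x C] by auto
    have "(\<lambda>n. cmod (cinner x (d n))) \<longlonglongrightarrow> cmod (cinner x x)" by (intro tendsto_intros d)
    moreover have "(\<lambda>n. a * norm (d n)) \<longlonglongrightarrow> a * norm x" by (intro tendsto_intros d)
    ultimately have "cmod (cinner x x) \<le> a * norm x"
      by (rule LIMSEQ_le) (use le d in auto)
    hence "norm x * norm x \<le> a * norm x" by (simp add: cinner_self norm_mult power2_eq_square)
    thus "norm x \<le> a" using that by (cases "x = 0") auto
  qed
  show ?thesis
    unfolding borel_measurable_iff_le
  proof
    fix a :: real
    show "{t \<in> space M. norm (u t) \<le> a} \<in> sets M"
    proof (cases "0 \<le> a")
      case True
      have [measurable]: "(\<lambda>t. cinner (u t) d) \<in> borel_measurable M" for d by (rule u)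
      show ?thesis unfolding *[OF True] using C(1) by measurable
    next
      case False
      hence "{t \<in> space M. norm (u t) \<le> a} = {}" by (auto simp: not_le intro: less_le_trans)
      thus ?thesis by (simp only: sets.empty_sets)
    qed
  qed
qed

text \<open>Real polarization expresses the real part through norms of sums and differences; the
  imaginary part is the real part with \<open>v\<close> multiplied by \<open>\<i>\<close>.\<close>

lemma borel_measurable_cinner_weak:
  fixes u v :: "'w \<Rightarrow> 'h::complex_hilbert"
  assumes sep: "separable_space (euclidean :: 'h topology)"
    and u: "\<And>d. (\<lambda>t. cinner (u t) d) \<in> borel_measurable M"
    and v: "\<And>d. (\<lambda>t. cinner (v t) d) \<in> borel_measurable M"
  shows "(\<lambda>t. cinner (u t) (v t)) \<in> borel_measurable M"
proof -
  have Re: "(\<lambda>t. Re (cinner (u t) (w t))) \<in> borel_measurable M"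
    if w: "\<And>d. (\<lambda>t. cinner (w t) d) \<in> borel_measurable M" for w
  proof -
    have [measurable]: "(\<lambda>t. norm (u t + w t)) \<in> borel_measurable M"
      by (rule borel_measurable_norm_weak[OF sep]) (use u w in \<open>simp add: cinner_add_left\<close>)
    have [measurable]: "(\<lambda>t. norm (u t - w t)) \<in> borel_measurable M"
      by (rule borel_measurable_norm_weak[OF sep]) (use u w in \<open>simp add: cinner_diff_left\<close>)
    have eq: "Re (cinner (u t) (w t)) = ((norm (u t + w t))\<^sup>2 - (norm (u t - w t))\<^sup>2) / 4" for t
      unfolding power2_norm_eq_inner
      by (simp add: Re_cinner inner_add_left inner_add_right inner_diff_left inner_diff_right inner_commute)
    show ?thesis unfolding eq by measurable
  qed
  have "(\<lambda>t. cinner (\<i> *\<^sub>C v t) d) \<in> borel_measurable M" for d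
    using v by (simp add: cinner_scaleC_left)
  from Re[OF this] have "(\<lambda>t. Im (cinner (u t) (v t))) \<in> borel_measurable M"
    by (simp add: cinner_scaleC_right)
  with Re[OF v] show ?thesis by (subst borel_measurable_complex_iff) simp
qed

text \<open>
  A uniform boundedness principle: the sets \<open>{f. \<integral> h t f \<le> n}\<close> are closed by Fatou's lemma,
  so one of them contains a ball.
\<close>

theorem integral_form_bounded:
  fixes h :: "'w \<Rightarrow> 'h::{real_normed_vector,complete_space} \<Rightarrow> real"
  assumes cont: "\<And>t. t \<in> space M \<Longrightarrow> continuous_on UNIV (h t)"
    and nonneg: "\<And>t f. t \<in> space M \<Longrightarrow> 0 \<le> h t f"
    and int: "\<And>f. integrable M (\<lambda>t. h t f)"
    and K: "0 \<le> K" "\<And>t f g. t \<in> space M \<Longrightarrow> h t (f + g) \<le> K * (h t f + h t g)"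
    and hom: "\<And>t r f. t \<in> space M \<Longrightarrow> h t (r *\<^sub>R f) = \<bar>r\<bar> powr s * h t f"
  shows "\<exists>C\<ge>0. \<forall>f. (\<integral>t. h t f \<partial>M) \<le> C * norm f powr s"
proof -
  define G where "G f = (\<integral>t. h t f \<partial>M)" for f
  define S where "S n = {f. G f \<le> real n}" for n
  have Gnn: "ennreal (G f) = (\<integral>\<^sup>+t. ennreal (h t f) \<partial>M)" for f
    unfolding G_def using int nonneg by (intro nn_integral_eq_integral[symmetric]) auto
  have G0: "0 \<le> G f" for f unfolding G_def using nonneg by (intro integral_nonneg_AE) auto
  have closed: "closed (S n)" for n
    unfolding closed_sequential_limits
  proof (intro allI impI, elim conjE)
    fix X l assume X: "\<forall>k. X k \<in> S n" and lim: "X \<longlonglongrightarrow> l"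
    have "ennreal (G l) = (\<integral>\<^sup>+t. liminf (\<lambda>k. ennreal (h t (X k))) \<partial>M)"
      unfolding Gnn
    proof (rule nn_integral_cong)
      fix t assume t: "t \<in> space M"
      have "(\<lambda>k. h t (X k)) \<longlonglongrightarrow> h t l"
        using cont[OF t] lim by (rule continuous_on_tendsto_compose) auto
      hence "(\<lambda>k. ennreal (h t (X k))) \<longlonglongrightarrow> ennreal (h t l)" by (rule tendsto_ennrealI)
      thus "ennreal (h t l) = liminf (\<lambda>k. ennreal (h t (X k)))"
        by (rule lim_imp_Liminf[OF sequentially_bot, symmetric])
    qed
    also have "\<dots> \<le> liminf (\<lambda>k. \<integral>\<^sup>+t. ennreal (h t (X k)) \<partial>M)"
    proof (rule nn_integral_liminf)
      have [measurable]: "(\<lambda>t. h t f) \<in> borel_measurable M" for f using int by blast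
      show "(\<lambda>t. ennreal (h t (X k))) \<in> borel_measurable M" for k by measurable
    qed
    also have "\<dots> \<le> liminf (\<lambda>k. ennreal n)"
      using X unfolding Gnn[symmetric] S_def
      by (intro Liminf_mono always_eventually allI ennreal_leI) auto
    also have "\<dots> = ennreal n" by (rule Liminf_const) simp
    finally show "l \<in> S n" by (simp add: S_def)
  qed
  have "\<exists>n. interior (S n) \<noteq> {}"
  proof (rule ccontr)
    assume "\<not> ?thesis"
    hence "euclidean interior_of \<Union>(range S) = {}"
      using Met_TC.metric_Baire_category_alt[where 'a = 'h, of "range S"] closed complete_UNIV
      by auto
    moreover have "\<Union>(range S) = UNIV"
      using real_arch_simple by (auto simp: S_def)
    ultimately show False by simp
  qed
  then obtain n x0 where "x0 \<in> interior (S n)" by blast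
  then obtain \<rho> where \<rho>: "\<rho> > 0" "ball x0 \<rho> \<subseteq> S n" by (meson mem_interior)
  \<comment> \<open>The ball is moved to the origin by writing \<open>f\<close> as
    \<open>(x0 + f) + (- x0)\<close>; both summands have integral at most \<open>n\<close>, the
    second by evenness.\<close>
  have small: "G f \<le> 2 * K * n" if "norm f < \<rho>" for f
  proof -
    have "G f \<le> (\<integral>t. K * (h t (x0 + f) + h t ((-1) *\<^sub>R x0)) \<partial>M)"
      unfolding G_def
    proof (rule integral_mono[OF int])
      show "integrable M (\<lambda>t. K * (h t (x0 + f) + h t ((-1) *\<^sub>R x0)))" using int by simp
      show "h t f \<le> K * (h t (x0 + f) + h t ((-1) *\<^sub>R x0))" if "t \<in> space M" for t
        using K(2)[OF that, of "x0 + f" "(-1) *\<^sub>R x0"] by simp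
    qed
    also have "\<dots> = (\<integral>t. K * (h t (x0 + f) + h t x0) \<partial>M)"
      by (rule Bochner_Integration.integral_cong) (use hom[of _ "-1" x0] in auto)
    also have "\<dots> = K * (G (x0 + f) + G x0)" unfolding G_def using int by simp
    also have "\<dots> \<le> K * (real n + real n)"
    proof (rule mult_left_mono[OF add_mono K(1)])
      have "x0 + f \<in> S n" using \<rho>(2) that by (auto simp: subset_iff dist_norm)
      thus "G (x0 + f) \<le> n" by (simp add: S_def)
      have "x0 \<in> S n" using \<rho> by auto
      thus "G x0 \<le> n" by (simp add: S_def)
    qed
    finally show ?thesis by simp
  qed
  define C where "C = (2 / \<rho>) powr s * (2 * K * n)"
  have "G f \<le> C * norm f powr s" for f
  proof (cases "f = 0")
    case True
    have "G (2 *\<^sub>R 0) = 2 powr s * G 0"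
      unfolding G_def by (subst integral_mult_right_zero[symmetric])
        (rule Bochner_Integration.integral_cong, use hom[of _ 2 0] in auto)
    hence z: "G 0 = 2 powr s * G 0" by simp
    \<comment> \<open>\<open>0 powr s\<close> is 0 for every real \<open>s\<close>, so homogeneity
      with factor 0 makes the integrand vanish.\<close>
    have "G (0 *\<^sub>R 0) = 0"
      unfolding G_def using hom[of _ 0 0] by (intro integral_eq_zero_AE) auto
    thus ?thesis using True by simp
  next
    case False
    \<comment> \<open>The rescaled vector \<open>(1 / r) *\<^sub>R f\<close> has norm
      \<open>\<rho> / 2\<close>, which is inside the ball.\<close>
    define r where "r = 2 * norm f / \<rho>"
    have r: "r > 0" using False \<rho> by (simp add: r_def)
    have "G f = G (r *\<^sub>R ((1 / r) *\<^sub>R f))" using r by simp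
    also have "\<dots> = r powr s * G ((1 / r) *\<^sub>R f)"
      unfolding G_def by (subst integral_mult_right_zero[symmetric])
        (rule Bochner_Integration.integral_cong, use hom[of _ r "(1 / r) *\<^sub>R f"] r in auto)
    also have "\<dots> \<le> r powr s * (2 * K * n)"
      using r False \<rho>(1) by (intro mult_left_mono small) (auto simp: r_def)
    also have "r powr s = (2 / \<rho>) powr s * norm f powr s"
      using \<rho>(1) by (simp add: r_def powr_mult[symmetric])
    finally show ?thesis by (simp add: C_def mult_ac)
  qed
  moreover have "0 \<le> C" using K(1) by (simp add: C_def)
  ultimately show ?thesis unfolding G_def by blast
qed

text \<open>Young's inequality is applied to \<open>u\<close> and \<open>v\<close> divided by their
  norms enlarged by \<open>e > 0\<close>, so that a vanishing norm causes no division by 0; then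
  \<open>e\<close> tends to 0.\<close>

theorem Holder_integral:
  fixes u v :: "'w \<Rightarrow> real"
  assumes pq: "1 < p" "1 < q" "1 / p + 1 / q = 1"
    and [measurable]: "u \<in> borel_measurable M" "v \<in> borel_measurable M"
    and nonneg: "\<And>t. 0 \<le> u t" "\<And>t. 0 \<le> v t"
    and int: "integrable M (\<lambda>t. u t powr p)" "integrable M (\<lambda>t. v t powr q)"
  shows "integrable M (\<lambda>t. u t * v t)"
    and "(\<integral>t. u t * v t \<partial>M) \<le> (\<integral>t. u t powr p \<partial>M) powr (1 / p) * (\<integral>t. v t powr q \<partial>M) powr (1 / q)"
proof -
  show uv: "integrable M (\<lambda>t. u t * v t)"
  proof (rule Bochner_Integration.integrable_bound[where f = "\<lambda>t. u t powr p / p + v t powr q / q"])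
    show "AE t in M. norm (u t * v t) \<le> norm (u t powr p / p + v t powr q / q)"
      using Youngs_inequality[OF pq nonneg(1) nonneg(2)] nonneg pq
      by (intro AE_I2) (simp add: abs_mult)
  qed (use int in auto)
  define I J where "I = (\<integral>t. u t powr p \<partial>M)" and "J = (\<integral>t. v t powr q \<partial>M)"
  define U V where "U = I powr (1 / p)" and "V = J powr (1 / q)"
  have IJ: "0 \<le> I" "0 \<le> J" unfolding I_def J_def by (simp_all add: integral_nonneg)
  have UV: "U powr p = I" "V powr q = J" "0 \<le> U" "0 \<le> V"
    using IJ pq by (simp_all add: U_def V_def powr_powr)
  have eps: "(\<integral>t. u t * v t \<partial>M) \<le> (U + e) * (V + e)" if e: "e > 0" for e
  proof -
    define a b where "a = U + e" and "b = V + e"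
    have ab: "0 < a" "0 < b" "U \<le> a" "V \<le> b" using UV e by (auto simp: a_def b_def)
    have "(\<integral>t. u t * v t \<partial>M) / (a * b) = (\<integral>t. (u t / a) * (v t / b) \<partial>M)"
      by (simp flip: integral_divide_zero)
    also have "\<dots> \<le> (\<integral>t. u t powr p / (a powr p * p) + v t powr q / (b powr q * q) \<partial>M)"
    proof (rule integral_mono)
      show "u t / a * (v t / b) \<le> u t powr p / (a powr p * p) + v t powr q / (b powr q * q)" for t
        using Youngs_inequality[OF pq, of "u t / a" "v t / b"] nonneg ab by (simp add: powr_divide)
    qed (use uv int in auto)
    also have "\<dots> = I / (a powr p * p) + J / (b powr q * q)"
      using int by (simp add: I_def J_def)
    also have "\<dots> \<le> 1 / p + 1 / q"
    proof (rule add_mono)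
      have "I \<le> a powr p" using UV ab pq powr_mono2[of p U a] by simp
      thus "I / (a powr p * p) \<le> 1 / p" using ab pq by (simp add: field_simps)
      have "J \<le> b powr q" using UV ab pq powr_mono2[of q V b] by simp
      thus "J / (b powr q * q) \<le> 1 / q" using ab pq by (simp add: field_simps)
    qed
    finally have "(\<integral>t. u t * v t \<partial>M) / (a * b) \<le> 1" using pq by simp
    thus ?thesis using ab by (simp add: a_def b_def divide_le_eq)
  qed
  have "((\<lambda>e. (U + e) * (V + e)) \<longlongrightarrow> (U + 0) * (V + 0)) (at_right 0)"
    by (intro tendsto_intros)
  hence "(\<integral>t. u t * v t \<partial>M) \<le> (U + 0) * (V + 0)"
    by (rule tendsto_lowerbound) (use eps in \<open>auto simp: eventually_at_right_less eventually_at_filter\<close>)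
  thus "(\<integral>t. u t * v t \<partial>M) \<le> (\<integral>t. u t powr p \<partial>M) powr (1 / p) * (\<integral>t. v t powr q \<partial>M) powr (1 / q)"
    by (simp add: U_def V_def I_def J_def)
qed

text \<open>The bound makes the integrated form representable by an operator. It stays a hypothesis
  because its source varies: uniform boundedness for positive integrands, Hoelder's inequality for
  the product.\<close>

lemma weak_integral:
  fixes A :: "'w \<Rightarrow> 'h::complex_hilbert \<Rightarrow>\<^sub>L 'h"
  assumes A: "weak_integrable M A" and E: "E \<in> sets M"
    and bound: "\<And>f g. cmod (LINT t:E|M. cinner (A t f) g) \<le> C * norm f * norm g"
  shows weak_integral_bounded: "weak_integral M E A \<in> bounded_ops"
    and cinner_weak_integral: "cinner (weak_integral M E A f) g
      = (LINT t:E|M. cinner (A t f) g)"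
proof -
  define b where "b f g = (LINT t:E|M. cinner (A t f) g)" for f g
  have A': "A t \<in> bounded_ops" if "t \<in> space M" for t
    using A that by (auto simp: weak_integrable_def weak_measurable_def)
  have int: "set_integrable M E (\<lambda>t. cinner (A t f) g)" for f g
    unfolding set_integrable_def using weak_integrable_cinner[OF A] E
    by (intro integrable_mult_indicator)
  have cong: "(LINT t:E|M. u t) = (LINT t:E|M. v t)" if "\<And>t. t \<in> space M \<Longrightarrow> u t = v t"
    for u v :: "'w \<Rightarrow> complex"
    unfolding set_lebesgue_integral_def using that by (intro Bochner_Integration.integral_cong) auto
  have "\<exists>T\<in>bounded_ops. \<forall>f g. cinner (T f) g = b f g"
  proof (rule sesquilinear_operator[where C = C])
    show "b (f + f') g = b f g + b f' g" for f f' g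
      unfolding b_def using set_integral_add(2)[OF int int]
      by (simp add: blinfun.add_right cinner_add_left)
    show "b f (g + g') = b f g + b f g'" for f g g'
      unfolding b_def using set_integral_add(2)[OF int int] by (simp add: cinner_add_right)
    show "b (c *\<^sub>C f) g = c * b f g" for c f g
      unfolding b_def set_integral_mult_right[symmetric]
      by (rule cong) (simp add: bounded_opsD[OF A'] cinner_scaleC_left)
    show "b f (c *\<^sub>C g) = cnj c * b f g" for c f g
      unfolding b_def set_integral_mult_right[symmetric]
      by (rule cong) (simp add: cinner_scaleC_right)
    show "cmod (b f g) \<le> C * norm f * norm g" for f g unfolding b_def by (rule bound)
  qed
  then obtain T where T: "T \<in> bounded_ops" "\<And>f g. cinner (T f) g = b f g" by blast
  have "weak_integral M E A = T"
    unfolding weak_integral_def b_def[symmetric]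
  proof (rule the_equality)
    fix T' assume "T' \<in> bounded_ops \<and> (\<forall>f g. cinner (T' f) g = b f g)"
    thus "T' = T" using T by (intro bounded_ops_cinner_eqI) simp
  qed (use T in blast)
  thus "weak_integral M E A \<in> bounded_ops"
    "cinner (weak_integral M E A f) g = (LINT t:E|M. cinner (A t f) g)"
    using T by (simp_all add: b_def)
qed

lemma pos_op_form_scaleC:
  assumes "pos_op R"
  shows "inner (R (c *\<^sub>C x)) (c *\<^sub>C x) = (cmod c)\<^sup>2 * inner (R x) x"
proof -
  have "cinner (R (c *\<^sub>C x)) (c *\<^sub>C x) = (c * cnj c) * cinner (R x) x"
    by (simp add:
      bounded_opsD[OF pos_opD(1)[OF assms]] cinner_scaleC_left cinner_scaleC_right mult_ac)
  also have "\<dots> = of_real ((cmod c)\<^sup>2 * inner (R x) x)"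
    unfolding complex_norm_square[symmetric] cinner_pos_op[OF assms] by simp
  finally show ?thesis by (simp only: Re_cinner[symmetric] Re_complex_of_real)
qed

text \<open>Positivity at \<open>c x - y\<close>, with \<open>c\<close> unimodular and chosen to
  make the mixed term real. The additive bound, unlike a product of roots, can be integrated term by
  term.\<close>

lemma cmod_pos_op_form_le:
  assumes R: "pos_op R"
  shows "cmod (cinner (R x) y) \<le> (inner (R x) x + inner (R y) y) / 2"
proof -
  obtain c where c: "cmod c = 1" "of_real (cmod (cinner (R x) y)) = c * cinner (R x) y"
    using cmod_eq_rotate by blast
  define z where "z = c *\<^sub>C x"
  have "cinner (R z) y = of_real (cmod (cinner (R x) y))"
    by (simp add: z_def bounded_opsD[OF pos_opD(1)[OF R]] cinner_scaleC_left c(2))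
  hence "cmod (cinner (R x) y) = Re (cinner (R z) y)" by simp
  also have "\<dots> \<le> (inner (R z) z + inner (R y) y) / 2"
    using pos_opD(4)[OF R, of "z - y"] pos_opD(3)[OF R, of y z]
    by (simp add: Re_cinner blinfun.bilinear_simps inner_diff_left inner_diff_right inner_commute)
  also have "inner (R z) z = inner (R x) x"
    by (simp add: z_def pos_op_form_scaleC[OF R] c(1))
  finally show ?thesis .
qed

text \<open>
  For positive integrands the bound needed for the weak* integral to exist comes from uniform
  boundedness.
\<close>

theorem
  fixes S :: "'w \<Rightarrow> 'h::complex_hilbert \<Rightarrow>\<^sub>L 'h"
  assumes S: "weak_integrable M S" and pos: "\<And>t. t \<in> space M \<Longrightarrow> pos_op (S t)" and E: "E \<in> sets M"
  shows pos_op_weak_integral: "pos_op (weak_integral M E S)"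
    and inner_weak_integral: "inner (weak_integral M E S f) f
      = (LINT t:E|M. inner (S t f) f)"
proof -
  have int: "integrable M (\<lambda>t. inner (S t f) f)" for f
    using weak_integrable_cinner[OF S, of f f] integrable_Re
    by (simp add: Re_cinner[symmetric])
  have mono: "h t (f + g) \<le> 2 * (h t f + h t g)" if "t \<in> space M" "h = (\<lambda>t f. inner (S t f) f)"
    for h t f g
    using pos_opD(4)[OF pos[OF that(1)], of "f - g"] unfolding that(2)
    by (simp add: blinfun.bilinear_simps inner_add_left inner_add_right inner_diff_left inner_diff_right)
  have "\<exists>C\<ge>0. \<forall>f. (\<integral>t. inner (S t f) f \<partial>M) \<le> C * norm f powr 2"
  proof (rule integral_form_bounded[where K = 2])
    show "continuous_on UNIV (\<lambda>f. inner (S t f) f)" for t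
      by (intro continuous_intros)
    show "0 \<le> inner (S t f) f" if "t \<in> space M" for t f
      using pos_opD(4)[OF pos[OF that]] .
    show "inner (S t (r *\<^sub>R f)) (r *\<^sub>R f) = \<bar>r\<bar> powr 2 * inner (S t f) f" for t r f
      by (simp add: blinfun.scaleR_right powr_numeral power2_eq_square)
  qed (use int mono in auto)
  then obtain C where C: "0 \<le> C" "\<And>f. (\<integral>t. inner (S t f) f \<partial>M) \<le> C * norm f powr 2" by blast
  \<comment> \<open>The additive bound is not homogeneous in \<open>f\<close> and \<open>g\<close>
    separately, so it is integrated for unit vectors and the general case follows by
    scaling.\<close>
  have unit: "cmod (LINT t:E|M. cinner (S t f) g) \<le> C" if "norm f = 1" "norm g = 1" for f g
  proof -
    have "cmod (LINT t:E|M. cinner (S t f) g) \<le> (\<integral>t. cmod (indicator E t *\<^sub>R cinner (S t f) g) \<partial>M)"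
      unfolding set_lebesgue_integral_def by (rule integral_norm_bound)
    also have "\<dots> \<le> (\<integral>t. (inner (S t f) f + inner (S t g) g) / 2 \<partial>M)"
    proof (rule integral_mono)
      show "integrable M (\<lambda>t. cmod (indicator E t *\<^sub>R cinner (S t f) g))"
        by (intro integrable_norm integrable_mult_indicator[OF E weak_integrable_cinner[OF S]])
      show "cmod (indicator E t *\<^sub>R cinner (S t f) g) \<le> (inner (S t f) f + inner (S t g) g) / 2"
        if "t \<in> space M" for t
        using cmod_pos_op_form_le[OF pos[OF that], of f g] pos_opD(4)[OF pos[OF that]]
        by (simp add: indicator_def)
    qed (use int in simp)
    also have "\<dots> \<le> C" using int C(2)[of f] C(2)[of g] that by simp
    finally show ?thesis .
  qed
  have sc: "(LINT t:E|M. cinner (S t (r *\<^sub>R f)) (s *\<^sub>R g))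
      = of_real (r * s) * (LINT t:E|M. cinner (S t f) g)" for r s f g
    unfolding set_integral_mult_right[symmetric]
    by (simp add: blinfun.scaleR_right cinner_scaleR_left cinner_scaleR_right mult_ac)
  have bound: "cmod (LINT t:E|M. cinner (S t f) g) \<le> C * norm f * norm g" for f g
  proof (cases "f = 0 \<or> g = 0")
    case True
    thus ?thesis by auto
  next
    case False
    define f' g' where "f' = (1 / norm f) *\<^sub>R f" and "g' = (1 / norm g) *\<^sub>R g"
    have "f = norm f *\<^sub>R f'" "g = norm g *\<^sub>R g'" "norm f' = 1" "norm g' = 1"
      using False by (simp_all add: f'_def g'_def)
    hence "cmod (LINT t:E|M. cinner (S t f) g)
        = norm f * norm g * cmod (LINT t:E|M. cinner (S t f') g')"
      using sc[of "norm f" f' "norm g" g'] by (simp add: norm_mult)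
    also have "\<dots> \<le> norm f * norm g * C"
      using unit[of f' g'] \<open>norm f' = 1\<close> \<open>norm g' = 1\<close> by (intro mult_left_mono) auto
    finally show ?thesis by (simp add: mult_ac)
  qed
  note W = weak_integral[OF S E bound]
  have si: "set_integrable M E (\<lambda>t. inner (S t f) f)" for f
    unfolding set_integrable_def using int E by (intro integrable_mult_indicator)
  have cW: "cinner (weak_integral M E S f) f = of_real (LINT t:E|M. inner (S t f) f)" for f
    unfolding W(2) set_lebesgue_integral_def using si[of f] unfolding set_integrable_def
    by (subst integral_complex_of_real[symmetric])
      (intro Bochner_Integration.integral_cong,
        auto simp: cinner_pos_op[OF pos] scaleR_conv_of_real)
  show inn: "inner (weak_integral M E S f) f = (LINT t:E|M. inner (S t f) f)" for f
    using cW[of f] by (simp flip: Re_cinner)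
  show "pos_op (weak_integral M E S)"
    unfolding pos_op_def
  proof (intro conjI allI)
    show "weak_integral M E S \<in> bounded_ops" by (rule W)
    show "0 \<le> inner (weak_integral M E S f) f" for f
      unfolding inn set_lebesgue_integral_def using pos_opD(4)[OF pos]
      by (intro integral_nonneg_AE) auto
    show "cinner (weak_integral M E S f) g = cinner f (weak_integral M E S g)" for f g
    proof -
      have "cinner f (weak_integral M E S g) = cnj (LINT t:E|M. cinner (S t g) f)"
        using cinner_commute[of f] W(2) by metis
      also have "\<dots> = (LINT t:E|M. cinner (S t f) g)"
        unfolding set_lebesgue_integral_def unfolding Bochner_Integration.integral_cnj[symmetric]
        by (intro Bochner_Integration.integral_cong)
          (auto simp: pos_opD(2)[OF pos] simp flip: cinner_commute)
      finally show ?thesis by (simp add: W(2))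
    qed
  qed
qed

section \<open>Integrals of products\<close>

text \<open>Positivity at \<open>v k - v j\<close> bounds each mixed term by the mean of two
  diagonal ones. It controls the form on the span of finitely many eigenvectors by its values at
  these vectors.\<close>

lemma pos_op_form_sum_le:
  assumes R: "pos_op R" and "finite I"
  shows "inner (R (\<Sum>k\<in>I. v k)) (\<Sum>k\<in>I. v k)
    \<le> real (card I) * (\<Sum>k\<in>I. inner (R (v k)) (v k))"
proof -
  define g where "g k = inner (R (v k)) (v k)" for k
  have le: "inner (R (v k)) (v j) \<le> (g k + g j) / 2" for k j
    using pos_opD(4)[OF R, of "v k - v j"] pos_opD(3)[OF R, of "v j" "v k"]
    by (simp add: g_def blinfun.bilinear_simps inner_diff_left inner_diff_right inner_commute)
  have "inner (R (\<Sum>k\<in>I. v k)) (\<Sum>k\<in>I. v k)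
      = (\<Sum>k\<in>I. \<Sum>j\<in>I. inner (R (v k)) (v j))"
    by (simp add: blinfun.sum_right inner_sum_left inner_sum_right) (rule sum.swap)
  also have "\<dots> \<le> (\<Sum>k\<in>I. \<Sum>j\<in>I. (g k + g j) / 2)" by (intro sum_mono le)
  also have "\<dots> = real (card I) * (\<Sum>k\<in>I. g k)"
    by (simp add: add_divide_distrib sum.distrib flip: sum_divide_distrib sum_distrib_left)
  finally show ?thesis by (simp add: g_def)
qed

text \<open>Bessel's inequality is used in the index \<open>i\<close>: an orthonormal family puts
  total weight at most 1 on each unit vector \<open>e k\<close>, whatever its length
  \<open>n\<close>.\<close>

lemma sum_norm_proj_le:
  assumes f: "orthonormal f {..<n::nat}" and e: "orthonormal e UNIV" and c: "\<And>k. 0 \<le> c k"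
  shows "(\<Sum>i<n. \<Sum>k<r::nat. (cmod (cinner (f i) (e k)))\<^sup>2 * c k) \<le> (\<Sum>k<r. c k)"
proof -
  have "(\<Sum>i<n. \<Sum>k<r. (cmod (cinner (f i) (e k)))\<^sup>2 * c k)
      = (\<Sum>k<r. (\<Sum>i<n. (cmod (cinner (f i) (e k)))\<^sup>2) * c k)"
    by (subst sum.swap) (simp add: sum_distrib_right)
  also have "\<dots> \<le> (\<Sum>k<r. 1 * c k)"
  proof (intro sum_mono mult_right_mono c)
    show "(\<Sum>i<n. (cmod (cinner (f i) (e k)))\<^sup>2) \<le> 1" for k
      using Bessel'[OF _ f, of "e k"] orthonormal_norm[OF e, of k] by simp
  qed
  finally show ?thesis by simp
qed

text \<open>A bound on a sum that is uniform in its length is a majorization by the sequence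
  \<open>(c, 0, 0, ...)\<close>, whose norm is \<open>c\<close> by the normalization of
  \<Phi>.\<close>

lemma phi_single:
  assumes sn: "sn_function \<Phi>" and c: "0 \<le> c"
  shows "phi \<Phi> (trunc n (\<lambda>k. if k = 0 then c else 0)) \<le> c"
proof -
  define u where "u k = (if k = 0 then 1 else 0 :: real)" for k :: nat
  have u: "rfin u" unfolding rfin_def u_def by (intro exI[of _ 1]) simp
  have "(\<lambda>k. complex_of_real (u k)) = (\<lambda>n. if n = 0 then 1 else 0)" by (auto simp: u_def)
  hence "phi \<Phi> u = 1" using sn_unit[OF sn] by (simp only: phi_def)
  hence "phi \<Phi> (\<lambda>k. c * u k) = c" using phi_scale[OF sn u c] by simp
  moreover have "rfin (\<lambda>k. c * u k)" unfolding rfin_def u_def by (intro exI[of _ 1]) simp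
  hence "phi \<Phi> (trunc n (\<lambda>k. if k = 0 then c else 0)) \<le> phi \<Phi> (\<lambda>k. c * u k)"
    using c by (intro phi_mono[OF sn]) (auto simp: trunc_def u_def)
  ultimately show ?thesis by simp
qed

text \<open>Common form of the estimates below; \<open>y\<close> will be the scaled eigenvalues, a
  tail of them, a single entry, or a tail plus a single entry.\<close>

lemma sn_ideal_p_modI:
  fixes K :: "'h::complex_hilbert \<Rightarrow>\<^sub>L 'h"
  assumes sn: "sn_function \<Phi>" and p: "0 < p"
    and K: "K \<in> bounded_ops" "compact_op K" and inf: "infinite_dim TYPE('h)"
    and y: "\<And>k. 0 \<le> y k" "\<And>n. phi \<Phi> (trunc n y) \<le> V"
    and le: "\<And>n f. orthonormal f {..<n} \<Longrightarrow> (\<Sum>i<n. norm (K (f i)) powr p) \<le> (\<Sum>i<n. y i)"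
  shows "K \<in> sn_ideal (p_mod \<Phi> p)" and "sn_norm (p_mod \<Phi> p) K \<le> ennreal (V powr (1 / p))"
proof -
  have s: "sing_vals K \<longlonglongrightarrow> 0" "0 \<le> sing_vals K n" for n
    by (rule sing_vals_compact[OF K inf]; assumption)+
  have "phi \<Phi> (trunc n (\<lambda>k. sing_vals K k powr p)) \<le> V" for n
    using phi_sing_vals_le[OF sn p K inf y(1) le] y(2) order_trans by blast
  thus le: "sn_norm (p_mod \<Phi> p) K \<le> ennreal (V powr (1 / p))"
    unfolding sn_norm_def by (intro p_mod_sn_ext_le[OF sn p s(2)])
  have "(\<lambda>n. complex_of_real (sing_vals K n)) \<longlonglongrightarrow> 0"
    using tendsto_of_real[OF s(1)] by simp
  moreover have "sn_ext (p_mod \<Phi> p) (\<lambda>n. of_real (sing_vals K n)) < \<infinity>"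
    using le unfolding sn_norm_def by (simp add: le_less_trans)
  ultimately show "K \<in> sn_ideal (p_mod \<Phi> p)"
    using K by (simp add: sn_ideal_def c_space_def)
qed

section \<open>The integral of the product and its pointwise estimate\<close>

locale operator_Hoelder =
  fixes M :: "'w measure" and p q :: real and A B :: "'w \<Rightarrow> 'h::complex_hilbert \<Rightarrow>\<^sub>L 'h"
  assumes sep: "separable_space (euclidean :: 'h topology)"
    and inf: "infinite_dim TYPE('h)"
    and complete: "complete_measure M"
    and q: "1 < q" and p: "2 \<le> p" and pq: "1 / p + 1 / q = 1"
    and A: "A \<in> Ls_space M q" and B: "B \<in> LG_space M p"
begin

abbreviation "S \<equiv> (\<lambda>t. op_powr (op_abs (B t)) p)"
abbreviation "T E \<equiv> weak_integral M E S"
abbreviation "X E \<equiv> weak_integral M E (\<lambda>t. adj (A t) o\<^sub>L B t)"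
abbreviation "L \<equiv> Ls_norm M q A"

lemma A_ops: "t \<in> space M \<Longrightarrow> A t \<in> bounded_ops" and B_ops: "t \<in> space M \<Longrightarrow> B t \<in> bounded_ops"
  using A B by (auto simp: Ls_space_def LG_space_def weak_measurable_def)

lemma pos_S: "t \<in> space M \<Longrightarrow> pos_op (S t)"
  using p by (intro pos_op_op_powr pos_op_op_abs B_ops) auto

lemma S_integrable: "weak_integrable M S"
  using B by (simp add: LG_space_def)

lemma pos_T: "E \<in> sets M \<Longrightarrow> pos_op (T E)"
  by (rule pos_op_weak_integral[OF S_integrable pos_S])

lemma inner_T: "E \<in> sets M \<Longrightarrow>
    inner (T E f) f = (LINT t:E|M. inner (S t f) f)"
  by (rule inner_weak_integral[OF S_integrable pos_S])

lemma inner_S_integrable: "integrable M (\<lambda>t. inner (S t f) f)"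
  using integrable_Re[OF weak_integrable_cinner[OF S_integrable, of f f]] by (simp add: Re_cinner)

lemma inner_T_mono:
  assumes E: "E \<in> sets M"
  shows "inner (T E f) f \<le> inner (T (space M) f) f"
proof -
  have "inner (T E f) f
      = (\<integral>t. indicator E t * inner (S t f) f \<partial>M)"
    by (simp add: inner_T[OF E] set_lebesgue_integral_def)
  also have "\<dots> \<le> (\<integral>t. indicator (space M) t * inner (S t f) f \<partial>M)"
  proof (rule integral_mono)
    show "integrable M (\<lambda>t. indicator E t * inner (S t f) f)"
      "integrable M (\<lambda>t. indicator (space M) t * inner (S t f) f)"
      using E inner_S_integrable integrable_mult_indicator[of _ M "\<lambda>t. inner (S t f) f"] by auto
    show "indicator E t * inner (S t f) f \<le> indicator (space M) t * inner (S t f) f"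
      if "t \<in> space M" for t
      using that pos_opD(4)[OF pos_S[OF that]] by (simp add: indicator_def)
  qed
  finally show ?thesis by (simp add: inner_T[OF sets.top] set_lebesgue_integral_def)
qed

lemma A_meas [measurable]: "(\<lambda>t. norm (A t f)) \<in> borel_measurable M"
  and B_meas [measurable]: "(\<lambda>t. norm (B t f)) \<in> borel_measurable M"
  using A B by (auto intro!: borel_measurable_norm_weak[OF sep] weak_measurable_cinner[OF complete]
      simp: Ls_space_def LG_space_def)

lemma A_powr_integrable: "integrable M (\<lambda>t. norm (A t f) powr q)"
  using A by (simp add: Ls_space_def)

text \<open>A real supremum bounds its members only when the set is bounded above; uniform
  boundedness supplies this. The constant \<open>2 powr q\<close> comes from bounding the norm of a
  sum by twice the larger norm.\<close>

lemma
  shows L_nonneg: "0 \<le> L"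
    and A_Ls: "(\<integral>t. norm (A t g) powr q \<partial>M) powr (1 / q) \<le> L * norm g"
proof -
  define N where "N f = (\<integral>t. norm (A t f) powr q \<partial>M) powr (1 / q)" for f
  have "\<exists>C\<ge>0. \<forall>f. (\<integral>t. norm (A t f) powr q \<partial>M) \<le> C * norm f powr q"
  proof (rule integral_form_bounded[where K = "2 powr q"])
    show "continuous_on UNIV (\<lambda>f. norm (A t f) powr q)" for t
      using q by (intro continuous_on_powr' continuous_intros) auto
    show "norm (A t (f + g)) powr q
        \<le> 2 powr q * (norm (A t f) powr q + norm (A t g) powr q)" for t f g
    proof -
      define m where "m = max (norm (A t f)) (norm (A t g))"
      have m: "0 \<le> m" by (simp add: m_def max_def)
      have "norm (A t (f + g)) \<le> 2 * m"
        using norm_triangle_ineq[of "A t f" "A t g"]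
        by (auto simp: m_def blinfun.add_right)
      hence "norm (A t (f + g)) powr q \<le> (2 * m) powr q"
        using q by (intro powr_mono2) auto
      also have "\<dots> = 2 powr q * m powr q" using m by (simp add: powr_mult)
      also have "m powr q \<le> norm (A t f) powr q + norm (A t g) powr q"
        by (simp add: m_def max_def)
      finally show ?thesis by simp
    qed
    show "norm (A t (r *\<^sub>R f)) powr q = \<bar>r\<bar> powr q * norm (A t f) powr q" for t r f
      by (simp add: blinfun.scaleR_right powr_mult)
  qed (use A_powr_integrable in auto)
  then obtain C where C: "C \<ge> 0" "\<And>f. (\<integral>t. norm (A t f) powr q \<partial>M) \<le> C * norm f powr q"
    by blast
  have bdd: "bdd_above (N ` {f. norm f = 1})"
  proof (rule bdd_aboveI2)
    show "N f \<le> C powr (1 / q)" if "f \<in> {f. norm f = 1}" for f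
      unfolding N_def using C(2)[of f] that q
      by (intro powr_mono2) (auto intro: Bochner_Integration.integral_nonneg)
  qed
  have unit: "N f \<le> L" if "norm f = 1" for f
    unfolding Ls_norm_def N_def[symmetric] using bdd that by (intro cSUP_upper) auto
  obtain f :: 'h where "norm f = 1" using infinite_dim_orthogonal_unit[OF inf, of "{}"] by auto
  hence "N f \<le> L" by (rule unit)
  moreover have "0 \<le> N f" by (simp add: N_def)
  ultimately show "0 \<le> L" by linarith
  show "(\<integral>t. norm (A t g) powr q \<partial>M) powr (1 / q) \<le> L * norm g"
  proof (cases "g = 0")
    case False
    define g' where "g' = (1 / norm g) *\<^sub>R g"
    have g': "norm g' = 1" "g = norm g *\<^sub>R g'" using False by (simp_all add: g'_def)
    have "(\<integral>t. norm (A t g) powr q \<partial>M)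
        = (\<integral>t. norm g powr q * norm (A t g') powr q \<partial>M)"
      by (subst g'(2)) (simp add: blinfun.scaleR_right powr_mult)
    also have "\<dots> = norm g powr q * (\<integral>t. norm (A t g') powr q \<partial>M)" by simp
    finally have "(\<integral>t. norm (A t g) powr q \<partial>M) powr (1 / q)
        = (norm g powr q) powr (1 / q) * N g'"
      by (simp add: N_def powr_mult Bochner_Integration.integral_nonneg)
    also have "(norm g powr q) powr (1 / q) = norm g" using q by (simp add: powr_powr)
    also have "norm g * N g' \<le> norm g * L" using unit[OF g'(1)] by (rule mult_left_mono) simp
    finally show ?thesis by (simp add: mult.commute)
  qed simp
qed

lemma B_powr_le: "t \<in> space M \<Longrightarrow> norm f \<le> 1 \<Longrightarrow>
    norm (B t f) powr p \<le> inner (S t f) f"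
  by (rule norm_powr_le_op_powr_abs[OF B_ops p])

lemma B_powr_integrable: "integrable M (\<lambda>t. norm (B t f) powr p)"
proof -
  have unit: "integrable M (\<lambda>t. norm (B t f) powr p)" if "norm f \<le> 1" for f
    by (rule Bochner_Integration.integrable_bound[OF inner_S_integrable[of f]])
      (use B_powr_le[OF _ that] pos_opD(4)[OF pos_S] in \<open>auto intro!: AE_I2\<close>)
  have "integrable M (\<lambda>t. norm f powr p * norm (B t ((1 / norm f) *\<^sub>R f)) powr p)"
    using unit[of "(1 / norm f) *\<^sub>R f"] by simp
  thus ?thesis
    by (cases "f = 0") (simp_all add: blinfun.scaleR_right flip: powr_mult)
qed

lemma B_powr_T:
  assumes "E \<in> sets M" "norm f \<le> 1"
  shows "(LINT t:E|M. norm (B t f) powr p) \<le> inner (T E f) f"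
  unfolding inner_T[OF assms(1)]
proof (rule set_integral_mono)
  show "set_integrable M E (\<lambda>t. norm (B t f) powr p)"
    "set_integrable M E (\<lambda>t. inner (S t f) f)"
    unfolding set_integrable_def
    by (intro integrable_mult_indicator assms(1) B_powr_integrable inner_S_integrable)+
qed (use assms sets.sets_into_space B_powr_le in blast)

lemma product_cinner:
  "t \<in> space M \<Longrightarrow> cinner ((adj (A t) o\<^sub>L B t) f) g
    = cinner (B t f) (A t g)"
  by (simp add: cinner_adj_left[OF A_ops])

lemma p_gt_1: "1 < p" using p by simp

lemma product_integrable:
  "integrable M (\<lambda>t. cinner ((adj (A t) o\<^sub>L B t) f) g)"
proof -
  have m: "(\<lambda>t. cinner (B t f) (A t g)) \<in> borel_measurable M"
    by (rule borel_measurable_cinner_weak[OF sep])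
      (use A B in \<open>simp_all add: weak_measurable_cinner[OF complete] Ls_space_def LG_space_def\<close>)
  have "integrable M (\<lambda>t. norm (B t f) * norm (A t g))"
    by (rule Holder_integral(1)[OF p_gt_1 q pq]) (use B_powr_integrable A_powr_integrable in auto)
  hence "integrable M (\<lambda>t. cinner (B t f) (A t g))"
    by (rule Bochner_Integration.integrable_bound) (use m cmod_cinner_le in auto)
  thus ?thesis
    by (rule Bochner_Integration.integrable_cong[OF refl, THEN iffD1, rotated])
      (rule product_cinner[symmetric])
qed

lemma product_weak_integrable: "weak_integrable M (\<lambda>t. adj (A t) o\<^sub>L B t)"
  unfolding weak_integrable_def weak_measurable_def
  by (intro conjI allI ballI product_integrable integrable_mu_measurable bounded_ops_comp
      adj_bounded A_ops B_ops)

text \<open>The indicator of \<open>E\<close> is attached to the factor with \<open>B\<close>, so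
  that restriction to \<open>E\<close> survives in the bound, while \<open>A\<close> is integrated
  over the whole space to produce \<open>L\<close>.\<close>

lemma product_bound:
  assumes E: "E \<in> sets M"
  shows "cmod (LINT t:E|M. cinner ((adj (A t) o\<^sub>L B t) f) g)
    \<le> (LINT t:E|M. norm (B t f) powr p) powr (1 / p) * (L * norm g)"
proof -
  define u v where "u t = indicator E t * norm (B t f)"
    and "v t = norm (A t g)" for t
  have [measurable]: "E \<in> sets M" by (rule E)
  have up: "u t powr p = indicator E t * norm (B t f) powr p" for t
    by (simp add: u_def indicator_def)
  have iu: "integrable M (\<lambda>t. u t powr p)"
    unfolding up using integrable_mult_indicator[OF E B_powr_integrable[of f]] by simp
  have iv: "integrable M (\<lambda>t. v t powr q)" unfolding v_def by (rule A_powr_integrable)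
  have meas: "u \<in> borel_measurable M" "v \<in> borel_measurable M"
    unfolding u_def[abs_def] v_def[abs_def] by measurable
  note H = Holder_integral[OF p_gt_1 q pq meas _ _ iu iv]
  have "cmod (LINT t:E|M. cinner ((adj (A t) o\<^sub>L B t) f) g)
      \<le> (\<integral>t. cmod (indicator E t *\<^sub>R cinner ((adj (A t) o\<^sub>L B t) f) g) \<partial>M)"
    unfolding set_lebesgue_integral_def by (rule integral_norm_bound)
  also have "\<dots> \<le> (\<integral>t. u t * v t \<partial>M)"
  proof (rule integral_mono)
    show "integrable M (\<lambda>t. cmod (indicator E t *\<^sub>R cinner ((adj (A t) o\<^sub>L B t) f) g))"
      by (intro integrable_norm integrable_mult_indicator[OF E product_integrable])
    show "integrable M (\<lambda>t. u t * v t)" by (rule H(1)) (simp_all add: u_def v_def)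
    show "cmod (indicator E t *\<^sub>R cinner ((adj (A t) o\<^sub>L B t) f) g) \<le> u t * v t"
      if "t \<in> space M" for t
      unfolding product_cinner[OF that] u_def v_def using cmod_cinner_le
      by (auto simp: indicator_def)
  qed
  also have "\<dots> \<le> (\<integral>t. u t powr p \<partial>M) powr (1 / p) * (\<integral>t. v t powr q \<partial>M) powr (1 / q)"
    by (rule H(2)) (simp_all add: u_def v_def)
  also have "\<dots> \<le> (\<integral>t. u t powr p \<partial>M) powr (1 / p) * (L * norm g)"
    unfolding v_def by (intro mult_left_mono A_Ls) simp
  finally show ?thesis by (simp add: up set_lebesgue_integral_def)
qed

text \<open>Existence of the weak* integral needs a bound linear in \<open>norm f\<close>; Jensen's
  inequality at the normalized \<open>f\<close> provides it.\<close>

lemma product_weak_bound: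
  assumes E: "E \<in> sets M"
  shows "cmod (LINT t:E|M. cinner ((adj (A t) o\<^sub>L B t) f) g)
    \<le> norm (T E) powr (1 / p) * L * norm f * norm g"
proof -
  have "(LINT t:E|M. norm (B t f) powr p) powr (1 / p) \<le> norm (T E) powr (1 / p) * norm f"
  proof (cases "f = 0")
    case False
    define f' where "f' = (1 / norm f) *\<^sub>R f"
    have f': "norm f' = 1" "f = norm f *\<^sub>R f'" using False by (simp_all add: f'_def)
    have "(LINT t:E|M. norm (B t f) powr p)
        = norm f powr p * (LINT t:E|M. norm (B t f') powr p)"
      by (subst f'(2)) (simp add: blinfun.scaleR_right powr_mult)
    also have "\<dots> \<le> norm f powr p * norm (T E)"
      using B_powr_T[OF E, of f'] inner_blinfun_le[of "T E" f'] f'(1)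
      by (intro mult_left_mono) auto
    finally have "(LINT t:E|M. norm (B t f) powr p) powr (1 / p)
        \<le> (norm f powr p * norm (T E)) powr (1 / p)"
      using p by (intro powr_mono2) (auto simp: set_lebesgue_integral_def
        intro!: Bochner_Integration.integral_nonneg)
    also have "\<dots> = norm (T E) powr (1 / p) * norm f"
      using p by (simp add: powr_mult powr_powr)
    finally show ?thesis .
  qed simp
  hence "(LINT t:E|M. norm (B t f) powr p) powr (1 / p) * (L * norm g)
      \<le> norm (T E) powr (1 / p) * norm f * (L * norm g)"
    by (rule mult_right_mono) (simp add: L_nonneg)
  with product_bound[OF E, of f g] show ?thesis by (simp add: mult_ac)
qed

lemma X_ops: "E \<in> sets M \<Longrightarrow> X E \<in> bounded_ops"
  by (rule weak_integral_bounded[OF product_weak_integrable _ product_weak_bound])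

lemma cinner_X: "E \<in> sets M \<Longrightarrow> cinner (X E f) g
    = (LINT t:E|M. cinner ((adj (A t) o\<^sub>L B t) f) g)"
  by (rule cinner_weak_integral[OF product_weak_integrable _ product_weak_bound])

text \<open>Testing the weak integral against \<open>X E f\<close> itself cancels one factor of its
  norm. The restriction to the unit ball is inherited from Jensen's inequality.\<close>

theorem norm_X_powr_le:
  assumes E: "E \<in> sets M" and f: "norm f \<le> 1"
  shows "norm (X E f) powr p \<le> L powr p * inner (T E f) f"
proof -
  define I where "I = (LINT t:E|M. norm (B t f) powr p)"
  have I: "0 \<le> I" unfolding I_def set_lebesgue_integral_def
    by (intro Bochner_Integration.integral_nonneg) simp
  define x where "x = X E f"
  have "norm x \<le> L * I powr (1 / p)"
  proof (cases "x = 0")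
    case False
    have "(norm x)\<^sup>2 = cmod (cinner x x)" by (simp add: cinner_self norm_power)
    also have "\<dots> = cmod (LINT t:E|M. cinner ((adj (A t) o\<^sub>L B t) f) x)"
      by (subst x_def) (simp add: cinner_X[OF E])
    also have "\<dots> \<le> I powr (1 / p) * (L * norm x)"
      unfolding I_def by (rule product_bound[OF E])
    finally show ?thesis using False by (simp add: power2_eq_square mult_ac)
  qed (simp add: L_nonneg)
  hence "norm x powr p \<le> (L * I powr (1 / p)) powr p" using p by (intro powr_mono2) auto
  also have "\<dots> = L powr p * I" using p I by (simp add: powr_mult powr_powr L_nonneg)
  also have "\<dots> \<le> L powr p * inner (T E f) f"
    unfolding I_def using B_powr_T[OF E f] by (rule mult_left_mono) simp
  finally show ?thesis by (simp add: x_def)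
qed

end

section \<open>Ideal membership and countable additivity\<close>

text \<open>The tolerance in \<open>sn_ideal0\<close> is extended real and may be infinite; a
  smaller positive real is needed to choose constants.\<close>

lemma ennreal_pos_below:
  fixes a :: ennreal
  assumes "0 < a" obtains e :: real where "0 < e" "ennreal e < a"
proof -
  obtain b where b: "0 < b" "b < a" using dense[OF assms] by blast
  hence "b < top" by (meson order.strict_trans2 top_greatest)
  then obtain e where "0 \<le> e" "b = ennreal e" by (cases b) auto
  thus thesis using b that[of e] by (auto simp: le_less)
qed

lemma finite_rank_comp_proj:
  fixes X Q :: "'h::complex_hilbert \<Rightarrow>\<^sub>L 'h"
  assumes X: "X \<in> bounded_ops" and Q: "\<And>x. Q x = proj e {..<r::nat} x"
  shows "finite_rank (X o\<^sub>L Q)"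
  unfolding finite_rank_def
proof (intro exI conjI)
  show "finite (blinfun_apply X ` e ` {..<r})" by simp
  show "range (blinfun_apply (X o\<^sub>L Q)) \<subseteq> complex_vector.span (blinfun_apply X ` e ` {..<r})"
    by (auto simp: Q proj_def blinfun.sum_right bounded_opsD[OF X]
        intro!: complex_vector.span_sum complex_vector.span_scale intro: complex_vector.span_base)
qed

context operator_Hoelder
begin

text \<open>Cauchy--Schwarz for the form of \<open>T E\<close> and its domination by the form over
  the whole space fit the compactness criterion with exponent 2.\<close>

lemma compact_T:
  assumes "compact_op (T (space M))" and E: "E \<in> sets M" shows "compact_op (T E)"
proof (rule compact_op_of_form[OF assms(1), where p = 2])
  fix x
  have "(norm (T E x))\<^sup>2 \<le> norm (T E) * inner (T E x) x"
    using pos_opD(3,4)[OF pos_T[OF E]] by (rule norm_positive_form)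
  also have "\<dots> \<le> norm (T E) * inner (T (space M) x) x"
    by (intro mult_left_mono inner_T_mono[OF E]) simp
  finally show "norm (T E x) powr 2 \<le> norm (T E) * inner (T (space M) x) x"
    by (simp add: powr_numeral)
qed simp_all

lemma compact_X:
  assumes "compact_op (T (space M))" and E: "E \<in> sets M" shows "compact_op (X E)"
  by (rule compact_op_of_form[OF compact_T[OF assms], where p = p and C = "L powr p"])
    (use norm_X_powr_le[OF E] p in auto)

lemma X_Un:
  assumes "E \<in> sets M" "F \<in> sets M" "E \<inter> F = {}"
  shows "X (E \<union> F) = X E + X F"
proof (rule bounded_ops_cinner_eqI)
  fix f g
  have "set_integrable M G (\<lambda>t. cinner ((adj (A t) o\<^sub>L B t) f) g)" if "G \<in> sets M" for G
    unfolding set_integrable_def by (rule integrable_mult_indicator[OF that product_integrable])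
  hence "(LINT t:E \<union> F|M. cinner ((adj (A t) o\<^sub>L B t) f) g)
      = (LINT t:E|M. cinner ((adj (A t) o\<^sub>L B t) f) g)
        + (LINT t:F|M. cinner ((adj (A t) o\<^sub>L B t) f) g)"
    using assms by (intro set_integral_Un) auto
  thus "cinner (X (E \<union> F) f) g = cinner ((X E + X F) f) g"
    using assms by (simp only: cinner_X sets.Un blinfun.add_left cinner_add_left)
qed

text \<open>Turns the remainder of the series into the integral over a tail union, so that countable
  additivity means convergence of these integrals to 0.\<close>

lemma X_tail:
  fixes E :: "nat \<Rightarrow> 'w set"
  assumes E: "range E \<subseteq> sets M" "disjoint_family E"
  shows "X (\<Union>i. E i) - (\<Sum>i<n. X (E i)) = X (\<Union>i\<in>{n..}. E i)"
proof (induction n)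
  case (Suc n)
  have m: "E n \<in> sets M" "(\<Union>i\<in>{Suc n..}. E i) \<in> sets M" using E(1) by auto
  have "{n..} = insert n {Suc n..}" by auto
  hence split: "(\<Union>i\<in>{n..}. E i) = E n \<union> (\<Union>i\<in>{Suc n..}. E i)"
    by (simp only: UN_insert)
  have "E n \<inter> E i = {}" if "i \<in> {Suc n..}" for i
  proof -
    have "n \<noteq> i" using that by auto
    thus ?thesis using E(2) unfolding disjoint_family_on_def by blast
  qed
  hence "E n \<inter> (\<Union>i\<in>{Suc n..}. E i) = {}" by blast
  hence "X (\<Union>i\<in>{n..}. E i) = X (E n) + X (\<Union>i\<in>{Suc n..}. E i)"
    unfolding split by (rule X_Un[OF m])
  moreover have "X (\<Union>i. E i) - (\<Sum>i<Suc n. X (E i)) = X (\<Union>i\<in>{n..}. E i) - X (E n)"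
    unfolding Suc[symmetric] by simp
  ultimately show ?case by simp
qed (simp add: atLeast_0)

lemma inner_T_tail_tendsto_0:
  fixes E :: "nat \<Rightarrow> 'w set"
  assumes E: "range E \<subseteq> sets M" "disjoint_family E"
  shows "(\<lambda>n. inner ((T (\<Union>i\<in>{n..}. E i)) f) f) \<longlonglongrightarrow> 0"
proof -
  have m: "(\<Union>i\<in>{n..}. E i) \<in> sets M" for n using E(1) by auto
  have "t \<notin> (\<Inter>n. \<Union>i\<in>{n..}. E i)" for t
  proof
    assume t: "t \<in> (\<Inter>n. \<Union>i\<in>{n..}. E i)"
    then obtain i where i: "t \<in> E i" by blast
    from t obtain j where j: "j \<ge> Suc i" "t \<in> E j" by blast
    from j(1) have "i \<noteq> j" by simp
    with i j(2) E(2) show False unfolding disjoint_family_on_def by blast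
  qed
  hence empty: "(\<Inter>n. \<Union>i\<in>{n..}. E i) = {}" by blast
  have "(\<lambda>n. LINT t:(\<Union>i\<in>{n..}. E i)|M. inner (S t f) f)
      \<longlonglongrightarrow> (LINT t:(\<Inter>n. \<Union>i\<in>{n..}. E i)|M. inner (S t f) f)"
  proof (rule set_integral_cont_down[OF m])
    show "decseq (\<lambda>n. \<Union>i\<in>{n..}. E i)" by (intro decseq_SucI UN_mono) auto
    show "set_integrable M (\<Union>i\<in>{0..}. E i) (\<lambda>t. inner (S t f) f)"
      unfolding set_integrable_def by (rule integrable_mult_indicator[OF m inner_S_integrable])
  qed
  thus ?thesis unfolding empty by (simp add: inner_T[OF m] set_lebesgue_integral_def)
qed

end

section \<open>Singular value estimates for the integral\<close>

locale operator_Hoelder_ideal = operator_Hoelder M p q A B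
  for M :: "'w measure" and p q :: real and A B :: "'w \<Rightarrow> 'h::complex_hilbert \<Rightarrow>\<^sub>L 'h" +
  fixes \<Phi> :: "(nat \<Rightarrow> complex) \<Rightarrow> real"
  assumes sn: "sn_function \<Phi>" and ideal: "T (space M) \<in> sn_ideal0 \<Phi>"
begin

abbreviation "T0 \<equiv> T (space M)"

lemma T0: "pos_op T0" "compact_op T0"
  using pos_T[OF sets.top] ideal by (auto simp: sn_ideal0_def sn_ideal_def)

lemma p_pos: "0 < p" using p by simp

lemma T0_sing_vals_nonneg: "0 \<le> sing_vals T0 n"
  by (rule sing_vals_compact[OF pos_opD(1)[OF T0(1)] T0(2) inf])

text \<open>The \<open>p\<close>-th root on the right undoes the power inside \<open>p_mod\<close>,
  so both sides are compared through \<Phi> on truncations, and suprema are taken last. The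
  eigenvectors are those of \<open>T E\<close>, which keeps the bound dependent on
  \<open>E\<close>.\<close>

lemma sn_norm_X_le:
  assumes E: "E \<in> sets M"
  shows "sn_norm (p_mod \<Phi> p) (X E) \<le> ennreal L * sn_norm (p_mod \<Phi> p) (op_powr (T E) (1 / p))"
proof -
  have TE: "pos_op (T E)" "compact_op (T E)" using pos_T[OF E] compact_T[OF T0(2) E] by auto
  have XE: "X E \<in> bounded_ops" "compact_op (X E)" using X_ops[OF E] compact_X[OF T0(2) E] by auto
  obtain e :: "nat \<Rightarrow> 'h" where e: "orthonormal e UNIV" "decseq (sing_vals (T E))"
    "sing_vals (T E) \<longlonglongrightarrow> 0"
    "\<And>n. 0 \<le> sing_vals (T E) n" "\<And>n. T E (e n) = sing_vals (T E) n *\<^sub>R e n"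
    "\<forall>n x. (\<forall>i<n. cinner x (e i) = 0) \<longrightarrow> inner (T E x) x \<le> sing_vals (T E) n * (norm x)\<^sup>2"
    "\<forall>r>0. sing_vals (op_powr (T E) r) = (\<lambda>n. sing_vals (T E) n powr r)"
    by (rule sing_vals_pos_op[OF TE inf], rule that)
  define s where "s = sing_vals (T E)"
  have s0: "0 \<le> s n" for n using e(4) by (simp add: s_def)
  have sX: "0 \<le> sing_vals (X E) n" for n by (rule sing_vals_compact[OF XE inf])
  have sum_le: "(\<Sum>i<n. norm (X E (f i)) powr p) \<le> (\<Sum>i<n. L powr p * s i)"
    if f: "orthonormal f {..<n}" for f n
  proof -
    have "(\<Sum>i<n. norm (X E (f i)) powr p) \<le> (\<Sum>i<n. L powr p * inner (T E (f i)) (f i))"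
      using orthonormal_norm[OF f] by (intro sum_mono norm_X_powr_le[OF E]) simp
    also have "\<dots> \<le> (\<Sum>i<n. L powr p * s i)"
      using Ky_Fan[OF TE(1) e(1,5,2) _ f, of 0] e(6)
      by (simp add: proj_def s_def mult_left_mono flip: sum_distrib_left)
    finally show ?thesis .
  qed
  have le: "phi \<Phi> (trunc n (\<lambda>k. sing_vals (X E) k powr p)) \<le> L powr p * phi \<Phi> (trunc n s)" for n
    unfolding phi_trunc_scale[OF sn powr_ge_zero, symmetric]
    by (rule phi_sing_vals_le[OF sn p_pos XE inf _ sum_le]) (simp_all add: s0)
  have root: "sing_vals (op_powr (T E) (1 / p)) = (\<lambda>n. s n powr (1 / p))"
    using e(7) p_pos by (simp add: s_def)
  have trunc_root:
    "phi (p_mod \<Phi> p) (trunc n (\<lambda>n. s n powr (1 / p))) = phi \<Phi> (trunc n s) powr (1 / p)" for n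
    using phi_p_mod[OF p_pos, of "\<lambda>n. s n powr (1 / p)" \<Phi> n] p_pos s0 by (simp add: powr_powr)
  have "ennreal (phi (p_mod \<Phi> p) (trunc n (sing_vals (X E))))
    \<le> ennreal L * sn_norm (p_mod \<Phi> p) (op_powr (T E) (1 / p))" for n
  proof -
    have "phi (p_mod \<Phi> p) (trunc n (sing_vals (X E)))
      = phi \<Phi> (trunc n (\<lambda>k. sing_vals (X E) k powr p)) powr (1 / p)"
      by (rule phi_p_mod[OF p_pos sX])
    also have "\<dots> \<le> (L powr p * phi \<Phi> (trunc n s)) powr (1 / p)"
      using p_pos le by (intro powr_mono2 phi_nonneg[OF sn]) auto
    also have "\<dots> = L * phi (p_mod \<Phi> p) (trunc n (\<lambda>n. s n powr (1 / p)))"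
      using p_pos L_nonneg phi_nonneg[OF sn] by (simp add: powr_mult powr_powr trunc_root)
    finally have "ennreal (phi (p_mod \<Phi> p) (trunc n (sing_vals (X E))))
        \<le> ennreal L * ennreal (phi (p_mod \<Phi> p) (trunc n (\<lambda>n. s n powr (1 / p))))"
      by (simp add: L_nonneg trunc_root flip: ennreal_mult)
    also have
      "ennreal (phi (p_mod \<Phi> p) (trunc n (\<lambda>n. s n powr (1 / p))))
        \<le> sn_norm (p_mod \<Phi> p) (op_powr (T E) (1 / p))"
      unfolding sn_norm_def root
      by (subst sn_ext_eq_SUP[OF incseq_phi_p_mod[OF sn p_pos]]) (auto intro: SUP_upper)
    finally show ?thesis by (simp add: mult_left_mono)
  qed
  thus ?thesis
    unfolding sn_norm_def[of _ "X E"]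
    by (subst sn_ext_eq_SUP[OF incseq_phi_p_mod[OF sn p_pos sX]]) (rule SUP_least)
qed

text \<open>
  The tail of the singular values of \<open>T0\<close> has small norm: by Weyl's inequality it is
  dominated by the singular values of \<open>T0 - F\<close> for a finite rank \<open>F\<close>.
\<close>

lemma T0_tail:
  assumes "0 < d" shows "\<exists>r. \<forall>n. phi \<Phi> (trunc n (\<lambda>i. sing_vals T0 (r + i))) \<le> d"
proof -
  have "\<forall>\<epsilon>>0. \<exists>F\<in>sn_ideal \<Phi>. finite_rank F \<and> sn_norm \<Phi> (T0 - F) < \<epsilon>"
    using ideal by (simp add: sn_ideal0_def)
  then obtain F where F: "F \<in> sn_ideal \<Phi>" "finite_rank F" "sn_norm \<Phi> (T0 - F) < ennreal d"
    using assms by (metis ennreal_less_zero_iff)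
  have FF: "F \<in> bounded_ops" "compact_op F" using F(1) by (auto simp: sn_ideal_def)
  have K: "T0 - F \<in> bounded_ops" "compact_op (T0 - F)"
    using T0 FF by (auto intro: bounded_ops_diff compact_op_diff pos_opD(1))
  obtain r where r: "\<And>i. sing_vals T0 (r + i) \<le> sing_vals (T0 - F) i"
    using sing_vals_finite_rank_perturbation[OF T0 FF F(2) inf] by blast
  have s1: "0 \<le> sing_vals (T0 - F) n" for n by (rule sing_vals_compact[OF K inf])
  have "phi \<Phi> (trunc n (\<lambda>i. sing_vals T0 (r + i))) \<le> d" for n
  proof -
    have "phi \<Phi> (trunc n (\<lambda>i. sing_vals T0 (r + i))) \<le> phi \<Phi> (trunc n (sing_vals (T0 - F)))"
      by (rule phi_trunc_le[OF sn T0_sing_vals_nonneg r])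
    also have "\<dots> < d"
      by (rule phi_le_of_sn_ext_less[OF sn s1 F(3)[unfolded sn_norm_def]])
    finally show ?thesis by simp
  qed
  thus ?thesis by blast
qed

lemma T0_bounded: "\<exists>V. \<forall>n. phi \<Phi> (trunc n (sing_vals T0)) \<le> V"
proof -
  have "sn_ext \<Phi> (\<lambda>n. of_real (sing_vals T0 n)) < top"
    using ideal by (simp add: sn_ideal0_def sn_ideal_def c_space_def)
  then obtain V where V: "0 \<le> V" "sn_ext \<Phi> (\<lambda>n. of_real (sing_vals T0 n)) = ennreal V"
    by (cases "sn_ext \<Phi> (\<lambda>n. of_real (sing_vals T0 n))") auto
  hence "phi \<Phi> (trunc n (sing_vals T0)) \<le> V" for n
    using phi_le_sn_ext[where x = "sing_vals T0" and n = n, OF sn T0_sing_vals_nonneg] by simp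
  thus ?thesis by blast
qed

text \<open>Keeps the two facts about eigenvectors of \<open>T0\<close> on which the estimates rest.
  The bound with \<open>r = 0\<close> is Ky Fan's principle; large \<open>r\<close> produces the
  small tails.\<close>

definition eigenbasis :: "(nat \<Rightarrow> 'h) \<Rightarrow> bool" where
  "eigenbasis e \<longleftrightarrow> orthonormal e UNIV \<and> (\<forall>f n r. orthonormal f {..<n} \<longrightarrow>
     (\<Sum>i<n. inner (T0 (f i - proj e {..<r} (f i))) (f i - proj e {..<r} (f i)))
       \<le> (\<Sum>i<n. sing_vals T0 (r + i)))"

lemma eigenbasis_exists: "\<exists>e. eigenbasis e"
proof -
  obtain e :: "nat \<Rightarrow> 'h" where e: "orthonormal e UNIV" "decseq (sing_vals T0)" "sing_vals T0 \<longlonglongrightarrow> 0"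
    "\<And>n. 0 \<le> sing_vals T0 n" "\<And>n. T0 (e n) = sing_vals T0 n *\<^sub>R e n"
    "\<forall>n x. (\<forall>i<n. cinner x (e i) = 0) \<longrightarrow> inner (T0 x) x \<le> sing_vals T0 n * (norm x)\<^sup>2"
    "\<forall>r>0. sing_vals (op_powr T0 r) = (\<lambda>n. sing_vals T0 n powr r)"
    by (rule sing_vals_pos_op[OF T0 inf], rule that)
  have "eigenbasis e"
    unfolding eigenbasis_def
    by (intro conjI allI impI e(1) Ky_Fan[OF T0(1) e(1,5,2)]) (use e(6) in auto)
  thus ?thesis by blast
qed

text \<open>With \<open>T0\<close> in place of \<open>T E\<close>, one choice of eigenvectors
  controls all measurable \<open>E\<close> at once.\<close>

lemma norm_X_powr_le_T0:
  assumes "E \<in> sets M" "norm f \<le> 1"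
  shows "norm (X E f) powr p \<le> L powr p * inner (T0 f) f"
  by (rule order_trans[OF norm_X_powr_le[OF assms]
        mult_left_mono[OF inner_T_mono[OF assms(1)]]]) simp

lemma sum_X_residual_le:
  assumes E: "E \<in> sets M" and e: "eigenbasis e" and f: "orthonormal f {..<n}"
  shows "(\<Sum>i<n. norm (X E (f i - proj e {..<r} (f i))) powr p)
    \<le> (\<Sum>i<n. L powr p * sing_vals T0 (r + i))"
proof -
  define g where "g i = f i - proj e {..<r} (f i)" for i
  have er: "orthonormal e {..<r}" using e unfolding eigenbasis_def
    by (blast intro: orthonormal_subset)
  have "norm (g i) \<le> 1" if "i < n" for i
    using norm_residual_le[OF finite_lessThan er, of "f i"] orthonormal_norm[OF f] that
    by (simp add: g_def)
  hence "(\<Sum>i<n. norm (X E (g i)) powr p) \<le> (\<Sum>i<n. L powr p * inner (T0 (g i)) (g i))"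
    by (intro sum_mono norm_X_powr_le_T0[OF E]) simp
  also have "\<dots> \<le> (\<Sum>i<n. L powr p * sing_vals T0 (r + i))"
    using e f unfolding eigenbasis_def by (simp add: g_def mult_left_mono flip: sum_distrib_left)
  finally show ?thesis by (simp add: g_def)
qed

lemma X_ideal:
  assumes E: "E \<in> sets M" shows "X E \<in> sn_ideal (p_mod \<Phi> p)"
proof -
  obtain e where e: "eigenbasis e" using eigenbasis_exists by blast
  obtain V where V: "\<And>n. phi \<Phi> (trunc n (sing_vals T0)) \<le> V" using T0_bounded by blast
  show ?thesis
  proof (rule sn_ideal_p_modI(1)[OF sn p_pos X_ops[OF E] compact_X[OF T0(2) E] inf])
    show "0 \<le> L powr p * sing_vals T0 k" for k by (simp add: T0_sing_vals_nonneg)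
    show "phi \<Phi> (trunc n (\<lambda>k. L powr p * sing_vals T0 k)) \<le> L powr p * V" for n
      using V by (simp add: phi_trunc_scale[OF sn] mult_left_mono)
    show "(\<Sum>i<n. norm (X E (f i)) powr p) \<le> (\<Sum>i<n. L powr p * sing_vals T0 i)"
      if "orthonormal f {..<n}" for n f
      using sum_X_residual_le[OF E e that, of 0] by (simp add: proj_def)
  qed
qed

text \<open>The constant \<open>d\<close> is tuned so that the factor \<open>L\<close> from the
  pointwise estimate is absorbed; \<open>L + 1\<close> replaces \<open>L\<close> because
  \<open>L\<close> may be 0.\<close>

lemma scaled_root_le:
  assumes "0 < e" "d = (e / (L + 1)) powr p"
  shows "0 < d" "(L powr p * d) powr (1 / p) \<le> e"
proof -
  have L1: "0 < L + 1" using L_nonneg by simp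
  thus "0 < d" using assms by simp
  have "(L powr p * d) powr (1 / p) = L * (e / (L + 1))"
    using L_nonneg L1 assms p_pos by (simp add: powr_mult powr_powr)
  also have "\<dots> \<le> (L + 1) * (e / (L + 1))" using L1 assms(1) by (intro mult_right_mono) auto
  also have "\<dots> = e" using L1 by simp
  finally show "(L powr p * d) powr (1 / p) \<le> e" .
qed

text \<open>\<open>Q\<close> projects onto the span of the first \<open>r\<close> eigenvectors of
  \<open>T0\<close>. The error \<open>X E - F\<close> is \<open>X E\<close> applied to residuals, so
  a tail of the singular values controls it; \<open>F\<close> itself must also be placed in the
  ideal.\<close>

theorem X_ideal0:
  assumes E: "E \<in> sets M" shows "X E \<in> sn_ideal0 (p_mod \<Phi> p)"
  unfolding sn_ideal0_def
proof (intro CollectI conjI X_ideal[OF E] allI impI)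
  fix \<epsilon> :: ennreal assume "0 < \<epsilon>"
  then obtain \<eta> where \<eta>: "0 < \<eta>" "ennreal \<eta> < \<epsilon>" by (rule ennreal_pos_below)
  define d where "d = (\<eta> / (L + 1)) powr p"
  note d = scaled_root_le[OF \<eta>(1) d_def]
  obtain r where r: "\<And>n. phi \<Phi> (trunc n (\<lambda>i. sing_vals T0 (r + i))) \<le> d"
    using T0_tail[OF d(1)] by blast
  obtain e where eb: "eigenbasis e" using eigenbasis_exists by blast
  hence e: "orthonormal e UNIV" by (simp add: eigenbasis_def)
  hence er: "orthonormal e {..<r}" by (rule orthonormal_subset) simp
  obtain Q where Q: "Q \<in> bounded_ops" "\<And>x. Q x = proj e {..<r} x"
    using proj_op[OF finite_lessThan er] by blast
  define F where "F = X E o\<^sub>L Q"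
  have Q1: "norm (Q x) \<le> norm x" for x
    unfolding Q(2) by (rule norm_proj_le[OF finite_lessThan er])
  have F: "F \<in> bounded_ops" "compact_op F" "finite_rank F"
    unfolding F_def
    using bounded_ops_comp[OF X_ops[OF E] Q(1)] compact_op_comp_right[OF compact_X[OF T0(2) E] Q1]
      finite_rank_comp_proj[OF X_ops[OF E] Q(2)] by auto
  have "F \<in> sn_ideal (p_mod \<Phi> p)"
  proof (rule sn_ideal_p_modI(1)[OF sn p_pos F(1,2) inf])
    \<comment> \<open>The factor \<open>r\<close> is the squared Hilbert--Schmidt norm of
      \<open>Q\<close>, which bounds the sum of squared norms of \<open>Q\<close> over any
      orthonormal family.\<close>
    define c where "c = norm (X E) powr p * r"
    show "0 \<le> (if k = 0 then c else 0)" for k :: nat by (simp add: c_def)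
    show "phi \<Phi> (trunc n (\<lambda>k. if k = 0 then c else 0)) \<le> c" for n
      by (rule phi_single[OF sn]) (simp add: c_def)
    fix n and f :: "nat \<Rightarrow> 'h" assume f: "orthonormal f {..<n}"
    show "(\<Sum>i<n. norm (F (f i)) powr p) \<le> (\<Sum>i<n. if i = 0 then c else 0)"
    \<comment> \<open>The whole mass sits at index 0, which is in the range of summation only for
      \<open>n > 0\<close>.\<close>
    proof (cases "n = 0")
      case False
      have "(\<Sum>i<n. norm (F (f i)) powr p)
          \<le> (\<Sum>i<n. norm (X E) powr p * (\<Sum>k<r. (cmod (cinner (f i) (e k)))\<^sup>2 * 1))"
      proof (rule sum_mono)
        fix i assume i: "i \<in> {..<n}"
        have n1: "norm (proj e {..<r} (f i)) \<le> 1"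
          using Q1[of "f i"] orthonormal_norm[OF f i] by (simp add: Q(2))
        have "norm (F (f i)) powr p \<le> (norm (X E) * norm (proj e {..<r} (f i))) powr p"
          using p_pos norm_blinfun[of "X E"] by (intro powr_mono2) (auto simp: F_def Q(2))
        also have "\<dots> = norm (X E) powr p * norm (proj e {..<r} (f i)) powr p"
          by (simp add: powr_mult)
        \<comment> \<open>A norm at most 1 and \<open>p\<close> \<ge> 2 allow the exponent to drop
          to 2, where Bessel's inequality applies.\<close>
        also have "\<dots> \<le> norm (X E) powr p * norm (proj e {..<r} (f i)) powr 2"
          using n1 p by (intro mult_left_mono powr_mono') auto
        finally show "norm (F (f i)) powr p
            \<le> norm (X E) powr p * (\<Sum>k<r. (cmod (cinner (f i) (e k)))\<^sup>2 * 1)"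
          by (simp add: powr_numeral norm_proj[OF finite_lessThan er])
      qed
      also have "\<dots> \<le> norm (X E) powr p * (\<Sum>k<r. 1)"
        unfolding sum_distrib_left[symmetric]
        by (intro mult_left_mono sum_norm_proj_le[OF f e]) auto
      finally show ?thesis using False by (simp add: c_def)
    qed simp
  qed
  moreover have "sn_norm (p_mod \<Phi> p) (X E - F) \<le> ennreal ((L powr p * d) powr (1 / p))"
  proof (rule sn_ideal_p_modI(2)[OF sn p_pos _ _ inf])
    show "X E - F \<in> bounded_ops" "compact_op (X E - F)"
      using X_ops[OF E] compact_X[OF T0(2) E] F by (auto intro: bounded_ops_diff compact_op_diff)
    show "0 \<le> L powr p * sing_vals T0 (r + k)" for k by (simp add: T0_sing_vals_nonneg)
    show "phi \<Phi> (trunc n (\<lambda>k. L powr p * sing_vals T0 (r + k))) \<le> L powr p * d" for n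
      using r by (simp add: phi_trunc_scale[OF sn] mult_left_mono)
    show "(\<Sum>i<n. norm ((X E - F) (f i)) powr p) \<le> (\<Sum>i<n. L powr p * sing_vals T0 (r + i))"
      if "orthonormal f {..<n}" for n f
      using sum_X_residual_le[OF E eb that, of r]
      by (simp add: F_def Q(2) blinfun.diff_left blinfun.diff_right)
  qed
  hence "sn_norm (p_mod \<Phi> p) (X E - F) < \<epsilon>"
    using d(2) \<eta>(2) by (meson ennreal_leI le_less_trans)
  ultimately show "\<exists>F\<in>sn_ideal (p_mod \<Phi> p). finite_rank F \<and> sn_norm (p_mod \<Phi> p) (X E - F) < \<epsilon>"
    using F(3) by blast
qed

text \<open>
  On the orthogonal complement of the first \<open>r\<close> eigenvectors of \<open>T0\<close> the form of \<open>T (G n)\<close> is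
  dominated by that of \<open>T0\<close>, which is small there; on their span it tends to \<open>0\<close> by dominated
  convergence.
\<close>

theorem X_countably_additive: "sn_countably_additive M (p_mod \<Phi> p) X"
  unfolding sn_countably_additive_def
proof (intro allI impI)
  fix E :: "nat \<Rightarrow> 'w set" assume E: "range E \<subseteq> sets M" "disjoint_family E"
  define G where "G n = (\<Union>i\<in>{n..}. E i)" for n
  have G: "G n \<in> sets M" for n using E(1) by (auto simp: G_def)
  have "(\<lambda>n. sn_norm (p_mod \<Phi> p) (X (G n))) \<longlonglongrightarrow> 0"
  proof (rule order_tendstoI)
    fix \<epsilon> :: ennreal assume "0 < \<epsilon>"
    then obtain \<eta> where \<eta>: "0 < \<eta>" "ennreal \<eta> < \<epsilon>" by (rule ennreal_pos_below)
    define d where "d = (\<eta> / (L + 1)) powr p"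
    note d = scaled_root_le[OF \<eta>(1) d_def]
    \<comment> \<open>Tail and head each enter with a factor 2 from splitting the form; a quarter of
      \<open>d\<close> for each gives \<open>d\<close> in total.\<close>
    obtain r where r: "\<And>n. phi \<Phi> (trunc n (\<lambda>i. sing_vals T0 (r + i))) \<le> d / 4"
      using T0_tail[of "d / 4"] d(1) by auto
    obtain e where eb: "eigenbasis e" using eigenbasis_exists by blast
    hence e: "orthonormal e UNIV" by (simp add: eigenbasis_def)
    define c where "c m k = inner (T (G m) (e k)) (e k)" for m k
    have c0: "0 \<le> c m k" for m k using pos_opD(4)[OF pos_T[OF G]] by (simp add: c_def)
    \<comment> \<open>The factor \<open>r\<close> comes from splitting the form over
      \<open>r\<close> eigenvectors. By Bessel's inequality \<open>b m\<close> bounds the total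
      contribution of the heads over any orthonormal family, uniformly in its length.\<close>
    define b where "b m = real r * (\<Sum>k<r. c m k)" for m
    have b0: "0 \<le> b m" for m using c0 by (simp add: b_def sum_nonneg)
    have "b \<longlonglongrightarrow> real r * (\<Sum>k<r. 0)"
      unfolding b_def c_def G_def by (intro tendsto_intros inner_T_tail_tendsto_0[OF E])
    hence "\<forall>\<^sub>F m in sequentially. b m < d / 4" using d(1) by (intro order_tendstoD(2)) auto
    thus "\<forall>\<^sub>F m in sequentially. sn_norm (p_mod \<Phi> p) (X (G m)) < \<epsilon>"
    proof eventually_elim
      case (elim m)
      define y where
        "y k = L powr p * (2 * sing_vals T0 (r + k) + 2 * (if k = 0 then b m else 0))" for k
      have "sn_norm (p_mod \<Phi> p) (X (G m)) \<le> ennreal ((L powr p * d) powr (1 / p))"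
      proof (rule sn_ideal_p_modI(2)[OF sn p_pos X_ops[OF G] compact_X[OF T0(2) G] inf])
        show "0 \<le> y k" for k using b0 by (simp add: y_def T0_sing_vals_nonneg)
        show "phi \<Phi> (trunc n y) \<le> L powr p * d" for n
        proof -
          define s t where "s = trunc n (\<lambda>i. sing_vals T0 (r + i))" and
            "t = trunc n (\<lambda>k. if k = 0 then b m else 0)"
          have fin: "rfin s" "rfin t" "rfin (\<lambda>k. 2 * s k)" "rfin (\<lambda>k. 2 * t k)"
            "rfin (\<lambda>k. 2 * s k + 2 * t k)"
            unfolding s_def t_def rfin_def trunc_def by (auto intro: exI[of _ n])
          have "trunc n y = (\<lambda>k. L powr p * (2 * s k + 2 * t k))"
            by (auto simp: trunc_def y_def s_def t_def)
          hence "phi \<Phi> (trunc n y) = L powr p * phi \<Phi> (\<lambda>k. 2 * s k + 2 * t k)"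
            using phi_scale[OF sn fin(5)] by simp
          also have "phi \<Phi> (\<lambda>k. 2 * s k + 2 * t k) \<le> 2 * phi \<Phi> s + 2 * phi \<Phi> t"
            using phi_add[OF sn fin(3,4)] phi_scale[OF sn fin(1), of 2]
              phi_scale[OF sn fin(2), of 2] by simp
          also have "\<dots> \<le> 2 * (d / 4) + 2 * (d / 4)"
            using r[of n] phi_single[OF sn b0, of n m] elim unfolding s_def t_def by linarith
          finally show ?thesis by (simp add: mult_left_mono)
        qed
        fix n and f :: "nat \<Rightarrow> 'h" assume f: "orthonormal f {..<n}"
        define g where "g i = f i - proj e {..<r} (f i)" for i
        have "(\<Sum>i<n. norm (X (G m) (f i)) powr p)
            \<le> (\<Sum>i<n. L powr p * (2 * inner (T0 (g i)) (g i)
                + 2 * (real r * (\<Sum>k<r. (cmod (cinner (f i) (e k)))\<^sup>2 * c m k))))"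
        proof (rule sum_mono)
          fix i assume i: "i \<in> {..<n}"
          define h where "h = proj e {..<r} (f i)"
          have "norm (X (G m) (f i)) powr p \<le> L powr p * inner (T (G m) (f i)) (f i)"
            using orthonormal_norm[OF f i] by (intro norm_X_powr_le[OF G]) simp
          also have "inner (T (G m) (f i)) (f i)
              \<le> 2 * inner (T (G m) (g i)) (g i) + 2 * inner (T (G m) h) h"
          proof -
            have "f i = g i + h" by (simp add: g_def h_def)
            \<comment> \<open>Nonnegativity of the form at \<open>g i - h\<close> bounds the mixed
              terms by the two diagonal ones.\<close>
            thus ?thesis
              using pos_opD(4)[OF pos_T[OF G[of m]], of "g i - h"]
              by (simp add: blinfun.bilinear_simps inner_add_left inner_add_right inner_diff_left inner_diff_right)
          qed
          also have "inner (T (G m) (g i)) (g i) \<le> inner (T0 (g i)) (g i)"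
            by (rule inner_T_mono[OF G])
          also have "inner (T (G m) h) h \<le> real r * (\<Sum>k<r. (cmod (cinner (f i) (e k)))\<^sup>2 * c m k)"
            using pos_op_form_sum_le[OF pos_T[OF G[of m]], of "{..<r}"
              "\<lambda>k. cinner (f i) (e k) *\<^sub>C e k"]
            by (simp add: h_def proj_def pos_op_form_scaleC[OF pos_T[OF G]] c_def)
          finally show "norm (X (G m) (f i)) powr p
              \<le> L powr p * (2 * inner (T0 (g i)) (g i)
                + 2 * (real r * (\<Sum>k<r. (cmod (cinner (f i) (e k)))\<^sup>2 * c m k)))"
            by (simp add: mult_left_mono)
        qed
        also have "\<dots> = L powr p * (2 * (\<Sum>i<n. inner (T0 (g i)) (g i))
            + 2 * (real r * (\<Sum>i<n. \<Sum>k<r. (cmod (cinner (f i) (e k)))\<^sup>2 * c m k)))"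
          by (simp add: sum.distrib flip: sum_distrib_left)
        also have "\<dots> \<le> (\<Sum>i<n. y i)"
        proof (cases "n = 0")
          case False
          have "(\<Sum>i<n. inner (T0 (g i)) (g i)) \<le> (\<Sum>i<n. sing_vals T0 (r + i))"
            using eb f unfolding eigenbasis_def g_def by blast
          moreover have "real r * (\<Sum>i<n. \<Sum>k<r. (cmod (cinner (f i) (e k)))\<^sup>2 * c m k) \<le> b m"
            unfolding b_def by (intro mult_left_mono sum_norm_proj_le[OF f e c0]) simp
          ultimately have "L powr p * (2 * (\<Sum>i<n. inner (T0 (g i)) (g i))
              + 2 * (real r * (\<Sum>i<n. \<Sum>k<r. (cmod (cinner (f i) (e k)))\<^sup>2 * c m k)))
              \<le> L powr p * (2 * (\<Sum>i<n. sing_vals T0 (r + i)) + 2 * b m)"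
            by (intro mult_left_mono) auto
          also have "\<dots> = (\<Sum>i<n. y i)"
            using False by (simp add: y_def sum.distrib flip: sum_distrib_left)
          finally show ?thesis .
        qed simp
        finally show "(\<Sum>i<n. norm (X (G m) (f i)) powr p) \<le> (\<Sum>i<n. y i)" .
      qed
      thus ?case using d(2) \<eta>(2) by (meson ennreal_leI le_less_trans)
    qed
  qed simp
  thus "(\<lambda>n. sn_norm (p_mod \<Phi> p) (X (\<Union>i. E i) - (\<Sum>i<n. X (E i)))) \<longlonglongrightarrow> 0"
    unfolding X_tail[OF E] G_def .
qed

end

theorem theorem4p2:
  fixes M :: "'w measure"
    and \<Phi> :: "(nat \<Rightarrow> complex) \<Rightarrow> real"
    and p q :: real
    and A B :: "'w \<Rightarrow> 'h::complex_hilbert \<Rightarrow>\<^sub>L 'h"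
  assumes "separable_space (euclidean :: 'h topology)"
    and "\<not> (\<exists>S :: 'h set. finite S \<and> complex_vector.span S = UNIV)"
    and "complete_measure M"
    and "sn_function \<Phi>"
    and "1 < q" and "q \<le> 2" and "2 \<le> p" and "1 / p + 1 / q = 1"
    and "A \<in> Ls_space M q"
    and "B \<in> LG_space M p"
    and "weak_integral M (space M) (\<lambda>t. op_powr (op_abs (B t)) p) \<in> sn_ideal0 \<Phi>"
  shows "weak_integrable M (\<lambda>t. adj (A t) o\<^sub>L B t) \<and>
    (\<forall>E\<in>sets M.
       weak_integral M E (\<lambda>t. adj (A t) o\<^sub>L B t) \<in> sn_ideal0 (p_mod \<Phi> p) \<and>
       sn_norm (p_mod \<Phi> p) (weak_integral M E (\<lambda>t. adj (A t) o\<^sub>L B t))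
         \<le> ennreal (Ls_norm M q A) *
           sn_norm (p_mod \<Phi> p)
             (op_powr (weak_integral M E (\<lambda>t. op_powr (op_abs (B t)) p)) (1 / p))) \<and>
    sn_countably_additive M (p_mod \<Phi> p) (\<lambda>E. weak_integral M E (\<lambda>t. adj (A t) o\<^sub>L B t))"
proof -
  interpret operator_Hoelder_ideal M p q A B \<Phi>
    using assms
    by (intro operator_Hoelder_ideal.intro operator_Hoelder.intro operator_Hoelder_ideal_axioms.intro)
      (simp_all add: infinite_dim_def)
  show ?thesis
    using product_weak_integrable X_ideal0 sn_norm_X_le X_countably_additive by blast
qed

end
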